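(* Let $R$ be a left Noetherian ring with finite left Krull dimension $\mathrm{lKdim}(R)$, and let $A=\sigma(R)\langle x_1,\dots,x_n\rangle$ be a bijective skew PBW extension of $R$ in $n$ variables $x_1,\dots,x_n$. Then $$1\leq \mathrm{sr}(A)\leq \mathrm{lKdim}(R)+n+1,$$ and $A$ is $d$-Hermite, where $d:=\mathrm{lKdim}(R)+n+1$.
   Context: Rings are associative with identity; modules are left modules. Standing assumption: every ring $S$ considered satisfies the rank condition, i.e. for all integers $r,s\ge 1$, if there is an epimorphism of left $S$-modules $S^r\to S^s$ then $r\ge s$. $\mathrm{lKdim}$ denotes the left (Gabriel–Rentschler) Krull dimension of a ring. Skew PBW extension: Let $R\subseteq A$ be rings. $A$ is a skew PBW extension of $R$, written $A=\sigma(R)\langle x_1,\dots,x_n\rangle$, if there are finitely many elements $x_1,\dots,x_n\in A$ such that: (1) $A$ is a left free $R$-module with basis $\{x_1^{\alpha_1}\cdots x_n^{\alpha_n}\mid (\alpha_1,\dots,\alpha_n)\in\mathbb{N}^n\}$ (with $0\in\mathbb{N}$); (2) for every $1\le i\le n$ and $r\in R\setminus\{0\}$ there is $c_{i,r}\in R\setminus\{0\}$ with $x_ir-c_{i,r}x_i\in R$; (3) for all $1\le i,j\le n$ there is $c_{i,j}\in R\setminus\{0\}$ with $x_jx_i-c_{i,j}x_ix_j\in R+Rx_1+\cdots+Rx_n$. In this situation, for every $i$ there are an injective ring endomorphism $\sigma_i:R\to R$ and a $\sigma_i$-derivation $\delta_i:R\to R$ with $x_ir=\sigma_i(r)x_i+\delta_i(r)$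 for all $r\in R$. $A$ is bijective if every $\sigma_i$ is bijective and $c_{i,j}$ is invertible for all $1\le i<j\le n$. Stable rank: a column vector $v=(v_1,\dots,v_r)^T$ over a ring $S$ is unimodular if it has a left inverse (i.e. $\sum_i b_iv_i=1$ for some $b_i\in S$). A unimodular column $v$ of length $r$ is stable if there are $a_1,\dots,a_{r-1}\in S$ such that $(v_1+a_1v_r,\dots,v_{r-1}+a_{r-1}v_r)^T$ is unimodular. The stable rank $\mathrm{sr}(S)$ is the least integer $d\ge 1$ such that every unimodular column vector of length $d+1$ over $S$ is stable, and $\mathrm{sr}(S)=\infty$ if there is no such $d$. $d$-Hermite: an $S$-module $M$ is stably free of rank $t\ge 0$ if $S^{s+t}\cong S^s\oplus M$ for some integer $s\ge 0$. For an integer $d\ge 0$, $S$ is $d$-Hermite if every stably free $S$-module of rank $\ge d$ is free (equivalently, every unimodular, i.e. right invertible, row over $S$ of length $\ge d+1$ can be completed to an invertible matrix over $S$). *)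

theory Defs
  imports "HOL-Algebra.Algebra" "HOL-Library.Extended_Nat"
begin

section \<open>Left modules over an arbitrary ring\<close>

text \<open>The library locale \<open>module\<close> requires a commutative ring of scalars. The following is the same
  locale over an arbitrary ring. As there, the fields \<open>mult\<close> and \<open>one\<close> of a module record carry no
  meaning here.\<close>

locale left_module = S?: ring S + M?: abelian_group M
  for S :: "('a, 's) ring_scheme" (structure) and M :: "('a, 'm, 'x) module_scheme" (structure) +
  assumes smult_closed:
      "\<lbrakk>a \<in> carrier S; u \<in> carrier M\<rbrakk> \<Longrightarrow> a \<odot>\<^bsub>M\<^esub> u \<in> carrier M"
    and smult_l_distr:
      "\<lbrakk>a \<in> carrier S; b \<in> carrier S; u \<in> carrier M\<rbrakk> \<Longrightarrow>
        (a \<oplus> b) \<odot>\<^bsub>M\<^esub> u = a \<odot>\<^bsub>M\<^esub> u \<oplus>\<^bsub>M\<^esub> b \<odot>\<^bsub>M\<^esub> u"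
    and smult_r_distr:
      "\<lbrakk>a \<in> carrier S; u \<in> carrier M; v \<in> carrier M\<rbrakk> \<Longrightarrow>
        a \<odot>\<^bsub>M\<^esub> (u \<oplus>\<^bsub>M\<^esub> v) = a \<odot>\<^bsub>M\<^esub> u \<oplus>\<^bsub>M\<^esub> a \<odot>\<^bsub>M\<^esub> v"
    and smult_assoc:
      "\<lbrakk>a \<in> carrier S; b \<in> carrier S; u \<in> carrier M\<rbrakk> \<Longrightarrow>
        (a \<otimes> b) \<odot>\<^bsub>M\<^esub> u = a \<odot>\<^bsub>M\<^esub> (b \<odot>\<^bsub>M\<^esub> u)"
    and smult_one:
      "u \<in> carrier M \<Longrightarrow> \<one> \<odot>\<^bsub>M\<^esub> u = u"

definition left_module_hom ::
    "('a, 's) ring_scheme \<Rightarrow> ('a, 'm, 'x) module_scheme \<Rightarrow> ('a, 'k, 'y) module_scheme \<Rightarrow> ('m \<Rightarrow> 'k) set"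
  where "left_module_hom S M N =
    {f \<in> carrier M \<rightarrow> carrier N.
      (\<forall>u\<in>carrier M. \<forall>v\<in>carrier M. f (u \<oplus>\<^bsub>M\<^esub> v) = f u \<oplus>\<^bsub>N\<^esub> f v) \<and>
      (\<forall>a\<in>carrier S. \<forall>u\<in>carrier M. f (a \<odot>\<^bsub>M\<^esub> u) = a \<odot>\<^bsub>N\<^esub> f u)}"

definition left_module_iso ::
    "('a, 's) ring_scheme \<Rightarrow> ('a, 'm, 'x) module_scheme \<Rightarrow> ('a, 'k, 'y) module_scheme \<Rightarrow> bool"
  where "left_module_iso S M N \<longleftrightarrow>
    (\<exists>f \<in> left_module_hom S M N. bij_betw f (carrier M) (carrier N))"

text \<open>A family \<open>b\<close> indexed by \<open>I\<close> is a basis if every element of the module is a linear combination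
  of the family with a unique finitely supported coefficient family. Coefficient families are
  extensional on \<open>I\<close>, so that uniqueness only concerns their values on \<open>I\<close>.\<close>

definition is_left_basis ::
    "('a, 's) ring_scheme \<Rightarrow> ('a, 'm, 'x) module_scheme \<Rightarrow> 'i set \<Rightarrow> ('i \<Rightarrow> 'm) \<Rightarrow> bool"
  where "is_left_basis S M I b \<longleftrightarrow>
    b \<in> I \<rightarrow> carrier M \<and>
    (\<forall>u\<in>carrier M. \<exists>!c. c \<in> I \<rightarrow>\<^sub>E carrier S \<and> finite {i \<in> I. c i \<noteq> \<zero>\<^bsub>S\<^esub>} \<and>
        u = (\<Oplus>\<^bsub>M\<^esub> i \<in> {i \<in> I. c i \<noteq> \<zero>\<^bsub>S\<^esub>}. c i \<odot>\<^bsub>M\<^esub> b i))"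

definition is_free_left_module :: "('a, 's) ring_scheme \<Rightarrow> ('a, 'm, 'x) module_scheme \<Rightarrow> bool"
  where "is_free_left_module S M \<longleftrightarrow>
    left_module S M \<and> (\<exists>B \<subseteq> carrier M. is_left_basis S M B (\<lambda>b. b))"

text \<open>The left module \<open>S\<^sup>r\<close>.\<close>

definition free_power :: "('a, 's) ring_scheme \<Rightarrow> nat \<Rightarrow> ('a, nat \<Rightarrow> 'a) module"
  where "free_power S r =
    \<lparr>carrier = {1..r} \<rightarrow>\<^sub>E carrier S, monoid.mult = undefined, monoid.one = undefined,
     ring.zero = (\<lambda>i\<in>{1..r}. \<zero>\<^bsub>S\<^esub>), ring.add = (\<lambda>u v. \<lambda>i\<in>{1..r}. u i \<oplus>\<^bsub>S\<^esub> v i),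
     smult = (\<lambda>a u. \<lambda>i\<in>{1..r}. a \<otimes>\<^bsub>S\<^esub> u i)\<rparr>"

definition direct_sum ::
    "('a, 'm, 'x) module_scheme \<Rightarrow> ('a, 'k, 'y) module_scheme \<Rightarrow> ('a, 'm \<times> 'k) module"
  where "direct_sum M N =
    \<lparr>carrier = carrier M \<times> carrier N, monoid.mult = undefined, monoid.one = undefined,
     ring.zero = (\<zero>\<^bsub>M\<^esub>, \<zero>\<^bsub>N\<^esub>), ring.add = (\<lambda>(u, v) (u', v'). (u \<oplus>\<^bsub>M\<^esub> u', v \<oplus>\<^bsub>N\<^esub> v')),
     smult = (\<lambda>a (u, v). (a \<odot>\<^bsub>M\<^esub> u, a \<odot>\<^bsub>N\<^esub> v))\<rparr>"

text \<open>A ring \<open>A\<close>, viewed as a left module over any of its subrings.\<close>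

definition self_module :: "('a, 's) ring_scheme \<Rightarrow> ('a, 'a) module"
  where "self_module A =
    \<lparr>carrier = carrier A, monoid.mult = monoid.mult A, monoid.one = \<one>\<^bsub>A\<^esub>,
     ring.zero = \<zero>\<^bsub>A\<^esub>, ring.add = ring.add A, smult = monoid.mult A\<rparr>"

text \<open>Epimorphisms of left modules are the surjective homomorphisms.\<close>

definition rank_condition :: "('a, 's) ring_scheme \<Rightarrow> bool"
  where "rank_condition S \<longleftrightarrow>
    (\<forall>r s. 1 \<le> r \<and> 1 \<le> s \<and>
      (\<exists>f \<in> left_module_hom S (free_power S r) (free_power S s).
        f ` carrier (free_power S r) = carrier (free_power S s)) \<longrightarrow> s \<le> r)"

section \<open>Left Noetherian rings and left Krull dimension\<close>

definition left_ideals :: "('a, 's) ring_scheme \<Rightarrow> 'a set set"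
  where "left_ideals S =
    {I. additive_subgroup I S \<and> (\<forall>a\<in>carrier S. \<forall>u\<in>I. a \<otimes>\<^bsub>S\<^esub> u \<in> I)}"

definition left_noetherian :: "('a, 's) ring_scheme \<Rightarrow> bool"
  where "left_noetherian S \<longleftrightarrow>
    ring S \<and> (\<forall>C. (\<forall>i::nat. C i \<in> left_ideals S) \<and> mono C \<longrightarrow> (\<exists>N. \<forall>i\<ge>N. C i = C N))"

text \<open>The left Krull dimension (in the sense of Gabriel and Rentschler) of a ring is the deviation of
  its poset of left ideals. The predicate \<open>dev_less k P\<close> says that the deviation of the family \<open>P\<close>,
  ordered by inclusion, is less than \<open>k\<close>. A poset without distinct comparable elements is the only
  one of deviation less than 0. A poset has deviation at most \<open>k\<close> if in each descending chain all
  but finitely many of the factors (the intervals between consecutive members) have deviation less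
  than \<open>k\<close>. Deviation 0 thus amounts to the descending chain condition. In general, deviations are
  ordinals; the finite ones are exactly those reached by this recursion.\<close>

primrec dev_less :: "nat \<Rightarrow> 'a set set \<Rightarrow> bool"
  where
    "dev_less 0 P \<longleftrightarrow> (\<forall>I\<in>P. \<forall>J\<in>P. I \<subseteq> J \<longrightarrow> I = J)"
  | "dev_less (Suc k) P \<longleftrightarrow>
      (\<forall>C::nat \<Rightarrow> 'a set. (\<forall>i. C i \<in> P) \<and> antimono C \<longrightarrow>
        (\<exists>N. \<forall>i\<ge>N. dev_less k {I \<in> P. C (Suc i) \<subseteq> I \<and> I \<subseteq> C i}))"

definition has_finite_lKdim :: "('a, 's) ring_scheme \<Rightarrow> bool"
  where "has_finite_lKdim S \<longleftrightarrow> (\<exists>k. dev_less k (left_ideals S))"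

text \<open>Only meaningful under \<open>has_finite_lKdim\<close>. The zero ring has dimension \<open>-1\<close>.\<close>

definition lKdim :: "('a, 's) ring_scheme \<Rightarrow> int"
  where "lKdim S = int (LEAST k. dev_less k (left_ideals S)) - 1"

section \<open>Skew PBW extensions\<close>

text \<open>The ordered monomial \<open>x\<^sub>1\<^sup>\<alpha>\<^sup>1 \<cdots> x\<^sub>n\<^sup>\<alpha>\<^sup>n\<close>.\<close>

definition pbw_monomial ::
    "('a, 's) ring_scheme \<Rightarrow> nat \<Rightarrow> (nat \<Rightarrow> 'a) \<Rightarrow> (nat \<Rightarrow> nat) \<Rightarrow> 'a"
  where "pbw_monomial A n x \<alpha> =
    foldr (\<lambda>i p. x i [^]\<^bsub>A\<^esub> \<alpha> i \<otimes>\<^bsub>A\<^esub> p) [1..<Suc n] \<one>\<^bsub>A\<^esub>"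

text \<open>The set \<open>R + R x\<^sub>1 + \<cdots> + R x\<^sub>n\<close>.\<close>

definition pbw_linear_part ::
    "('a, 's) ring_scheme \<Rightarrow> 'a set \<Rightarrow> nat \<Rightarrow> (nat \<Rightarrow> 'a) \<Rightarrow> 'a set"
  where "pbw_linear_part A R n x =
    {r\<^sub>0 \<oplus>\<^bsub>A\<^esub> (\<Oplus>\<^bsub>A\<^esub> i \<in> {1..n}. r i \<otimes>\<^bsub>A\<^esub> x i) | r\<^sub>0 r. r\<^sub>0 \<in> R \<and> r \<in> {1..n} \<rightarrow> R}"

locale skew_PBW_extension = ring A + subring R A
  for A :: "('a, 's) ring_scheme" (structure) and R :: "'a set" and n :: nat and x :: "nat \<Rightarrow> 'a" +
  assumes var_closed: "x \<in> {1..n} \<rightarrow> carrier A"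
    and monomial_basis:
      "is_left_basis (A\<lparr>carrier := R\<rparr>) (self_module A)
        ({1..n} \<rightarrow>\<^sub>E (UNIV :: nat set)) (pbw_monomial A n x)"
    and var_coeff:
      "\<lbrakk>i \<in> {1..n}; r \<in> R - {\<zero>}\<rbrakk> \<Longrightarrow> \<exists>c \<in> R - {\<zero>}. x i \<otimes> r \<ominus> c \<otimes> x i \<in> R"
    and var_var:
      "\<lbrakk>i \<in> {1..n}; j \<in> {1..n}\<rbrakk> \<Longrightarrow>
        \<exists>c \<in> R - {\<zero>}. x j \<otimes> x i \<ominus> c \<otimes> (x i \<otimes> x j) \<in> pbw_linear_part A R n x"

definition skew_derivation :: "('a, 's) ring_scheme \<Rightarrow> ('a \<Rightarrow> 'a) \<Rightarrow> ('a \<Rightarrow> 'a) \<Rightarrow> bool"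
  where "skew_derivation S \<sigma> \<delta> \<longleftrightarrow>
    \<delta> \<in> carrier S \<rightarrow> carrier S \<and>
    (\<forall>r\<in>carrier S. \<forall>s\<in>carrier S.
      \<delta> (r \<oplus>\<^bsub>S\<^esub> s) = \<delta> r \<oplus>\<^bsub>S\<^esub> \<delta> s \<and>
      \<delta> (r \<otimes>\<^bsub>S\<^esub> s) = \<sigma> r \<otimes>\<^bsub>S\<^esub> \<delta> s \<oplus>\<^bsub>S\<^esub> \<delta> r \<otimes>\<^bsub>S\<^esub> s)"

text \<open>Since the monomials form a basis, the maps \<open>\<sigma>\<^sub>i\<close> and \<open>\<delta>\<^sub>i\<close> are determined on \<open>R\<close>, and the
  coefficients \<open>c\<^sub>i\<^sub>,\<^sub>j\<close> with \<open>i < j\<close> are unique. Hence the existential quantifiers below refer to the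
  maps and coefficients attached to the extension.\<close>

locale bijective_skew_PBW_extension = skew_PBW_extension +
  assumes bij_endo:
      "i \<in> {1..n} \<Longrightarrow>
        \<exists>\<sigma> \<delta>. \<sigma> \<in> ring_hom (A\<lparr>carrier := R\<rparr>) (A\<lparr>carrier := R\<rparr>) \<and> bij_betw \<sigma> R R \<and>
          skew_derivation (A\<lparr>carrier := R\<rparr>) \<sigma> \<delta> \<and>
          (\<forall>r\<in>R. x i \<otimes> r = \<sigma> r \<otimes> x i \<oplus> \<delta> r)"
    and invertible_coeff:
      "\<lbrakk>i \<in> {1..n}; j \<in> {1..n}; i < j\<rbrakk> \<Longrightarrow>
        \<exists>c \<in> Units (A\<lparr>carrier := R\<rparr>).
          x j \<otimes> x i \<ominus> c \<otimes> (x i \<otimes> x j) \<in> pbw_linear_part A R n x"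

section \<open>Stable rank\<close>

definition unimodular_column :: "('a, 's) ring_scheme \<Rightarrow> nat \<Rightarrow> (nat \<Rightarrow> 'a) \<Rightarrow> bool"
  where "unimodular_column S r v \<longleftrightarrow>
    v \<in> {1..r} \<rightarrow> carrier S \<and>
    (\<exists>b \<in> {1..r} \<rightarrow> carrier S. (\<Oplus>\<^bsub>S\<^esub> i \<in> {1..r}. b i \<otimes>\<^bsub>S\<^esub> v i) = \<one>\<^bsub>S\<^esub>)"

definition stable_column :: "('a, 's) ring_scheme \<Rightarrow> nat \<Rightarrow> (nat \<Rightarrow> 'a) \<Rightarrow> bool"
  where "stable_column S r v \<longleftrightarrow>
    (\<exists>a \<in> {1..r - 1} \<rightarrow> carrier S. unimodular_column S (r - 1) (\<lambda>i. v i \<oplus>\<^bsub>S\<^esub> a i \<otimes>\<^bsub>S\<^esub> v r))"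

text \<open>The infimum of the empty set of extended naturals is \<open>\<infinity>\<close>.\<close>

definition stable_rank :: "('a, 's) ring_scheme \<Rightarrow> enat"
  where "stable_rank S =
    Inf {enat d | d. 1 \<le> d \<and> (\<forall>v. unimodular_column S (d + 1) v \<longrightarrow> stable_column S (d + 1) v)}"

section \<open>Hermite rings\<close>

definition stably_free_of_rank ::
    "('a, 's) ring_scheme \<Rightarrow> ('a, 'm, 'x) module_scheme \<Rightarrow> nat \<Rightarrow> bool"
  where "stably_free_of_rank S M t \<longleftrightarrow>
    left_module S M \<and>
    (\<exists>s. left_module_iso S (free_power S (s + t)) (direct_sum (free_power S s) M))"

text \<open>The type argument is the type of the elements of the modules quantified over, which a
  definition cannot quantify over itself. A theorem in which it is a type variable holds for modules on all
  types.\<close>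

definition hermite :: "'m itself \<Rightarrow> ('a, 's) ring_scheme \<Rightarrow> nat \<Rightarrow> bool"
  where "hermite T S d \<longleftrightarrow>
    (\<forall>(M :: ('a, 'm) module) t. d \<le> t \<and> stably_free_of_rank S M t \<longrightarrow> is_free_left_module S M)"

end

theory Submission
  imports Defs
begin

text \<open>The bound on the stable rank is Stafford's theorem. Let \<open>w\<close> be the last entry of a unimodular column. For a left
  ideal \<open>I\<close> and a prime \<open>P\<close>, consider the module \<open>(I + P + A w) / (I + P)\<close> and disregard its subfactors
  annihilated by ideals not contained in \<open>P\<close>. If at all primes its other subfactors have dimension less
  than \<open>k + 1\<close>, then only finitely many primes admit a subfactor of dimension \<open>k\<close>, and for any \<open>v\<close>
  there is \<open>a\<close> such that passing from \<open>I\<close> to \<open>I + A (v + a w)\<close> removes all of them: choose \<open>a\<close> so that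
  \<open>A (v + a w)\<close> captures as much as possible of the \<open>k\<close>-dimensional length. Starting from \<open>I = 0\<close>, as many
  steps as the Krull dimension plus one lead to a left ideal such that each maximal left ideal containing it
  contains \<open>w\<close>, hence the whole column. So the resulting shorter column is unimodular.

  The Krull dimension of the extension is bounded by sending a left ideal to its left ideals of leading
  coefficients, written on the right of the monomials: this is a strictly increasing map to the
  order-preserving maps from \<open>\<nat>\<^sup>n\<close> to the left ideals of \<open>R\<close>, and each coordinate of \<open>\<nat>\<^sup>n\<close> raises the
  deviation by at most one.\<close>

section \<open>Deviation of posets of sequences\<close>

text \<open>Instead of localizing at a prime \<open>P\<close>, the proof works modulo
  \<open>small\<close> intervals. These are closed under subfactors and extensions, so a length can
  be defined by counting only those steps of a chain that are not small. When finitely many primes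
  must be treated by one element, the obstacle is that a correction at \<open>P\<close> could spoil
  the primes already dealt with. For this reason the correcting element is confined to a two-sided
  ideal \<open>J\<close> that is not contained in \<open>P\<close> but lies inside all the others.
  Indices are shifted by one: \<open>dev_less k\<close> is a strict bound, so the least
  \<open>k\<close> for the coefficient ring is its dimension plus one, and \<open>k + n\<close> is
  the number of reduction steps needed in the extension. The Hermite property comes from
  cancellation: an isomorphism of free modules that splits off \<open>M\<close> and free summands
  loses one free summand on both sides as soon as a certain unimodular column is stable. Its length
  exceeds \<open>d\<close> as long as the rank of \<open>M\<close> is at least \<open>d\<close>.
  Stability for every such length is obtained directly from the reduction steps, since
  \<open>dev_less\<close> is monotone in its index.\<close>

lemma dev_less_transfer:
  assumes "dev_less k Q"
    and "\<And>I. I \<in> P \<Longrightarrow> f I \<in> Q"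
    and "\<And>I J. I \<in> P \<Longrightarrow> J \<in> P \<Longrightarrow> I \<subseteq> J \<Longrightarrow> f I \<subseteq> f J"
    and "\<And>I J. I \<in> P \<Longrightarrow> J \<in> P \<Longrightarrow> I \<subseteq> J \<Longrightarrow> f I = f J \<Longrightarrow> I = J"
  shows "dev_less k P"
  using assms
proof (induction k arbitrary: P Q)
  case 0
  show ?case
    unfolding dev_less.simps
  proof (intro ballI impI)
    fix I J assume *: "I \<in> P" "J \<in> P" "I \<subseteq> J"
    then have "f I = f J"
      using 0(1) 0(2)[of I] 0(2)[of J] 0(3)[of I J] by simp
    then show "I = J"
      using * by (rule 0(4)[rotated 3])
  qed
next
  case (Suc k)
  show ?case
    unfolding dev_less.simps
  proof (intro allI impI)
    fix C :: "nat \<Rightarrow> 'b set"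
    assume C: "(\<forall>i. C i \<in> P) \<and> antimono C"
    then have "(\<forall>i. f (C i) \<in> Q) \<and> antimono (\<lambda>i. f (C i))"
      using Suc.prems(2,3) by (simp add: antimono_def)
    then obtain N where N: "\<And>i. i \<ge> N \<Longrightarrow> dev_less k {I \<in> Q. f (C (Suc i)) \<subseteq> I \<and> I \<subseteq> f (C i)}"
      using Suc.prems(1) unfolding dev_less.simps by meson
    \<comment> \<open>\<open>f\<close> carries each interval of the chain into the corresponding
      interval of the image chain. Injectivity is demanded on comparable members only, which is all
      that leading coefficients provide later.\<close>
    have "dev_less k {I \<in> P. C (Suc i) \<subseteq> I \<and> I \<subseteq> C i}" if "i \<ge> N" for i
      by (rule Suc.IH[OF N[OF that]]) (use Suc.prems C in auto)
    then show "\<exists>N. \<forall>i\<ge>N. dev_less k {I \<in> P. C (Suc i) \<subseteq> I \<and> I \<subseteq> C i}" by blast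
  qed
qed

lemma dev_less_subset:
  assumes "dev_less k Q" "P \<subseteq> Q"
  shows "dev_less k P"
  by (rule dev_less_transfer[where f = "\<lambda>I. I", OF assms(1)]) (use assms(2) in auto)

lemma dev_less_Suc: "dev_less k P \<Longrightarrow> dev_less (Suc k) P"
proof (induction k arbitrary: P)
  case 0
  then show ?case by (auto intro!: exI[of _ 0])
next
  case (Suc k)
  show ?case
    unfolding dev_less.simps(2)[of "Suc k"]
  proof (intro allI impI)
    fix C :: "nat \<Rightarrow> 'a set"
    assume "(\<forall>i. C i \<in> P) \<and> antimono C"
    then obtain N where "\<forall>i\<ge>N. dev_less k {I \<in> P. C (Suc i) \<subseteq> I \<and> I \<subseteq> C i}"
      using Suc.prems unfolding dev_less.simps by meson
    then show "\<exists>N. \<forall>i\<ge>N. dev_less (Suc k) {I \<in> P. C (Suc i) \<subseteq> I \<and> I \<subseteq> C i}"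
      using Suc.IH by blast
  qed
qed

lemma dev_less_mono: "dev_less k P \<Longrightarrow> k \<le> l \<Longrightarrow> dev_less l P"
proof (induction l)
  case (Suc l)
  then show ?case
    by (cases "k = Suc l") (simp_all del: dev_less.simps add: dev_less_Suc)
qed (simp del: dev_less.simps)

lemma dev_less_singleton: "(\<And>I J. I \<in> P \<Longrightarrow> J \<in> P \<Longrightarrow> I = J) \<Longrightarrow> dev_less k P"
  by (rule dev_less_mono[of 0]) auto

definition acc :: "'a set set \<Rightarrow> bool"
  where "acc P \<longleftrightarrow> (\<forall>C. (\<forall>i::nat. C i \<in> P) \<and> mono C \<longrightarrow> (\<exists>N. \<forall>i\<ge>N. C i = C N))"

lemma accD:
  fixes C :: "nat \<Rightarrow> 'a set"
  assumes "acc P" "\<And>i. C i \<in> P" "mono C"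
  shows "\<exists>N. \<forall>i\<ge>N. C i = C N"
  by (rule assms(1)[unfolded acc_def, THEN spec, THEN mp]) (use assms(2,3) in blast)

lemma dev_less_SucD:
  assumes "dev_less (Suc k) P" "\<And>i. C i \<in> P" "antimono C"
  shows "\<exists>N. \<forall>i\<ge>N. dev_less k {I \<in> P. C (Suc i) \<subseteq> I \<and> I \<subseteq> C i}"
  using assms unfolding dev_less.simps by simp

lemma acc_subset: "acc Q \<Longrightarrow> P \<subseteq> Q \<Longrightarrow> acc P"
  unfolding acc_def by blast

lemma acc_transfer:
  assumes "acc Q"
    and "\<And>I. I \<in> P \<Longrightarrow> f I \<in> Q"
    and "\<And>I J. I \<in> P \<Longrightarrow> J \<in> P \<Longrightarrow> I \<subseteq> J \<Longrightarrow> f I \<subseteq> f J"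
    and "\<And>I J. I \<in> P \<Longrightarrow> J \<in> P \<Longrightarrow> I \<subseteq> J \<Longrightarrow> f I = f J \<Longrightarrow> I = J"
  shows "acc P"
  unfolding acc_def
proof (intro allI impI)
  fix C :: "nat \<Rightarrow> 'b set"
  assume C: "(\<forall>i. C i \<in> P) \<and> mono C"
  then have "(\<forall>i. f (C i) \<in> Q) \<and> mono (\<lambda>i. f (C i))"
    using assms(2,3) by (simp add: mono_def)
  then obtain N where N: "\<And>i. i \<ge> N \<Longrightarrow> f (C i) = f (C N)"
    using accD[OF assms(1), of "\<lambda>i. f (C i)"] by blast
  have "C i = C N" if "i \<ge> N" for i
    using assms(4)[of "C N" "C i"] N[OF that] C that by (simp add: mono_def)
  then have "\<forall>i\<ge>N. C i = C N" by blast
  then show "\<exists>N. \<forall>i\<ge>N. C i = C N" by blast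
qed

lemma acc_maximal:
  assumes "acc P" "Q \<subseteq> P" "Q \<noteq> {}"
  obtains M where "M \<in> Q" "\<And>N. N \<in> Q \<Longrightarrow> M \<subseteq> N \<Longrightarrow> N = M"
proof (rule ccontr)
  assume "\<not> thesis"
  with that have step: "\<exists>N. N \<in> Q \<and> M \<subset> N" if "M \<in> Q" for M
    using \<open>M \<in> Q\<close> by blast
  have "\<exists>C. \<forall>i::nat. C i \<in> Q \<and> C i \<subset> C (Suc i)"
    by (rule dependent_nat_choice) (use assms(3) step in auto)
  then obtain C where C: "\<And>i::nat. C i \<in> Q" "\<And>i. C i \<subset> C (Suc i)" by blast
  have "mono C"
    using C(2) by (intro mono_iff_le_Suc[THEN iffD2]) blast
  moreover have "C i \<in> P" for i
    using assms(2) C(1)[of i] by blast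
  ultimately obtain N where N: "\<And>i. i \<ge> N \<Longrightarrow> C i = C N"
    using accD[OF assms(1), of C] by blast
  have "C (Suc N) = C N" by (rule N) simp
  then show False
    using C(2)[of N] by simp
qed

text \<open>Pairs and sequences of sets are encoded as single sets, so that the componentwise order becomes
  inclusion, the order which deviations refer to.\<close>

definition fam_prod :: "'a set set \<Rightarrow> 'b set set \<Rightarrow> ('a + 'b) set set"
  where "fam_prod P Q = {F. Inl -` F \<in> P \<and> Inr -` F \<in> Q}"

lemma vimage_Plus_eq:
  fixes F F' :: "('a + 'b) set"
  assumes "Inl -` F = Inl -` F'" "Inr -` F = Inr -` F'"
  shows "F = F'"
proof (rule Set.set_eqI)
  fix z show "z \<in> F \<longleftrightarrow> z \<in> F'"
    using assms by (cases z) (auto simp: vimage_def set_eq_iff)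
qed

text \<open>The interval between two pairs is the product of the intervals between their components,
  and beyond the larger of two thresholds both factors are under control.\<close>

lemma dev_less_fam_prod:
  assumes "dev_less k P" "dev_less k Q"
  shows "dev_less k (fam_prod P Q)"
  using assms
proof (induction k arbitrary: P Q)
  case 0
  show ?case
    unfolding dev_less.simps
  proof (intro ballI impI)
    fix F G assume *: "F \<in> fam_prod P Q" "G \<in> fam_prod P Q" "F \<subseteq> G"
    have "Inl -` F \<subseteq> Inl -` G" "Inr -` F \<subseteq> Inr -` G"
      using *(3) by blast+
    then show "F = G"
      using * 0 by (intro vimage_Plus_eq) (simp_all add: fam_prod_def)
  qed
next
  case (Suc k)
  show ?case
    unfolding dev_less.simps
  proof (intro allI impI)
    fix C :: "nat \<Rightarrow> ('a + 'b) set"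
    assume C: "(\<forall>i. C i \<in> fam_prod P Q) \<and> antimono C"
    then have "(\<forall>i. Inl -` C i \<in> P) \<and> antimono (\<lambda>i. Inl -` C i)"
      "(\<forall>i. Inr -` C i \<in> Q) \<and> antimono (\<lambda>i. Inr -` C i)"
      by (simp_all add: fam_prod_def antimono_def vimage_mono)
    then obtain N1 N2 where
      N: "\<And>i. i \<ge> N1 \<Longrightarrow> dev_less k {I \<in> P. Inl -` C (Suc i) \<subseteq> I \<and> I \<subseteq> Inl -` C i}"
        "\<And>i. i \<ge> N2 \<Longrightarrow> dev_less k {I \<in> Q. Inr -` C (Suc i) \<subseteq> I \<and> I \<subseteq> Inr -` C i}"
      using Suc.prems unfolding dev_less.simps by meson
    have "dev_less k {I \<in> fam_prod P Q. C (Suc i) \<subseteq> I \<and> I \<subseteq> C i}" if "i \<ge> max N1 N2" for i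
      by (rule dev_less_subset[OF Suc.IH[OF N]]) (use that in \<open>auto simp: fam_prod_def\<close>)
    then show "\<exists>N. \<forall>i\<ge>N. dev_less k {I \<in> fam_prod P Q. C (Suc i) \<subseteq> I \<and> I \<subseteq> C i}" by blast
  qed
qed

section \<open>Monotone sequences in a noetherian poset\<close>

definition slice :: "('i \<times> 'a) set \<Rightarrow> 'i \<Rightarrow> 'a set"
  where "slice F i = {a. (i, a) \<in> F}"

lemma slice_mono: "F \<subseteq> G \<Longrightarrow> slice F i \<subseteq> slice G i"
  by (auto simp: slice_def)

definition seqs :: "'a set set \<Rightarrow> (nat \<times> 'a) set set"
  where "seqs P = {F. (\<forall>m. slice F m \<in> P) \<and> mono (slice F)}"

text \<open>The entries are independent of each other, as only an upper bound for the deviation is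
  wanted. The empty slices from \<open>m\<close> on make a tuple determined by its first
  \<open>m\<close> entries.\<close>

definition tuples :: "nat \<Rightarrow> 'a set set \<Rightarrow> (nat \<times> 'a) set set"
  where "tuples m P = {F. (\<forall>i<m. slice F i \<in> P) \<and> (\<forall>i\<ge>m. slice F i = {})}"

lemma slice_eqI: "(\<And>i. slice F i = slice G i) \<Longrightarrow> F = G"
  by (auto simp: slice_def set_eq_iff)

lemma dev_less_tuples: "dev_less k P \<Longrightarrow> dev_less k (tuples m P)"
proof (induction m)
  case 0
  show ?case
    by (rule dev_less_singleton) (auto simp: tuples_def intro!: slice_eqI)
next
  case (Suc m)
  define f :: "(nat \<times> 'a) set \<Rightarrow> ('a + (nat \<times> 'a)) set"
    where "f F = Inl ` slice F m \<union> Inr ` {(i, a) \<in> F. i < m}" for F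
  have l: "Inl -` f F = slice F m" and r: "Inr -` f F = {(i, a) \<in> F. i < m}" for F
    by (auto simp: f_def)
  have s: "slice {(i, a) \<in> F. i < m} j = (if j < m then slice F j else {})" for F :: "(nat \<times> 'a) set" and j
    by (auto simp: slice_def)
  show ?case
  proof (rule dev_less_transfer[where f = f, OF dev_less_fam_prod[OF Suc.prems Suc.IH[OF Suc.prems]]])
    show "f F \<in> fam_prod P (tuples m P)" if "F \<in> tuples (Suc m) P" for F
      using that by (auto simp: fam_prod_def tuples_def l r s)
    show "f F \<subseteq> f G" if "F \<subseteq> G" for F G
      using that by (auto simp: f_def slice_def)
    fix F G assume FG: "F \<in> tuples (Suc m) P" "G \<in> tuples (Suc m) P" "f F = f G"
    then have "slice F m = slice G m" "{(i, a) \<in> F. i < m} = {(i, a) \<in> G. i < m}"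
      by (metis l, metis r)
    then have "slice F i = slice G i" if "i \<le> m" for i
      using that s[of F i] s[of G i] by (cases "i = m") auto
    moreover have "slice F i = slice G i" if "i > m" for i
      using FG(1,2) that by (auto simp: tuples_def)
    ultimately show "F = G"
      by (intro slice_eqI) (meson not_less)
  qed
qed

text \<open>The diagonal of an ascending chain of monotone sequences is ascending in
  \<open>P\<close>, hence stationary from some \<open>N\<close> on. This settles all entries with
  both indices at least \<open>N\<close>; the finitely many positions below \<open>N\<close> are
  then handled one by one.\<close>

lemma acc_seqs:
  assumes "acc P"
  shows "acc (seqs P)"
  unfolding acc_def
proof (intro allI impI)
  fix C :: "nat \<Rightarrow> (nat \<times> 'a) set"
  assume C: "(\<forall>i. C i \<in> seqs P) \<and> mono C"
  have mono2: "slice (C i) m \<subseteq> slice (C j) l" if "i \<le> j" "m \<le> l" for i j m l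
    using C that slice_mono[of "C i" "C j" m] by (simp add: seqs_def mono_def) blast
  have st: "\<exists>N. \<forall>i\<ge>N. D i = D N" if "\<And>i. D i \<in> P" "mono D" for D :: "nat \<Rightarrow> 'a set"
    using accD[OF assms that] .
  have "mono (\<lambda>i. slice (C i) i)"
    using mono2 by (simp add: mono_def)
  then obtain N where N: "\<And>i. i \<ge> N \<Longrightarrow> slice (C i) i = slice (C N) N"
    using st[of "\<lambda>i. slice (C i) i"] C unfolding seqs_def by blast
  \<comment> \<open>The entry is sandwiched between the diagonal entry at \<open>N\<close> and the
    one at the larger of its two indices, and these agree.\<close>
  have big: "slice (C i) m = slice (C N) N" if "i \<ge> N" "m \<ge> N" for i m
    using mono2[of N i N m] mono2[of i "max i m" m "max i m"] N[of "max i m"] that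
    by (simp add: subset_antisym)
  have "\<exists>M. \<forall>i\<ge>M. slice (C i) m = slice (C M) m" for m
    by (rule st) (use C in \<open>simp_all add: seqs_def mono_def slice_mono\<close>)
  then have "\<exists>M. \<forall>m. \<forall>i\<ge>M m. slice (C i) m = slice (C (M m)) m"
    by (intro choice allI)
  then obtain M where M: "\<And>m i. i \<ge> M m \<Longrightarrow> slice (C i) m = slice (C (M m)) m" by blast
  define K where "K = Max (insert N (M ` {..<N}))"
  have K: "K \<ge> N" "\<And>m. m < N \<Longrightarrow> K \<ge> M m"
    by (auto simp: K_def)
  have "C i = C K" if "i \<ge> K" for i
  proof (rule slice_eqI)
    fix m show "slice (C i) m = slice (C K) m"
    proof (cases "m < N")
      case True
      then show ?thesis using M[of m i] M[of m K] K(2)[of m] that by simp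
    next
      case False
      then show ?thesis using big[of i m] big[of K m] K that by simp
    qed
  qed
  then show "\<exists>N. \<forall>i\<ge>N. C i = C N" by blast
qed

text \<open>Each \<open>C i\<close> is eventually constant with a limit \<open>L i\<close>. These
  limits descend in \<open>P\<close>, so for large \<open>i\<close> the interval between consecutive
  limits has a smaller deviation. A sequence between \<open>C (Suc i)\<close> and \<open>C i\<close>
  consists of finitely many entries, which cost no more than \<open>P\<close> itself, and a tail
  living in that smaller interval, to which the induction hypothesis applies.\<close>

lemma dev_less_seqs:
  assumes "acc P" "dev_less k P"
  shows "dev_less (Suc k) (seqs P)"
  using assms
proof (induction k arbitrary: P)
  case 0
  have "dev_less 0 (seqs P)"
    unfolding dev_less.simps
  proof (intro ballI impI)
    fix F G assume "F \<in> seqs P" "G \<in> seqs P" "F \<subseteq> G"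
    then show "F = G"
      using 0 slice_mono[of F G] unfolding dev_less.simps seqs_def
      by (intro slice_eqI) blast
  qed
  then show ?case by (rule dev_less_Suc)
next
  case (Suc k)
  show ?case
    unfolding dev_less.simps(2)[of "Suc k"]
  proof (intro allI impI)
    fix C :: "nat \<Rightarrow> (nat \<times> 'a) set"
    assume C: "(\<forall>i. C i \<in> seqs P) \<and> antimono C"
    have "\<exists>M. \<forall>m\<ge>M. slice (C i) m = slice (C i) M" for i
    proof -
      have "(\<forall>m. slice (C i) m \<in> P) \<and> mono (slice (C i))"
        using C by (simp add: seqs_def)
      then show ?thesis
        using Suc.prems(1) unfolding acc_def by simp
    qed
    then have "\<exists>M. \<forall>i. \<forall>m\<ge>M i. slice (C i) m = slice (C i) (M i)"
      by (intro choice allI)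
    then obtain M where M: "\<And>i m. m \<ge> M i \<Longrightarrow> slice (C i) m = slice (C i) (M i)" by blast
    define L where "L i = slice (C i) (M i)" for i
    have L: "L i = slice (C i) m" if "m \<ge> M i" for i m
      unfolding L_def by (rule M[OF that, symmetric])
    have "L j \<subseteq> L i" if "i \<le> j" for i j
      using L[of i "max (M i) (M j)"] L[of j "max (M i) (M j)"] C that
        slice_mono[of "C j" "C i"] by (simp add: antimono_def)
    then have "(\<forall>i. L i \<in> P) \<and> antimono L"
      using C by (simp add: L_def antimono_def seqs_def)
    then obtain N where N: "\<And>i. i \<ge> N \<Longrightarrow> dev_less k {I \<in> P. L (Suc i) \<subseteq> I \<and> I \<subseteq> L i}"
      using Suc.prems(2) unfolding dev_less.simps by meson
    have "dev_less (Suc k) {F \<in> seqs P. C (Suc i) \<subseteq> F \<and> F \<subseteq> C i}" if "i \<ge> N" for i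
    proof -
      let ?I = "{I \<in> P. L (Suc i) \<subseteq> I \<and> I \<subseteq> L i}"
      \<comment> \<open>From position \<open>m\<close> on, both bounding sequences have reached
        their limits, so every later entry of \<open>F\<close> lies between \<open>L (Suc i)\<close>
        and \<open>L i\<close>.\<close>
      define m where "m = max (M i) (M (Suc i))"
      define f :: "(nat \<times> 'a) set \<Rightarrow> ((nat \<times> 'a) + (nat \<times> 'a)) set"
        where "f F = Inl ` {(j, a) \<in> F. j < m} \<union> Inr ` {(j, a). (m + j, a) \<in> F}" for F
      have l: "Inl -` f F = {(j, a) \<in> F. j < m}" and r: "Inr -` f F = {(j, a). (m + j, a) \<in> F}" for F
        by (auto simp: f_def)
      have sl: "slice {(j, a) \<in> F. j < m} j = (if j < m then slice F j else {})"
        and sr: "slice {(j, a). (m + j, a) \<in> F} j = slice F (m + j)" for F :: "(nat \<times> 'a) set" and j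
        by (auto simp: slice_def)
      have "dev_less (Suc k) (fam_prod (tuples m P) (seqs ?I))"
        by (intro dev_less_fam_prod dev_less_tuples Suc.prems Suc.IH N that)
           (rule acc_subset[OF Suc.prems(1)], blast)
      then show ?thesis
      proof (rule dev_less_transfer[where f = f])
        fix F assume F: "F \<in> {F \<in> seqs P. C (Suc i) \<subseteq> F \<and> F \<subseteq> C i}"
        have "L (Suc i) \<subseteq> slice F (m + j)" "slice F (m + j) \<subseteq> L i" for j
          using F slice_mono[of "C (Suc i)" F] slice_mono[of F "C i"]
            L[of "Suc i" "m + j"] L[of i "m + j"] by (simp_all add: m_def)
        then show "f F \<in> fam_prod (tuples m P) (seqs ?I)"
          using F by (auto simp: fam_prod_def tuples_def seqs_def l r sl sr mono_def)
      next
        fix F G :: "(nat \<times> 'a) set" assume "F \<subseteq> G"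
        then show "f F \<subseteq> f G" by (auto simp: f_def)
      next
        fix F G assume "f F = f G"
        then have *: "{(j, a) \<in> F. j < m} = {(j, a) \<in> G. j < m}"
          "{(j, a). (m + j, a) \<in> F} = {(j, a). (m + j, a) \<in> G}"
          by (metis l, metis r)
        show "F = G"
        proof (rule slice_eqI)
          fix j show "slice F j = slice G j"
          proof (cases "j < m")
            case True
            then show ?thesis using sl[of F j] sl[of G j] *(1) by simp
          next
            case False
            then show ?thesis using sr[of F "j - m"] sr[of G "j - m"] *(2) by simp
          qed
        qed
      qed
    qed
    then show "\<exists>N. \<forall>i\<ge>N. dev_less (Suc k) {I \<in> seqs P. C (Suc i) \<subseteq> I \<and> I \<subseteq> C i}" by blast
  qed
qed

section \<open>Monotone maps on tuples of natural numbers\<close>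

definition exps :: "nat \<Rightarrow> (nat \<Rightarrow> nat) set"
  where "exps n = {1..n} \<rightarrow>\<^sub>E UNIV"

definition mono_maps :: "nat \<Rightarrow> 'a set set \<Rightarrow> ((nat \<Rightarrow> nat) \<times> 'a) set set"
  where "mono_maps n P = {F. (\<forall>\<alpha>\<in>exps n. slice F \<alpha> \<in> P) \<and> (\<forall>\<alpha>. \<alpha> \<notin> exps n \<longrightarrow> slice F \<alpha> = {}) \<and>
    (\<forall>\<alpha>\<in>exps n. \<forall>i\<in>{1..n}. slice F \<alpha> \<subseteq> slice F (\<alpha>(i := Suc (\<alpha> i))))}"

lemma mono_mapsD:
  "F \<in> mono_maps n P \<Longrightarrow> \<alpha> \<in> exps n \<Longrightarrow> i \<in> {1..n} \<Longrightarrow> slice F \<alpha> \<subseteq> slice F (\<alpha>(i := Suc (\<alpha> i)))"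
  unfolding mono_maps_def by blast

text \<open>By currying, a monotone map in \<open>Suc n\<close> exponents is a monotone sequence,
  indexed by the last exponent, of monotone maps in \<open>n\<close> exponents. Each coordinate
  therefore costs one application of \<open>dev_less_seqs\<close>.\<close>

lemma acc_dev_less_mono_maps:
  assumes "acc P" "dev_less k P"
  shows "acc (mono_maps n P) \<and> dev_less (k + n) (mono_maps n P)"
proof (induction n)
  case 0
  have e: "exps 0 = {\<lambda>_. undefined}" by (auto simp: exps_def)
  show ?case
    unfolding add_0_right
  proof (intro conjI acc_transfer[where f = "\<lambda>F. slice F (\<lambda>_. undefined)", OF assms(1)]
      dev_less_transfer[where f = "\<lambda>F. slice F (\<lambda>_. undefined)", OF assms(2)])
    fix F G :: "((nat \<Rightarrow> nat) \<times> 'a) set"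
    assume *: "F \<in> mono_maps 0 P" "G \<in> mono_maps 0 P" "slice F (\<lambda>_. undefined) = slice G (\<lambda>_. undefined)"
    have "slice F \<alpha> = slice G \<alpha>" for \<alpha>
      using * by (cases "\<alpha> = (\<lambda>_. undefined)") (simp_all add: mono_maps_def e)
    then show "F = G" "F = G"
      by (rule slice_eqI)+
  qed (auto simp: mono_maps_def e slice_mono)
next
  case (Suc n)
  define f :: "((nat \<Rightarrow> nat) \<times> 'a) set \<Rightarrow> (nat \<times> (nat \<Rightarrow> nat) \<times> 'a) set"
    where "f F = {(m, \<alpha>, a). \<alpha> \<in> exps n \<and> (\<alpha>(Suc n := m), a) \<in> F}" for F
  have sl: "slice (slice (f F) m) \<alpha> = (if \<alpha> \<in> exps n then slice F (\<alpha>(Suc n := m)) else {})" for F m \<alpha>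
    by (auto simp: slice_def f_def)
  have up: "\<alpha>(Suc n := m) \<in> exps (Suc n)" if "\<alpha> \<in> exps n" for \<alpha> m
    using that unfolding exps_def by (force simp: PiE_iff extensional_def)
  have step: "slice F (\<alpha>(Suc n := m)) \<subseteq> slice F (\<alpha>(Suc n := Suc m))"
    if "F \<in> mono_maps (Suc n) P" "\<alpha> \<in> exps n" for F \<alpha> m
  proof -
    have "slice F (\<alpha>(Suc n := m)) \<subseteq> slice F ((\<alpha>(Suc n := m))(Suc n := Suc ((\<alpha>(Suc n := m)) (Suc n))))"
      by (rule mono_mapsD[OF that(1) up[OF that(2)]]) simp
    then show ?thesis by simp
  qed
  have step2: "slice F (\<alpha>(Suc n := m)) \<subseteq> slice F (\<alpha>(i := Suc (\<alpha> i), Suc n := m))"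
    if "F \<in> mono_maps (Suc n) P" "\<alpha> \<in> exps n" "i \<in> {1..n}" for F \<alpha> m i
  proof -
    have "slice F (\<alpha>(Suc n := m)) \<subseteq> slice F ((\<alpha>(Suc n := m))(i := Suc ((\<alpha>(Suc n := m)) i)))"
      by (rule mono_mapsD[OF that(1) up[OF that(2)]]) (use that(3) in simp)
    moreover have "(\<alpha>(Suc n := m))(i := Suc ((\<alpha>(Suc n := m)) i)) = \<alpha>(i := Suc (\<alpha> i), Suc n := m)"
      using that(3) by (auto simp: fun_eq_iff)
    ultimately show ?thesis by simp
  qed
  have 1: "f F \<in> seqs (mono_maps n P)" if F: "F \<in> mono_maps (Suc n) P" for F
    unfolding seqs_def mem_Collect_eq
  proof (intro conjI allI)
    have *: "\<alpha>(i := Suc (\<alpha> i)) \<in> exps n" if "\<alpha> \<in> exps n" "i \<in> {1..n}" for \<alpha> i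
      using that by (auto simp: exps_def PiE_iff extensional_def)
    show "slice (f F) m \<in> mono_maps n P" for m
      using step2[OF F] * F up unfolding mono_maps_def by (auto simp: sl)
    have "slice (f F) m \<subseteq> slice (f F) (Suc m)" for m
      using step[OF F] unfolding f_def slice_def by auto
    then show "mono (slice (f F))"
      by (simp add: mono_iff_le_Suc)
  qed
  have 2: "f F \<subseteq> f G" if "F \<subseteq> G" for F G
    using that by (auto simp: f_def)
  have 3: "F = G" if FG: "F \<in> mono_maps (Suc n) P" "G \<in> mono_maps (Suc n) P" "f F = f G" for F G
  proof (rule slice_eqI)
    fix \<beta> show "slice F \<beta> = slice G \<beta>"
    proof (cases "\<beta> \<in> exps (Suc n)")
      case True
      \<comment> \<open>Exponents are extensional functions, so dropping the last coordinate means
        resetting it to \<open>undefined\<close>.\<close>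
      define \<alpha> where "\<alpha> = \<beta>(Suc n := undefined)"
      have "\<alpha> \<in> exps n" "\<beta> = \<alpha>(Suc n := \<beta> (Suc n))"
        using True by (auto simp: \<alpha>_def exps_def PiE_iff extensional_def)
      then show ?thesis using sl[of F "\<beta> (Suc n)" \<alpha>] sl[of G "\<beta> (Suc n)" \<alpha>] FG(3) by simp
    next
      case False
      then show ?thesis using FG by (auto simp: mono_maps_def)
    qed
  qed
  have acc: "acc (seqs (mono_maps n P))" and dev: "dev_less (Suc (k + n)) (seqs (mono_maps n P))"
    using Suc acc_seqs dev_less_seqs by blast+
  show ?case
    unfolding add_Suc_right
    by (rule conjI)
       (rule acc_transfer[where f = f, OF acc] dev_less_transfer[where f = f, OF dev];
        (rule 1 | rule 2 | rule 3); assumption)+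
qed

section \<open>The lattice of left ideals\<close>

definition lideal :: "('a, 's) ring_scheme \<Rightarrow> 'a set \<Rightarrow> bool"
  where "lideal S I \<longleftrightarrow> I \<in> left_ideals S"

context ring
begin

abbreviation lid :: "'a set \<Rightarrow> bool"
  where "lid \<equiv> lideal R"

definition tid :: "'a set \<Rightarrow> bool"
  where "tid J \<longleftrightarrow> lid J \<and> (\<forall>a\<in>J. \<forall>x\<in>carrier R. a \<otimes> x \<in> J)"

definition ladd :: "'a set \<Rightarrow> 'a set \<Rightarrow> 'a set"
  where "ladd L Y = {x \<oplus> y | x y. x \<in> L \<and> y \<in> Y}"

definition lmul :: "'a set \<Rightarrow> 'a \<Rightarrow> 'a set"
  where "lmul L r = {x \<otimes> r | x. x \<in> L}"

definition lquo :: "'a set \<Rightarrow> 'a \<Rightarrow> 'a set"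
  where "lquo L v = {b \<in> carrier R. b \<otimes> v \<in> L}"

abbreviation lprin :: "'a \<Rightarrow> 'a set"
  where "lprin w \<equiv> lmul (carrier R) w"

definition between :: "'a set \<Rightarrow> 'a set \<Rightarrow> 'a set set"
  where "between L Y = {I. lid I \<and> L \<subseteq> I \<and> I \<subseteq> Y}"

section \<open>Elementary arithmetic of left ideals\<close>

lemma lidI:
  assumes "I \<subseteq> carrier R" "\<zero> \<in> I" "\<And>x y. x \<in> I \<Longrightarrow> y \<in> I \<Longrightarrow> x \<oplus> y \<in> I"
    and "\<And>a x. a \<in> carrier R \<Longrightarrow> x \<in> I \<Longrightarrow> a \<otimes> x \<in> I"
  shows "lid I"
proof -
  have "\<ominus> x \<in> I" if "x \<in> I" for x
    using assms(4)[of "\<ominus> \<one>" x] assms(1) that by (simp add: l_minus subset_iff)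
  then have "subgroup I (add_monoid R)"
    using assms by (intro subgroup.intro) (auto simp: a_inv_def)
  then show ?thesis
    using assms(4) by (simp add: lideal_def left_ideals_def additive_subgroup_def)
qed

lemma lid_carrier: "lid I \<Longrightarrow> I \<subseteq> carrier R"
  and lid_zero: "lid I \<Longrightarrow> \<zero> \<in> I"
  and lid_add: "lid I \<Longrightarrow> x \<in> I \<Longrightarrow> y \<in> I \<Longrightarrow> x \<oplus> y \<in> I"
  and lid_mult: "lid I \<Longrightarrow> a \<in> carrier R \<Longrightarrow> x \<in> I \<Longrightarrow> a \<otimes> x \<in> I"
  by (auto simp: lideal_def left_ideals_def additive_subgroup.a_subset
      additive_subgroup.zero_closed additive_subgroup.a_closed)

lemma lid_closed: "lid I \<Longrightarrow> x \<in> I \<Longrightarrow> x \<in> carrier R"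
  using lid_carrier by blast

lemma lid_minus: "lid I \<Longrightarrow> x \<in> I \<Longrightarrow> y \<in> I \<Longrightarrow> x \<ominus> y \<in> I"
  using lid_add[of I x "\<ominus> y"] lid_mult[of I "\<ominus> \<one>" y] lid_closed[of I y]
  by (simp add: minus_eq l_minus)

lemma lid_diff_cancel:
  assumes "lid I" "x \<in> carrier R" "y \<in> I" "x \<oplus> y \<in> I"
  shows "x \<in> I"
proof -
  have "(x \<oplus> y) \<ominus> y = x"
    using assms lid_closed by (simp add: minus_eq a_assoc r_neg)
  then show ?thesis using lid_minus[OF assms(1,4,3)] by simp
qed

lemma lid_carrier_self: "lid (carrier R)"
  by (rule lidI) auto

lemma lid_eq_carrier: "lid I \<Longrightarrow> \<one> \<in> I \<Longrightarrow> I = carrier R"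
  using lid_mult[of I _ \<one>] lid_carrier[of I] by auto

lemma lid_trivial: "lid {\<zero>}"
  by (rule lidI) auto

lemma lid_Int: "lid L \<Longrightarrow> lid Y \<Longrightarrow> lid (L \<inter> Y)"
  by (rule lidI) (auto dest: lid_closed lid_zero lid_add lid_mult)

lemma tid_lid: "tid J \<Longrightarrow> lid J"
  by (simp add: tid_def)

lemma tid_mult: "tid J \<Longrightarrow> a \<in> J \<Longrightarrow> x \<in> carrier R \<Longrightarrow> a \<otimes> x \<in> J"
  by (simp add: tid_def)

lemma tid_carrier: "tid (carrier R)"
  by (simp add: tid_def lid_carrier_self)

lemma tid_Int: "tid L \<Longrightarrow> tid Y \<Longrightarrow> tid (L \<inter> Y)"
  by (simp add: tid_def lid_Int)

lemma laddI: "x \<in> L \<Longrightarrow> y \<in> Y \<Longrightarrow> x \<oplus> y \<in> ladd L Y"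
  by (auto simp: ladd_def)

lemma laddE:
  assumes "z \<in> ladd L Y"
  obtains x y where "x \<in> L" "y \<in> Y" "z = x \<oplus> y"
  using assms by (auto simp: ladd_def)

lemma lid_ladd:
  assumes "lid L" "lid Y"
  shows "lid (ladd L Y)"
proof (rule lidI)
  show "ladd L Y \<subseteq> carrier R"
    using lid_carrier[OF assms(1)] lid_carrier[OF assms(2)] by (auto simp: ladd_def)
  show "\<zero> \<in> ladd L Y"
    using laddI[OF lid_zero lid_zero, OF assms] by simp
next
  fix u v assume "u \<in> ladd L Y" "v \<in> ladd L Y"
  then obtain x y x' y' where *: "x \<in> L" "y \<in> Y" "u = x \<oplus> y" "x' \<in> L" "y' \<in> Y" "v = x' \<oplus> y'"
    by (metis laddE)
  then have "x \<in> carrier R" "y \<in> carrier R" "x' \<in> carrier R" "y' \<in> carrier R"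
    using assms lid_closed by blast+
  then have "u \<oplus> v = (x \<oplus> x') \<oplus> (y \<oplus> y')"
    using * by (simp add: a_ac)
  then show "u \<oplus> v \<in> ladd L Y"
    using * assms by (simp add: laddI lid_add)
next
  fix a u assume a: "a \<in> carrier R" and "u \<in> ladd L Y"
  then obtain x y where *: "x \<in> L" "y \<in> Y" "u = x \<oplus> y"
    by (metis laddE)
  then have "a \<otimes> u = a \<otimes> x \<oplus> a \<otimes> y"
    using a assms lid_closed by (simp add: r_distr)
  then show "a \<otimes> u \<in> ladd L Y"
    using * a assms by (simp add: laddI lid_mult)
qed

lemma ladd_upper1: "lid L \<Longrightarrow> lid Y \<Longrightarrow> L \<subseteq> ladd L Y"
  using laddI[of _ L \<zero> Y] lid_zero[of Y] lid_closed[of L] by force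

lemma ladd_upper2: "lid L \<Longrightarrow> lid Y \<Longrightarrow> Y \<subseteq> ladd L Y"
  using laddI[of \<zero> L _ Y] lid_zero[of L] lid_closed[of Y] by force

lemma ladd_least: "lid Z \<Longrightarrow> L \<subseteq> Z \<Longrightarrow> Y \<subseteq> Z \<Longrightarrow> ladd L Y \<subseteq> Z"
  by (auto simp: ladd_def intro: lid_add)

lemma ladd_mono: "L \<subseteq> L' \<Longrightarrow> Y \<subseteq> Y' \<Longrightarrow> ladd L Y \<subseteq> ladd L' Y'"
  by (auto simp: ladd_def)

lemma ladd_absorb1: "lid L \<Longrightarrow> lid Y \<Longrightarrow> L \<subseteq> Y \<Longrightarrow> ladd L Y = Y"
  by (simp add: ladd_least ladd_upper2 subset_antisym)

lemma ladd_absorb2: "lid L \<Longrightarrow> lid Y \<Longrightarrow> Y \<subseteq> L \<Longrightarrow> ladd L Y = L"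
  by (simp add: ladd_least ladd_upper1 subset_antisym)

lemma lid_lmul:
  assumes "lid L" "r \<in> carrier R"
  shows "lid (lmul L r)"
proof (rule lidI)
  show "lmul L r \<subseteq> carrier R" "\<zero> \<in> lmul L r"
    using lid_carrier[OF assms(1)] lid_zero[OF assms(1)] assms(2) l_null[OF assms(2)]
    unfolding lmul_def by (auto, metis)
next
  fix u v assume "u \<in> lmul L r" "v \<in> lmul L r"
  then obtain x y where *: "x \<in> L" "u = x \<otimes> r" "y \<in> L" "v = y \<otimes> r"
    by (auto simp: lmul_def)
  then have "u \<oplus> v = (x \<oplus> y) \<otimes> r"
    using assms lid_closed by (simp add: l_distr)
  then show "u \<oplus> v \<in> lmul L r"
    using lid_add[OF assms(1) *(1,3)] unfolding lmul_def by blast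
next
  fix a u assume a: "a \<in> carrier R" and "u \<in> lmul L r"
  then obtain x where *: "x \<in> L" "u = x \<otimes> r" by (auto simp: lmul_def)
  then have "a \<otimes> u = (a \<otimes> x) \<otimes> r"
    using assms a lid_closed by (simp add: m_assoc)
  then show "a \<otimes> u \<in> lmul L r"
    using lid_mult[OF assms(1) a *(1)] unfolding lmul_def by blast
qed

lemma lmulI: "x \<in> L \<Longrightarrow> x \<otimes> r \<in> lmul L r"
  by (auto simp: lmul_def)

lemma lmul_mono: "L \<subseteq> Y \<Longrightarrow> lmul L r \<subseteq> lmul Y r"
  by (auto simp: lmul_def)

lemma lmul_one: "L \<subseteq> carrier R \<Longrightarrow> lmul L \<one> = L"
  unfolding lmul_def by force

lemma lmul_lmul:
  "L \<subseteq> carrier R \<Longrightarrow> r \<in> carrier R \<Longrightarrow> s \<in> carrier R \<Longrightarrow> lmul (lmul L r) s = lmul L (r \<otimes> s)"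
  unfolding lmul_def by (auto, (metis m_assoc subsetD)+)

lemma lid_lprin: "w \<in> carrier R \<Longrightarrow> lid (lprin w)"
  by (simp add: lid_lmul lid_carrier_self)

lemma lprin_self: "w \<in> carrier R \<Longrightarrow> w \<in> lprin w"
  using lmulI[of \<one> "carrier R" w] by simp

lemma lprin_least: "lid Z \<Longrightarrow> w \<in> Z \<Longrightarrow> lprin w \<subseteq> Z"
  by (auto simp: lmul_def intro: lid_mult)

lemma lid_lquo:
  assumes "lid L" "v \<in> carrier R"
  shows "lid (lquo L v)"
  using assms by (intro lidI) (auto simp: lquo_def l_distr m_assoc lid_zero intro: lid_add lid_mult)

text \<open>This describes the quotients \<open>Y / L\<close> with a finite series whose factors
  have deviation less than \<open>k\<close> or are annihilated by a two-sided ideal not inside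
  \<open>P\<close>. Extensions are built in, and \<open>small_sub\<close> adds subfactors, so these
  quotients form a Serre class; it stands in for the modules of small dimension after localization
  at \<open>P\<close>.\<close>

inductive small :: "nat \<Rightarrow> 'a set \<Rightarrow> 'a set \<Rightarrow> 'a set \<Rightarrow> bool"
  for k :: nat and P :: "'a set"
  where
    small_dev: "\<lbrakk>lid L; lid Y; L \<subseteq> Y; dev_less k (between L Y)\<rbrakk> \<Longrightarrow> small k P L Y"
  | small_ann: "\<lbrakk>lid L; lid Y; L \<subseteq> Y; tid J; \<not> J \<subseteq> P; \<forall>a\<in>J. \<forall>y\<in>Y. a \<otimes> y \<in> L\<rbrakk> \<Longrightarrow> small k P L Y"
  | small_trans: "\<lbrakk>small k P L Y; small k P Y Z\<rbrakk> \<Longrightarrow> small k P L Z"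

lemma small_lid: "small k P L Y \<Longrightarrow> lid L \<and> lid Y \<and> L \<subseteq> Y"
  by (induction rule: small.induct) auto

lemma small_refl: "lid L \<Longrightarrow> small k P L L"
  by (rule small_dev) (auto simp: between_def intro!: dev_less_singleton)

text \<open>A common scheme for operations \<open>F\<close> on left ideals such that
  \<open>F Y / F L\<close> is a subfactor of \<open>Y / L\<close>: the map \<open>G\<close>
  transports the left ideals between \<open>F L\<close> and \<open>F Y\<close> strictly
  monotonically back between \<open>L\<close> and \<open>Y\<close>, so that deviations can be
  compared, and \<open>ann\<close> transports annihilators.\<close>

lemma small_functor:
  assumes "small k P L Y"
    and F: "\<And>L. lid L \<Longrightarrow> lid (F L)" "\<And>L Y. lid L \<Longrightarrow> lid Y \<Longrightarrow> L \<subseteq> Y \<Longrightarrow> F L \<subseteq> F Y"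
    and G: "\<And>L Y U. lid L \<Longrightarrow> lid Y \<Longrightarrow> L \<subseteq> Y \<Longrightarrow> U \<in> between (F L) (F Y) \<Longrightarrow> G L Y U \<in> between L Y"
    and G_mono: "\<And>L Y U V. lid L \<Longrightarrow> lid Y \<Longrightarrow> L \<subseteq> Y \<Longrightarrow> U \<in> between (F L) (F Y) \<Longrightarrow>
      V \<in> between (F L) (F Y) \<Longrightarrow> U \<subseteq> V \<Longrightarrow> G L Y U \<subseteq> G L Y V"
    and G_inj: "\<And>L Y U V. lid L \<Longrightarrow> lid Y \<Longrightarrow> L \<subseteq> Y \<Longrightarrow> U \<in> between (F L) (F Y) \<Longrightarrow>
      V \<in> between (F L) (F Y) \<Longrightarrow> U \<subseteq> V \<Longrightarrow> G L Y U = G L Y V \<Longrightarrow> V \<subseteq> U"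
    and ann: "\<And>J L Y. tid J \<Longrightarrow> lid L \<Longrightarrow> lid Y \<Longrightarrow> L \<subseteq> Y \<Longrightarrow> \<forall>a\<in>J. \<forall>y\<in>Y. a \<otimes> y \<in> L \<Longrightarrow>
      \<forall>a\<in>J. \<forall>y\<in>F Y. a \<otimes> y \<in> F L"
  shows "small k P (F L) (F Y)"
  using assms(1)
proof (induction rule: small.induct)
  case (small_dev L Y)
  note XY = small_dev(1-3)
  show ?case
  proof (rule small.small_dev)
    show "lid (F L)" "lid (F Y)" "F L \<subseteq> F Y"
      using XY F by auto
    show "dev_less k (between (F L) (F Y))"
    proof (rule dev_less_transfer[where f = "G L Y", OF small_dev(4)])
      fix U V assume U: "U \<in> between (F L) (F Y)"
      then show "G L Y U \<in> between L Y" by (rule G[OF XY])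
      assume V: "V \<in> between (F L) (F Y)" and UV: "U \<subseteq> V"
      then show "G L Y U \<subseteq> G L Y V" using G_mono[OF XY U] by blast
      assume "G L Y U = G L Y V"
      then show "U = V" using G_inj[OF XY U V UV] UV by blast
    qed
  qed
next
  case (small_ann L Y J)
  show ?case
    using small_ann F ann[OF small_ann(4,1,2,3,6)] by (intro small.small_ann[of _ _ J]) auto
next
  case (small_trans L Y Z)
  then show ?case by (blast intro: small.small_trans)
qed

lemma betweenD: "U \<in> between L Y \<Longrightarrow> lid U \<and> L \<subseteq> U \<and> U \<subseteq> Y"
  by (simp add: between_def)

text \<open>The quotient of the traces on \<open>T\<close> embeds in \<open>Y / L\<close>, and an
  intermediate \<open>U\<close> corresponds to \<open>L + U\<close>.\<close>

lemma small_Int: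
  assumes "small k P L Y" "lid T"
  shows "small k P (L \<inter> T) (Y \<inter> T)"
proof (rule small_functor[where F = "\<lambda>L. L \<inter> T" and G = "\<lambda>L Y U. ladd L U", OF assms(1)])
  fix L Y U V
  assume XY: "lid L" "lid Y" "L \<subseteq> Y" and U: "U \<in> between (L \<inter> T) (Y \<inter> T)"
  note U' = betweenD[OF U]
  show "ladd L U \<in> between L Y"
    using XY U' by (simp add: between_def lid_ladd ladd_upper1 ladd_least)
  assume "V \<in> between (L \<inter> T) (Y \<inter> T)" and UV: "U \<subseteq> V"
  note V' = betweenD[OF this(1)]
  show "ladd L U \<subseteq> ladd L V"
    using UV by (simp add: ladd_mono)
  assume eq: "ladd L U = ladd L V"
  show "V \<subseteq> U"
  proof
    fix v assume v: "v \<in> V"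
    then have "v \<in> ladd L U"
      using eq ladd_upper2[of L V] XY V' by blast
    then obtain x u where *: "x \<in> L" "u \<in> U" "v = x \<oplus> u" by (rule laddE)
    have "x \<in> V"
      by (rule lid_diff_cancel[of V x u]) (use * v UV V' XY lid_closed in auto)
    then have "x \<in> U" using * V' U' by blast
    then show "v \<in> U" using * U' lid_add by blast
  qed
next
  fix J L Y assume "tid J" "\<forall>a\<in>J. \<forall>y\<in>Y. a \<otimes> y \<in> L"
  then show "\<forall>a\<in>J. \<forall>y\<in>Y \<inter> T. a \<otimes> y \<in> L \<inter> T"
    using assms(2) lid_mult lid_closed tid_lid by blast
qed (use assms(2) lid_Int in auto)

text \<open>Right multiplication by \<open>r\<close> maps \<open>Y / L\<close> onto the quotient in
  question, so intermediate left ideals are pulled back to \<open>Y\<close>.\<close>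

lemma small_img:
  assumes "small k P L Y" "lid T" "r \<in> carrier R"
  shows "small k P (ladd (lmul L r) T) (ladd (lmul Y r) T)"
proof (rule small_functor[where F = "\<lambda>L. ladd (lmul L r) T" and G = "\<lambda>L Y U. Y \<inter> lquo U r", OF assms(1)])
  fix L Y U V
  assume XY: "lid L" "lid Y" "L \<subseteq> Y" and U: "U \<in> between (ladd (lmul L r) T) (ladd (lmul Y r) T)"
  note U' = betweenD[OF U]
  have "lmul L r \<subseteq> U" and T: "T \<subseteq> U"
    using U' ladd_upper1[of "lmul L r" T] ladd_upper2[of "lmul L r" T] lid_lmul XY assms by blast+
  then have "L \<subseteq> lquo U r"
    using lid_closed[OF XY(1)] by (auto simp: lquo_def intro: lmulI)
  then show "Y \<inter> lquo U r \<in> between L Y"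
    using XY U' assms(3) by (simp add: between_def lid_Int lid_lquo)
  assume "V \<in> between (ladd (lmul L r) T) (ladd (lmul Y r) T)" and UV: "U \<subseteq> V"
  note V' = betweenD[OF this(1)]
  show "Y \<inter> lquo U r \<subseteq> Y \<inter> lquo V r"
    using UV by (auto simp: lquo_def)
  assume eq: "Y \<inter> lquo U r = Y \<inter> lquo V r"
  show "V \<subseteq> U"
  proof
    fix v assume v: "v \<in> V"
    then have "v \<in> ladd (lmul Y r) T" using V' by blast
    then obtain y t where *: "y \<in> Y" "t \<in> T" "v = y \<otimes> r \<oplus> t"
      by (auto simp: ladd_def lmul_def)
    have "y \<in> carrier R" using * XY lid_closed by blast
    moreover have "y \<otimes> r \<in> V"
      by (rule lid_diff_cancel[of V _ t]) (use * v UV V' XY T assms(3) lid_closed in auto)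
    ultimately have "y \<otimes> r \<in> U" using eq * by (auto simp: lquo_def)
    then show "v \<in> U" using * T U' lid_add by blast
  qed
next
  fix J L Y assume J: "tid J" "lid L" "lid Y" "\<forall>a\<in>J. \<forall>y\<in>Y. a \<otimes> y \<in> L"
  show "\<forall>a\<in>J. \<forall>y\<in>ladd (lmul Y r) T. a \<otimes> y \<in> ladd (lmul L r) T"
  proof (intro ballI)
    fix a z assume a: "a \<in> J" "z \<in> ladd (lmul Y r) T"
    then obtain y t where *: "y \<in> Y" "t \<in> T" "z = y \<otimes> r \<oplus> t"
      by (auto simp: ladd_def lmul_def)
    have c: "a \<in> carrier R" "y \<in> carrier R" "t \<in> carrier R"
      using * a J assms lid_closed tid_lid by blast+
    then have "a \<otimes> z = (a \<otimes> y) \<otimes> r \<oplus> a \<otimes> t"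
      using * assms(3) by (simp add: r_distr m_assoc)
    then show "a \<otimes> z \<in> ladd (lmul L r) T"
      using J(4) a * c assms(2) by (simp add: laddI lmulI lid_mult)
  qed
qed (use assms(2,3) in \<open>auto simp: lid_ladd lid_lmul ladd_mono lmul_mono\<close>)

lemma small_add:
  assumes "small k P L Y" "lid T"
  shows "small k P (ladd L T) (ladd Y T)"
  using small_img[OF assms one_closed] small_lid[OF assms(1)] by (simp add: lmul_one lid_carrier)

text \<open>Right multiplication by \<open>v\<close> embeds the quotient of \<open>lquo Y v\<close>
  by \<open>lquo L v\<close> in \<open>Y / L\<close>.\<close>

lemma small_quo:
  assumes "small k P L Y" "v \<in> carrier R"
  shows "small k P (lquo L v) (lquo Y v)"
proof (rule small_functor[where F = "\<lambda>L. lquo L v" and G = "\<lambda>L Y U. ladd L (lmul U v)", OF assms(1)])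
  fix L Y U V
  assume XY: "lid L" "lid Y" "L \<subseteq> Y" and U: "U \<in> between (lquo L v) (lquo Y v)"
  note U' = betweenD[OF U]
  show "ladd L (lmul U v) \<in> between L Y"
  proof -
    have "lid (lmul U v)" "lmul U v \<subseteq> Y"
      using U' assms(2) by (blast intro: lid_lmul) (use U' in \<open>auto simp: lmul_def lquo_def\<close>)
    then show ?thesis
      using XY by (simp add: between_def lid_ladd ladd_upper1 ladd_least)
  qed
  assume "V \<in> between (lquo L v) (lquo Y v)" and UV: "U \<subseteq> V"
  note V' = betweenD[OF this(1)]
  show "ladd L (lmul U v) \<subseteq> ladd L (lmul V v)"
    using UV by (simp add: ladd_mono lmul_mono)
  assume eq: "ladd L (lmul U v) = ladd L (lmul V v)"
  show "V \<subseteq> U"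
  proof
    fix b assume b: "b \<in> V"
    then have "b \<otimes> v \<in> ladd L (lmul U v)"
      using eq ladd_upper2[of L "lmul V v"] XY V' assms(2) by (auto simp: lid_lmul intro: lmulI)
    then obtain x u where *: "x \<in> L" "u \<in> U" "b \<otimes> v = x \<oplus> u \<otimes> v"
      by (auto simp: ladd_def lmul_def)
    have c: "b \<in> carrier R" "x \<in> carrier R" "u \<in> carrier R"
      using b * U' V' XY lid_closed by blast+
    then have "(b \<ominus> u) \<otimes> v = x"
      using * assms(2) by (simp add: minus_eq l_distr l_minus a_assoc r_neg)
    then have "b \<ominus> u \<in> lquo L v" using c * by (simp add: lquo_def)
    then have "b \<ominus> u \<oplus> u \<in> U" using * U' lid_add by blast
    then show "b \<in> U" using c by (simp add: minus_eq a_assoc l_neg)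
  qed
next
  fix J L Y assume J: "tid J" "\<forall>a\<in>J. \<forall>y\<in>Y. a \<otimes> y \<in> L"
  then show "\<forall>a\<in>J. \<forall>y\<in>lquo Y v. a \<otimes> y \<in> lquo L v"
    using assms(2) lid_closed[OF tid_lid[OF J(1)]] by (auto simp: lquo_def m_assoc)
qed (use assms(2) lid_lquo in \<open>auto simp: lquo_def\<close>)

text \<open>A subfactor arises by cutting down with \<open>Y'\<close> and then adding
  \<open>L'\<close>.\<close>

lemma small_sub:
  assumes "small k P L Y" "lid L'" "lid Y'" "L \<subseteq> L'" "L' \<subseteq> Y'" "Y' \<subseteq> Y"
  shows "small k P L' Y'"
proof -
  have XY: "lid L" "lid Y" "L \<subseteq> Y" using small_lid[OF assms(1)] by auto
  have "L \<inter> Y' = L" "Y \<inter> Y' = Y'" "ladd L L' = L'" "ladd Y' L' = Y'"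
    using assms XY ladd_absorb1[of L L'] ladd_absorb2[of Y' L'] by blast+
  then show ?thesis
    using small_add[OF small_Int[OF assms(1,3)] assms(2)] by simp
qed

text \<open>The first nonzero factor of a series provides \<open>M\<close>. This matters for
  \<open>k = 0\<close>, where a proper interval never satisfies the first alternative, so that an
  annihilator must exist.\<close>

lemma small_proper:
  assumes "small k P L Y" "L \<noteq> Y"
  shows "\<exists>M. lid M \<and> L \<subset> M \<and> M \<subseteq> Y \<and> (dev_less k (between L M) \<or>
    (\<exists>J. tid J \<and> \<not> J \<subseteq> P \<and> (\<forall>a\<in>J. \<forall>y\<in>M. a \<otimes> y \<in> L)))"
  using assms
proof (induction rule: small.induct)
  case (small_trans L Y Z)
  show ?case
  proof (cases "L = Y")
    case True
    then show ?thesis using small_trans.IH(2) small_trans.prems by blast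
  next
    case False
    moreover have "Y \<subseteq> Z" using small_lid[OF small_trans.hyps(2)] by blast
    ultimately show ?thesis using small_trans.IH(1) by (meson subset_trans)
  qed
next
  case (small_dev L Y)
  then have "L \<subset> Y" by blast
  then show ?case
    using small_dev.hyps by blast
next
  case (small_ann L Y J)
  then have "L \<subset> Y" "tid J \<and> \<not> J \<subseteq> P \<and> (\<forall>a\<in>J. \<forall>y\<in>Y. a \<otimes> y \<in> L)" by blast+
  then show ?case
    using small_ann.hyps(2) by blast
qed

text \<open>Insert \<open>L + (L' \<inter> Y)\<close> between \<open>L\<close> and
  \<open>L'\<close>. The lower factor is a quotient of the trace on \<open>Y\<close>, the upper one
  embeds in the image modulo \<open>Y\<close>.\<close>

lemma small_split:
  assumes L: "lid L" "lid L'" "L \<subseteq> L'" "lid Y"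
    and "small k P (L \<inter> Y) (L' \<inter> Y)" "small k P (ladd L Y) (ladd L' Y)"
  shows "small k P L L'"
proof -
  have "small k P (ladd (L \<inter> Y) L) (ladd (L' \<inter> Y) L)"
    by (rule small_add[OF assms(5) L(1)])
  then have 1: "small k P L (ladd (L' \<inter> Y) L)"
    using L by (simp add: ladd_absorb1 lid_Int)
  have "small k P (ladd L Y \<inter> L') (ladd L' Y \<inter> L')"
    by (rule small_Int[OF assms(6) L(2)])
  moreover have "ladd L' Y \<inter> L' = L'"
    using ladd_upper1[OF L(2,4)] by blast
  \<comment> \<open>The modular law, using that \<open>L\<close> is contained in
    \<open>L'\<close>.\<close>
  moreover have "ladd L Y \<inter> L' \<subseteq> ladd (L' \<inter> Y) L"
  proof
    fix z assume z: "z \<in> ladd L Y \<inter> L'"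
    then obtain x y where *: "x \<in> L" "y \<in> Y" "z = x \<oplus> y" by (auto elim: laddE)
    have c: "x \<in> carrier R" "y \<in> carrier R" using * L lid_closed by blast+
    have "y \<in> L'"
      by (rule lid_diff_cancel[of L' y x]) (use * z L c in \<open>auto simp: a_comm\<close>)
    then show "z \<in> ladd (L' \<inter> Y) L"
      using * c laddI[of y "L' \<inter> Y" x L] by (simp add: a_comm)
  qed
  moreover have "ladd (L' \<inter> Y) L \<subseteq> L'"
    using L by (intro ladd_least) auto
  ultimately have "small k P (ladd (L' \<inter> Y) L) L'"
    using L small_sub[of k P "ladd L Y \<inter> L'" L' "ladd (L' \<inter> Y) L" L'] by (simp add: lid_ladd lid_Int)
  with 1 show ?thesis by (rule small_trans)
qed

end

section \<open>Lengths modulo small intervals\<close>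

locale left_noetherian_ring = ring +
  assumes acc_lid: "acc (Collect lid)"
begin

lemma lid_maximal:
  assumes "Q L" "\<And>L. Q L \<Longrightarrow> lid L"
  obtains M where "Q M" "\<And>N. Q N \<Longrightarrow> M \<subseteq> N \<Longrightarrow> N = M"
proof (rule acc_maximal[OF acc_lid, of "Collect Q"])
  show "Collect Q \<subseteq> Collect lid" "Collect Q \<noteq> {}"
    using assms by auto
  fix M assume "M \<in> Collect Q" "\<And>N. N \<in> Collect Q \<Longrightarrow> M \<subseteq> N \<Longrightarrow> N = M"
  then show thesis by (intro that[of M]) simp_all
qed

text \<open>Intervals of deviation at most \<open>k\<close> are built by extensions from intervals
  of deviation less than \<open>k\<close> and critical ones, all of whose proper quotients have
  deviation less than \<open>k\<close>. For a maximal \<open>A\<close> where \<open>Q A Y\<close>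
  fails, no interval above \<open>A\<close> is critical, so one descends forever from
  \<open>Y\<close> through factors of deviation at least \<open>k\<close>, against the
  hypothesis.\<close>

lemma dev_Suc_induct:
  assumes dev: "dev_less (Suc k) (between L Y)" and LY: "lid L" "lid Y" "L \<subseteq> Y"
    and trans: "\<And>A B C. lid A \<Longrightarrow> lid B \<Longrightarrow> lid C \<Longrightarrow> A \<subseteq> B \<Longrightarrow> B \<subseteq> C \<Longrightarrow> Q A B \<Longrightarrow> Q B C \<Longrightarrow> Q A C"
    and base: "\<And>A B. lid A \<Longrightarrow> lid B \<Longrightarrow> A \<subseteq> B \<Longrightarrow> dev_less k (between A B) \<Longrightarrow> Q A B"
    and critical: "\<And>A B. lid A \<Longrightarrow> lid B \<Longrightarrow> A \<subseteq> B \<Longrightarrow>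
      (\<And>C. lid C \<Longrightarrow> A \<subset> C \<Longrightarrow> C \<subseteq> B \<Longrightarrow> dev_less k (between C B)) \<Longrightarrow> Q A B"
  shows "Q L Y"
proof (rule ccontr)
  assume "\<not> Q L Y"
  then have "lid L \<and> L \<subseteq> L \<and> L \<subseteq> Y \<and> \<not> Q L Y" using LY by blast
  then obtain A where A: "lid A \<and> L \<subseteq> A \<and> A \<subseteq> Y \<and> \<not> Q A Y"
    and A_max: "\<And>C. lid C \<and> L \<subseteq> C \<and> C \<subseteq> Y \<and> \<not> Q C Y \<Longrightarrow> A \<subseteq> C \<Longrightarrow> C = A"
    by (rule lid_maximal[where Q = "\<lambda>A. lid A \<and> L \<subseteq> A \<and> A \<subseteq> Y \<and> \<not> Q A Y"]) blast+
  let ?S = "\<lambda>C. lid C \<and> A \<subset> C \<and> C \<subseteq> Y"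
  \<comment> \<open>By maximality of \<open>A\<close> the property holds from \<open>C\<close> to
    \<open>Y\<close>, so it would extend down to \<open>A\<close>.\<close>
  have nQ: "\<not> Q A C" if "?S C" for C
  proof
    assume "Q A C"
    moreover have "Q C Y" using A_max[of C] A that by blast
    ultimately show False using trans[of A C Y] A LY that by blast
  qed
  have "Q Y Y"
    by (rule base[OF LY(2,2)]) (auto simp: between_def intro!: dev_less_singleton)
  then have "?S Y" using A LY by blast
  moreover have "\<exists>C'. ?S C' \<and> C' \<subseteq> C \<and> \<not> dev_less k (between C' C)" if "?S C" for C
    using critical[of A C] nQ[OF that] A that by (meson psubset_subset_trans subset_trans psubset_imp_subset)
  ultimately have "\<exists>C. \<forall>i::nat. ?S (C i) \<and> (C (Suc i) \<subseteq> C i \<and> \<not> dev_less k (between (C (Suc i)) (C i)))"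
    by (intro dependent_nat_choice) blast+
  then obtain C where C: "\<And>i::nat. ?S (C i)" "\<And>i. C (Suc i) \<subseteq> C i"
    "\<And>i. \<not> dev_less k (between (C (Suc i)) (C i))" by blast
  have "C i \<in> between L Y" for i
    using C(1)[of i] A by (auto simp: between_def)
  moreover have "antimono C"
    using C(2) by (simp add: antimono_iff_le_Suc)
  ultimately obtain N where "dev_less k {I \<in> between L Y. C (Suc N) \<subseteq> I \<and> I \<subseteq> C N}"
    using dev_less_SucD[OF dev, of C] by blast
  moreover have "{I \<in> between L Y. C (Suc N) \<subseteq> I \<and> I \<subseteq> C N} = between (C (Suc N)) (C N)"
    using C(1)[of N] C(1)[of "Suc N"] A by (auto simp: between_def)
  ultimately show False using C(3)[of N] by simp
qed

text \<open>Inclusions need not be proper, so that intersecting with or adding a fixed left ideal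
  turns a chain into one with the same indices. Trivial steps are small and never counted.\<close>

definition lid_chain :: "(nat \<Rightarrow> 'a set) \<Rightarrow> nat \<Rightarrow> 'a set \<Rightarrow> 'a set \<Rightarrow> bool"
  where "lid_chain c t L Y \<longleftrightarrow> (\<forall>i\<le>t. lid (c i) \<and> L \<subseteq> c i \<and> c i \<subseteq> Y) \<and> (\<forall>i<t. c i \<subseteq> c (Suc i))"

definition large_steps :: "nat \<Rightarrow> 'a set \<Rightarrow> (nat \<Rightarrow> 'a set) \<Rightarrow> nat \<Rightarrow> nat set"
  where "large_steps k P c t = {i. i < t \<and> \<not> small k P (c i) (c (Suc i))}"

definition bounded_steps :: "nat \<Rightarrow> 'a set \<Rightarrow> 'a set \<Rightarrow> 'a set \<Rightarrow> nat \<Rightarrow> bool"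
  where "bounded_steps k P L Y b \<longleftrightarrow> (\<forall>c t. lid_chain c t L Y \<longrightarrow> card (large_steps k P c t) \<le> b)"

lemma finite_large_steps: "finite (large_steps k P c t)"
  by (auto simp: large_steps_def)

lemma lid_chainD:
  assumes "lid_chain c t L Y"
  shows "i \<le> t \<Longrightarrow> lid (c i)" "i \<le> t \<Longrightarrow> L \<subseteq> c i" "i \<le> t \<Longrightarrow> c i \<subseteq> Y" "i < t \<Longrightarrow> c i \<subseteq> c (Suc i)"
  using assms by (auto simp: lid_chain_def)

lemma lid_chain_mono:
  assumes "lid_chain c t L Y" "i \<le> j" "j \<le> t"
  shows "c i \<subseteq> c j"
  using assms(2,3)
proof (induction j rule: dec_induct)
  case (step j)
  then show ?case using lid_chainD(4)[OF assms(1), of j] by auto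
qed simp

lemma lid_chain_Int:
  assumes "lid_chain c t L Z" "lid Y" "L \<subseteq> Y"
  shows "lid_chain (\<lambda>i. c i \<inter> Y) t L Y"
  unfolding lid_chain_def
proof (intro conjI allI impI)
  fix i assume "i \<le> t"
  note ci = lid_chainD(1-3)[OF assms(1) this]
  show "lid (c i \<inter> Y)" "L \<subseteq> c i \<inter> Y" "c i \<inter> Y \<subseteq> Y"
    using ci assms(2,3) by (simp_all add: lid_Int)
next
  fix i assume "i < t"
  then show "c i \<inter> Y \<subseteq> c (Suc i) \<inter> Y"
    using lid_chainD(4)[OF assms(1)] by blast
qed

lemma lid_chain_ladd:
  assumes "lid_chain c t L Z" "lid Y" "lid Z" "Y \<subseteq> Z"
  shows "lid_chain (\<lambda>i. ladd (c i) Y) t Y Z"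
  unfolding lid_chain_def
proof (intro conjI allI impI)
  fix i assume "i \<le> t"
  note ci = lid_chainD(1-3)[OF assms(1) this]
  show "lid (ladd (c i) Y)" "Y \<subseteq> ladd (c i) Y" "ladd (c i) Y \<subseteq> Z"
    using ci assms(2-4) by (simp_all add: lid_ladd ladd_upper2 ladd_least)
next
  fix i assume "i < t"
  then show "ladd (c i) Y \<subseteq> ladd (c (Suc i)) Y"
    using lid_chainD(4)[OF assms(1)] by (simp add: ladd_mono)
qed

lemma bounded_steps_small:
  assumes "small k P L Y"
  shows "bounded_steps k P L Y 0"
proof -
  have "large_steps k P c t = {}" if "lid_chain c t L Y" for c t
    using small_sub[OF assms, of "c i" "c (Suc i)" for i] lid_chainD[OF that]
    by (force simp: large_steps_def)
  then show ?thesis by (simp add: bounded_steps_def)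
qed

text \<open>By \<open>small_split\<close> a large step remains large in the trace on
  \<open>Y\<close> or in the image modulo \<open>Y\<close>, so the two bounds add up.\<close>

lemma bounded_steps_trans:
  assumes "lid L" "lid Y" "lid Z" "L \<subseteq> Y" "Y \<subseteq> Z" "bounded_steps k P L Y b" "bounded_steps k P Y Z b'"
  shows "bounded_steps k P L Z (b + b')"
  unfolding bounded_steps_def
proof (intro allI impI)
  fix c t assume c: "lid_chain c t L Z"
  let ?c1 = "\<lambda>i. c i \<inter> Y" and ?c2 = "\<lambda>i. ladd (c i) Y"
  have "lid_chain ?c1 t L Y" "lid_chain ?c2 t Y Z"
    using lid_chain_Int[OF c assms(2,4)] lid_chain_ladd[OF c assms(2,3,5)] .
  then have "card (large_steps k P ?c1 t) \<le> b" "card (large_steps k P ?c2 t) \<le> b'"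
    using assms(6,7) by (auto simp: bounded_steps_def)
  moreover have "large_steps k P c t \<subseteq> large_steps k P ?c1 t \<union> large_steps k P ?c2 t"
  proof
    fix i assume i: "i \<in> large_steps k P c t"
    then have "i < t" by (simp add: large_steps_def)
    then show "i \<in> large_steps k P ?c1 t \<union> large_steps k P ?c2 t"
      using i small_split[of "c i" "c (Suc i)" Y k P] lid_chainD[OF c, of i] lid_chainD[OF c, of "Suc i"] assms(2)
      by (auto simp: large_steps_def)
  qed
  then have "card (large_steps k P c t) \<le> card (large_steps k P ?c1 t) + card (large_steps k P ?c2 t)"
    by (meson card_Un_le card_mono finite_UnI finite_large_steps order_trans)
  ultimately show "card (large_steps k P c t) \<le> b + b'" by linarith
qed

text \<open>Finite length modulo the next lower level. Factors that are small at level
  \<open>k\<close> contribute nothing, and a critical factor contributes at most one step, since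
  only a step leaving its bottom can be large.\<close>

lemma small_bounded_steps: "small (Suc k) P L Y \<Longrightarrow> \<exists>b. bounded_steps k P L Y b"
proof (induction rule: small.induct)
  case (small_dev L Y)
  show ?case
  proof (rule dev_Suc_induct[OF small_dev(4,1-3)])
    show "\<exists>b. bounded_steps k P A B b" if "lid A" "lid B" "A \<subseteq> B" "dev_less k (between A B)" for A B
      using bounded_steps_small[OF small.small_dev[OF that]] by blast
    show "\<exists>b. bounded_steps k P A B b" if AB: "lid A" "lid B" "A \<subseteq> B"
      and cr: "\<And>C. lid C \<Longrightarrow> A \<subset> C \<Longrightarrow> C \<subseteq> B \<Longrightarrow> dev_less k (between C B)" for A B
    proof -
      have "bounded_steps k P A B 1"
        unfolding bounded_steps_def
      proof (intro allI impI)
        fix c t assume c: "lid_chain c t A B"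
        \<comment> \<open>If the step started above \<open>A\<close>, it would lie in a proper
          quotient of a critical interval and be small.\<close>
        have bot: "c i = A \<and> c (Suc i) \<noteq> A" if "i \<in> large_steps k P c t" for i
        proof -
          have i: "i < t" "\<not> small k P (c i) (c (Suc i))" using that by (auto simp: large_steps_def)
          note ci = lid_chainD[OF c, of i] and ci' = lid_chainD[OF c, of "Suc i"]
          have *: "c i = A"
          proof (rule ccontr)
            assume "c i \<noteq> A"
            then have "dev_less k (between (c i) B)" using cr[of "c i"] ci i(1) by auto
            then have "small k P (c i) B"
              using ci i AB by (intro small.small_dev) auto
            then show False
              using i ci ci' small_sub[of k P "c i" B "c i" "c (Suc i)"] by auto
          qed
          moreover have "c (Suc i) \<noteq> A"
            using * i small_refl[OF AB(1)] by auto
          ultimately show ?thesis by blast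
        qed
        have "i = j" if ij: "i \<in> large_steps k P c t" "j \<in> large_steps k P c t" for i j
        proof -
          have *: False if "i < j" "i \<in> large_steps k P c t" "j \<in> large_steps k P c t" for i j
          proof -
            have "c (Suc i) \<subseteq> c j" "A \<subseteq> c (Suc i)"
              using that lid_chain_mono[OF c, of "Suc i" j] lid_chainD(2)[OF c, of "Suc i"]
              by (auto simp: large_steps_def)
            then show False using bot[OF that(2)] bot[OF that(3)] by auto
          qed
          show ?thesis using *[of i j] *[of j i] ij by (meson linorder_neqE_nat)
        qed
        then show "card (large_steps k P c t) \<le> 1"
          using card_le_Suc0_iff_eq[OF finite_large_steps] by auto
      qed
      then show ?thesis by blast
    qed
  qed (use bounded_steps_trans in blast)
next
  case (small_ann L Y J)
  then show ?case using bounded_steps_small[OF small.small_ann] by blast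
next
  case (small_trans L Y Z)
  then show ?case using bounded_steps_trans small_lid[OF small_trans.hyps(1)] small_lid[OF small_trans.hyps(2)] by blast
qed

text \<open>The length of \<open>Y / L\<close> modulo small factors. The maximum is meaningful only
  for a bounded set, hence the premise \<open>bounded_steps\<close> in all its properties.\<close>

definition slength :: "nat \<Rightarrow> 'a set \<Rightarrow> 'a set \<Rightarrow> 'a set \<Rightarrow> nat"
  where "slength k P L Y = Max {card (large_steps k P c t) | c t. lid_chain c t L Y}"

lemma slength_props:
  assumes "bounded_steps k P L Y b" "lid L" "L \<subseteq> Y"
  shows "\<exists>c t. lid_chain c t L Y \<and> slength k P L Y = card (large_steps k P c t)"
    and "lid_chain c t L Y \<Longrightarrow> card (large_steps k P c t) \<le> slength k P L Y"
    and "slength k P L Y \<le> b"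
proof -
  let ?S = "{card (large_steps k P c t) | c t. lid_chain c t L Y}"
  have S: "?S \<subseteq> {..b}" using assms(1) by (auto simp: bounded_steps_def)
  then have fin: "finite ?S" using finite_subset by blast
  have "lid_chain (\<lambda>_. L) 0 L Y" using assms by (simp add: lid_chain_def)
  then have "?S \<noteq> {}" by blast
  from Max_in[OF fin this] S
  show "\<exists>c t. lid_chain c t L Y \<and> slength k P L Y = card (large_steps k P c t)" "slength k P L Y \<le> b"
    by (auto simp: slength_def)
  show "lid_chain c t L Y \<Longrightarrow> card (large_steps k P c t) \<le> slength k P L Y"
    using Max_ge[OF fin] by (auto simp: slength_def)
qed

lemma lid_chain_subset: "lid_chain c t L N \<Longrightarrow> N \<subseteq> Y \<Longrightarrow> lid_chain c t L Y"
  unfolding lid_chain_def by (meson subset_trans)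

lemma bounded_steps_mono: "bounded_steps k P L Y b \<Longrightarrow> N \<subseteq> Y \<Longrightarrow> bounded_steps k P L N b"
  using lid_chain_subset unfolding bounded_steps_def by blast

lemma slength_mono:
  assumes "bounded_steps k P L Y b" "lid L" "L \<subseteq> N" "N \<subseteq> N'" "N' \<subseteq> Y"
  shows "slength k P L N \<le> slength k P L N'"
proof -
  have b: "bounded_steps k P L N b" "bounded_steps k P L N' b"
    using assms bounded_steps_mono by blast+
  obtain c t where "lid_chain c t L N" "slength k P L N = card (large_steps k P c t)"
    using slength_props(1)[OF b(1)] assms by blast
  moreover then have "lid_chain c t L N'"
    using assms(4) by (auto simp: lid_chain_def)
  ultimately show ?thesis using slength_props(2)[OF b(2)] assms by simp
qed

text \<open>An optimal chain up to \<open>N\<close> is prolonged by \<open>N'\<close>. The new step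
  contains \<open>N' / N\<close> as a subfactor, so it is large.\<close>

lemma slength_strict:
  assumes "bounded_steps k P L Y b" "lid L" "L \<subseteq> N" "N \<subseteq> N'" "N' \<subseteq> Y" "lid N" "lid N'"
    and "\<not> small k P N N'"
  shows "slength k P L N < slength k P L N'"
proof -
  have b: "bounded_steps k P L N b" "bounded_steps k P L N' b"
    using assms bounded_steps_mono by blast+
  obtain c t where c: "lid_chain c t L N" "slength k P L N = card (large_steps k P c t)"
    using slength_props(1)[OF b(1)] assms by blast
  define d where "d i = (if i \<le> t then c i else N')" for i
  have "lid_chain d (Suc t) L N'"
    unfolding lid_chain_def
  proof (intro conjI allI impI)
    fix i show "lid (d i)" "L \<subseteq> d i" "d i \<subseteq> N'"
      using lid_chainD(1-3)[OF c(1), of i] assms(3,4,7) by (auto simp: d_def)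
  next
    fix i assume "i < Suc t"
    then show "d i \<subseteq> d (Suc i)"
      using lid_chainD(4)[OF c(1), of i] lid_chainD(3)[OF c(1), of i] assms(4)
      by (cases "i = t") (auto simp: d_def)
  qed
  moreover have "\<not> small k P (c t) N'"
    using assms(4,6-8) lid_chainD(3)[OF c(1), of t] small_sub[of k P "c t" N' N N'] by auto
  then have "large_steps k P d (Suc t) = insert t (large_steps k P c t)"
    by (auto simp: large_steps_def d_def less_Suc_eq)
  then have "card (large_steps k P d (Suc t)) = Suc (card (large_steps k P c t))"
    by (simp add: finite_large_steps) (simp add: large_steps_def)
  moreover have "L \<subseteq> N'" using assms(3,4) by simp
  ultimately show ?thesis
    using slength_props(2)[OF b(2) assms(2), of d "Suc t"] c(2) by simp
qed

text \<open>Intersect an optimal chain up to \<open>N'\<close> with \<open>N\<close>. What a step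
  loses modulo \<open>N\<close> is a subfactor of the small \<open>N' / N\<close>, so by
  \<open>small_split\<close> every large step stays large.\<close>

lemma slength_small:
  assumes "bounded_steps k P L Y b" "lid L" "L \<subseteq> N" "N' \<subseteq> Y" "small k P N N'"
  shows "slength k P L N' \<le> slength k P L N"
proof -
  have N: "lid N" "lid N'" "N \<subseteq> N'" using small_lid[OF assms(5)] by auto
  have b: "bounded_steps k P L N b" "bounded_steps k P L N' b"
    using assms N bounded_steps_mono by blast+
  obtain c t where c: "lid_chain c t L N'" "slength k P L N' = card (large_steps k P c t)"
    using slength_props(1)[OF b(2)] assms N by blast
  have "lid_chain (\<lambda>i. c i \<inter> N) t L N"
    by (rule lid_chain_Int[OF c(1) N(1) assms(3)])
  moreover have "large_steps k P c t \<subseteq> large_steps k P (\<lambda>i. c i \<inter> N) t"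
  proof
    fix i assume i: "i \<in> large_steps k P c t"
    then have "i < t" by (simp add: large_steps_def)
    note ci = lid_chainD[OF c(1), of i] and ci' = lid_chainD[OF c(1), of "Suc i"]
    have "small k P (ladd (c i) N) (ladd (c (Suc i)) N)"
      by (rule small_sub[OF assms(5)])
         (use \<open>i < t\<close> ci ci' N in \<open>simp_all add: lid_ladd ladd_mono ladd_upper2 ladd_least\<close>)
    then show "i \<in> large_steps k P (\<lambda>i. c i \<inter> N) t"
      using i \<open>i < t\<close> small_split[of "c i" "c (Suc i)" N k P] ci ci' N by (auto simp: large_steps_def)
  qed
  then have "card (large_steps k P c t) \<le> card (large_steps k P (\<lambda>i. c i \<inter> N) t)"
    by (rule card_mono[OF finite_large_steps])
  ultimately show ?thesis
    using slength_props(2)[OF b(1) assms(2,3), of "\<lambda>i. c i \<inter> N" t] c(2) by linarith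
qed

text \<open>Suppose every \<open>B n\<close> adds only something small to \<open>Y\<close>. A
  maximal small extension \<open>S\<close> of \<open>Y\<close> then absorbs all of them, so
  \<open>B\<close> annihilates the image of \<open>N\<close> modulo \<open>S\<close>. As
  \<open>B\<close> is not inside \<open>P\<close>, that image is small as well.\<close>

lemma exists_large_summand:
  assumes "lid Y" "lid N" "lid B" "\<not> B \<subseteq> P" "\<not> small k P Y (ladd Y N)"
  shows "\<exists>n\<in>N. \<not> small k P Y (ladd Y (lmul B n))"
proof (rule ccontr)
  assume "\<not> ?thesis"
  then have all: "\<And>n. n \<in> N \<Longrightarrow> small k P Y (ladd Y (lmul B n))" by blast
  obtain S where S: "small k P Y S" and S_max: "\<And>S'. small k P Y S' \<Longrightarrow> S \<subseteq> S' \<Longrightarrow> S' = S"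
    by (rule lid_maximal[where Q = "small k P Y" and L = Y]) (use small_refl[OF assms(1)] small_lid in auto)
  have lS: "lid S" "Y \<subseteq> S" using small_lid[OF S] by auto
  have Bn: "lmul B n \<subseteq> S" if n: "n \<in> N" for n
  proof -
    have lB: "lid (lmul B n)" using n assms lid_closed by (intro lid_lmul) auto
    have "small k P (ladd Y S) (ladd (ladd Y (lmul B n)) S)"
      by (rule small_add[OF all[OF n] lS(1)])
    then have "small k P S (ladd (ladd Y (lmul B n)) S)"
      using lS assms(1) by (simp add: ladd_absorb1)
    then have "ladd (ladd Y (lmul B n)) S = S"
      using S_max small_trans[OF S] small_lid by blast
    moreover have "lmul B n \<subseteq> ladd (ladd Y (lmul B n)) S"
      using ladd_upper2[OF assms(1) lB] ladd_upper1[OF lid_ladd[OF assms(1) lB] lS(1)] by blast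
    ultimately show ?thesis by simp
  qed
  \<comment> \<open>\<open>B\<close> is merely a left ideal, but the annihilator \<open>J\<close>
    containing it is two-sided because \<open>N\<close> is a left ideal.\<close>
  define J where "J = {a \<in> carrier R. \<forall>n\<in>N. a \<otimes> n \<in> S}"
  have Nc: "n \<in> carrier R" if "n \<in> N" for n using that assms lid_closed by blast
  have "lid J"
    using lS Nc by (intro lidI) (auto simp: J_def l_distr m_assoc lid_zero intro: lid_add lid_mult)
  then have J: "tid J"
    using assms(2) Nc lid_mult[OF assms(2)] by (auto simp: tid_def J_def m_assoc)
  have "B \<subseteq> J"
    using Bn lid_closed[OF assms(3)] by (auto simp: J_def lmul_def)
  then have "\<not> J \<subseteq> P" using assms(4) by blast
  moreover have "\<forall>a\<in>J. \<forall>y\<in>ladd S N. a \<otimes> y \<in> S"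
  proof (intro ballI)
    fix a y assume a: "a \<in> J" "y \<in> ladd S N"
    then obtain s n where *: "s \<in> S" "n \<in> N" "y = s \<oplus> n" by (auto elim: laddE)
    have "a \<otimes> y = a \<otimes> s \<oplus> a \<otimes> n"
      using * a Nc lid_closed[OF lS(1)] by (simp add: J_def r_distr)
    then show "a \<otimes> y \<in> S"
      using a * lS by (simp add: J_def lid_add lid_mult)
  qed
  ultimately have "small k P S (ladd S N)"
    using J lS assms(2) by (intro small_ann) (auto simp: lid_ladd ladd_upper1)
  from small_trans[OF S this] have "small k P Y (ladd S N)" .
  then have "small k P Y (ladd Y N)"
    by (rule small_sub) (use assms(1,2) lS in \<open>simp_all add: lid_ladd ladd_mono ladd_upper1\<close>)
  then show False using assms(5) by simp
qed

end

section \<open>Reduction at a single prime\<close>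

context left_noetherian_ring
begin

definition prm :: "'a set \<Rightarrow> bool"
  where "prm P \<longleftrightarrow> tid P \<and> P \<noteq> carrier R \<and>
    (\<forall>a\<in>carrier R. \<forall>b\<in>carrier R. (\<forall>x\<in>carrier R. a \<otimes> x \<otimes> b \<in> P) \<longrightarrow> a \<in> P \<or> b \<in> P)"

lemma prm_tid: "prm P \<Longrightarrow> tid P"
  and prm_lid: "prm P \<Longrightarrow> lid P"
  by (simp_all add: prm_def tid_lid)

lemma prmD:
  "prm P \<Longrightarrow> a \<in> carrier R \<Longrightarrow> b \<in> carrier R \<Longrightarrow> a \<notin> P \<Longrightarrow> b \<notin> P \<Longrightarrow> \<exists>x\<in>carrier R. a \<otimes> x \<otimes> b \<notin> P"
  unfolding prm_def by blast

lemma ladd_commute: "lid A \<Longrightarrow> lid B \<Longrightarrow> ladd A B = ladd B A"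
  by (intro subset_antisym ladd_least ladd_upper1 ladd_upper2 lid_ladd)

lemma ladd_assoc:
  assumes "lid A" "lid B" "lid C"
  shows "ladd (ladd A B) C = ladd A (ladd B C)"
proof -
  note l = lid_ladd assms
  have "A \<subseteq> ladd A (ladd B C)" "B \<subseteq> ladd A (ladd B C)" "C \<subseteq> ladd A (ladd B C)"
    "A \<subseteq> ladd (ladd A B) C" "B \<subseteq> ladd (ladd A B) C" "C \<subseteq> ladd (ladd A B) C"
    using ladd_upper1[of A "ladd B C"] ladd_upper2[of A "ladd B C"] ladd_upper1[of B C] ladd_upper2[of B C]
      ladd_upper1[of "ladd A B" C] ladd_upper2[of "ladd A B" C] ladd_upper1[of A B] ladd_upper2[of A B] l
    by (meson subset_trans)+
  then show ?thesis
    by (intro subset_antisym ladd_least) (simp_all add: l)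
qed

text \<open>A maximal small extension \<open>S\<close> of \<open>P\<close> containing
  \<open>N\<close> absorbs its right translates, whose images modulo \<open>S\<close> are small
  again. Hence \<open>S\<close> is a two-sided ideal not inside \<open>P\<close>, and it annihilates
  the remaining factor above \<open>S\<close>.\<close>

lemma small_prime_top:
  assumes P: "tid P" and N: "small k P P N" "P \<noteq> N"
  shows "small k P P (carrier R)"
proof -
  obtain S where S: "small k P P S" "N \<subseteq> S"
    and S_max: "\<And>S'. small k P P S' \<and> N \<subseteq> S' \<Longrightarrow> S \<subseteq> S' \<Longrightarrow> S' = S"
    by (rule lid_maximal[where Q = "\<lambda>S. small k P P S \<and> N \<subseteq> S" and L = N]) (use N small_lid in auto)
  have lS: "lid S" "P \<subseteq> S" using small_lid[OF S(1)] by auto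
  have "s \<otimes> x \<in> S" if s: "s \<in> S" "x \<in> carrier R" for s x
  proof -
    have "lmul P x \<subseteq> S"
      using tid_mult[OF P] s lS by (auto simp: lmul_def)
    then have "ladd (lmul P x) S = S"
      using lS s P by (intro ladd_absorb1) (auto simp: lid_lmul tid_lid)
    then have "small k P S (ladd (lmul S x) S)"
      using small_img[OF S(1) lS(1) s(2)] by simp
    then have "small k P P (ladd (lmul S x) S)" "S \<subseteq> ladd (lmul S x) S"
      using small_trans[OF S(1)] small_lid by blast+
    then have "ladd (lmul S x) S = S"
      using S_max S(2) by blast
    then show ?thesis
      using ladd_upper1[of "lmul S x" S] lid_lmul[OF lS(1) s(2)] lS lmulI[OF s(1)] by blast
  qed
  then have "tid S" using lS by (simp add: tid_def)
  moreover have "\<not> S \<subseteq> P" using S(2) N small_lid[OF N(1)] by blast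
  ultimately have "small k P S (carrier R)"
    using lS lid_carrier by (intro small_ann[of _ _ S]) (auto simp: lid_carrier_self tid_mult)
  with S(1) show ?thesis by (rule small_trans)
qed

text \<open>A noetherian ring contains no infinite direct sum \<open>I + I v + I v\<^sup>2 + \<dots>\<close>, so that \<open>v\<close> can only
  be regular modulo \<open>I\<close> if \<open>I = P\<close>. In that case all factors of the chain \<open>P + A v\<^sup>i\<close> are isomorphic.\<close>

lemma small_regular:
  assumes P: "prm P" and I: "lid I" "P \<subseteq> I" and v: "v \<in> carrier R" and w: "w \<in> carrier R"
    and sm: "small (Suc k) P I (ladd I (lprin w))"
    and reg: "\<And>b. b \<in> carrier R \<Longrightarrow> b \<otimes> v \<in> I \<Longrightarrow> b \<in> P"
  shows "small k P (ladd I (lprin v)) (ladd (ladd I (lprin v)) (lprin w))"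
proof (cases "I = P")
  case False
  then obtain x where x: "x \<in> I" "x \<notin> P" using I(2) by blast
  \<comment> \<open>\<open>S n\<close> is \<open>I + I v + ... + I v^(n-1) + P v^n\<close> and
    \<open>y n\<close> is \<open>x v^n\<close>. Regularity of \<open>v\<close> modulo
    \<open>I\<close> puts \<open>y n\<close> into \<open>S (Suc n)\<close> but not into
    \<open>S n\<close>, so the chain would ascend strictly forever.\<close>
  define S where "S = rec_nat P (\<lambda>_ S. ladd I (lmul S v))"
  define y where "y = rec_nat x (\<lambda>_ y. y \<otimes> v)"
  have S: "S 0 = P" "\<And>n. S (Suc n) = ladd I (lmul (S n) v)"
    and y: "y 0 = x" "\<And>n. y (Suc n) = y n \<otimes> v" by (simp_all add: S_def y_def)
  have yc: "y n \<in> carrier R" for n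
    by (induction n) (use x I v lid_closed in \<open>auto simp: y\<close>)
  have lS: "lid (S n)" for n
    by (induction n) (use P I v in \<open>auto simp: S prm_lid lid_ladd lid_lmul\<close>)
  have SI: "I \<subseteq> S (Suc n)" for n
    using I lS v by (simp add: S ladd_upper1 lid_lmul)
  have PS: "P \<subseteq> S n" for n
    using SI I by (cases n) (auto simp: S)
  have S_mono: "S n \<subseteq> S (Suc n)" for n
  proof (induction n)
    case 0
    then show ?case using PS[of "Suc 0"] by (simp add: S(1))
  next
    case (Suc n)
    then have "ladd I (lmul (S n) v) \<subseteq> ladd I (lmul (S (Suc n)) v)"
      by (intro ladd_mono lmul_mono order_refl)
    then show ?case unfolding S(2)[symmetric] .
  qed
  have y_in: "y n \<in> S (Suc n)" for n
  proof (induction n)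
    case 0
    then show ?case using SI x by (auto simp: y)
  next
    case (Suc n)
    then show ?case
      using ladd_upper2[OF I(1) lid_lmul[OF lS[of "Suc n"] v]] by (auto simp: y S(2)[of "Suc n"] intro: lmulI)
  qed
  have y_notin: "y n \<notin> S n" for n
  proof (induction n)
    case 0
    then show ?case using x by (simp add: y S)
  next
    case (Suc n)
    show ?case
    proof
      assume "y (Suc n) \<in> S (Suc n)"
      then obtain i s where *: "i \<in> I" "s \<in> S n" "y n \<otimes> v = i \<oplus> s \<otimes> v"
        by (auto simp: y S ladd_def lmul_def)
      have c: "i \<in> carrier R" "s \<in> carrier R" using * I lS lid_closed by blast+
      then have "(y n \<ominus> s) \<otimes> v = i"
        using * yc v by (simp add: minus_eq l_distr l_minus a_assoc r_neg)
      then have "y n \<ominus> s \<in> P" using reg * c yc by simp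
      then have "y n \<ominus> s \<oplus> s \<in> S n" using PS lS * lid_add by blast
      then show False using Suc c yc by (simp add: minus_eq a_assoc l_neg)
    qed
  qed
  have "mono S" using S_mono by (simp add: mono_iff_le_Suc)
  then obtain N where "\<forall>i\<ge>N. S i = S N"
    using accD[OF acc_lid, of S] lS by blast
  then have "S (Suc N) = S N" by (meson le_Suc_eq order_refl)
  then show ?thesis using y_in[of N] y_notin[of N] by blast
next
  case True
  have tP: "tid P" "lid P" using P prm_tid prm_lid by blast+
  show ?thesis
  proof (cases "w \<in> P")
    case True
    then have "lprin w \<subseteq> ladd I (lprin v)"
      using \<open>I = P\<close> I v w lprin_least[OF tP(2) True] ladd_upper1[OF I(1) lid_lprin[OF v]] by blast
    then have "ladd (ladd I (lprin v)) (lprin w) = ladd I (lprin v)"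
      using I v w by (simp add: ladd_absorb2 lid_ladd lid_lprin)
    then show ?thesis using I v small_refl by (simp add: lid_ladd lid_lprin)
  next
    case False
    have "w \<in> ladd I (lprin w)"
      using ladd_upper2[OF I(1) lid_lprin[OF w]] lprin_self[OF w] by blast
    then have top: "small (Suc k) P P (carrier R)"
      using small_prime_top[OF tP(1), of "Suc k" "ladd P (lprin w)"] sm False \<open>I = P\<close> by auto
    then obtain b where b: "bounded_steps k P P (carrier R) b"
      using small_bounded_steps by blast
    define D where "D j = ladd P (lprin (v [^] j))" for j :: nat
    have vc: "v [^] j \<in> carrier R" for j :: nat using v by simp
    have D: "lid (D j)" "P \<subseteq> D j" for j
      using tP vc by (simp_all add: D_def lid_ladd ladd_upper1 lid_lprin)
    have D_mono: "D (Suc j) \<subseteq> D j" for j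
    proof -
      have "v [^] Suc j \<in> lprin (v [^] j)"
        using nat_pow_Suc2[OF v, of j] lmulI[OF v] by simp
      then have "lprin (v [^] Suc j) \<subseteq> lprin (v [^] j)"
        by (intro lprin_least lid_lprin vc)
      then show ?thesis by (simp add: D_def ladd_mono)
    qed
    \<comment> \<open>The powers of \<open>v\<close> read backwards form an ascending chain with one
      step more than the bound \<open>b\<close> permits to be large, so some step is small.\<close>
    define c where "c i = D (Suc b - i)" for i
    have "lid_chain c (Suc b) P (carrier R)"
      unfolding lid_chain_def c_def
    proof (intro conjI allI impI)
      fix i assume "i < Suc b"
      then have e: "Suc b - i = Suc (Suc b - Suc i)" by simp
      show "D (Suc b - i) \<subseteq> D (Suc b - Suc i)" unfolding e by (rule D_mono)
    qed (use D lid_carrier in auto)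
    then have le: "card (large_steps k P c (Suc b)) \<le> b"
      using b unfolding bounded_steps_def by blast
    have "\<exists>i<Suc b. small k P (c i) (c (Suc i))"
    proof (rule ccontr)
      assume "\<not> ?thesis"
      then have "large_steps k P c (Suc b) = {..<Suc b}"
        unfolding large_steps_def by blast
      then show False using le by simp
    qed
    then obtain i where i: "i < Suc b" "small k P (c i) (c (Suc i))" by blast
    define j where "j = b - i"
    have "c i = D (Suc j)" "c (Suc i) = D j"
      using i by (auto simp: c_def j_def Suc_diff_le)
    \<comment> \<open>Dividing by \<open>v^j\<close> identifies this small factor with one whose
      bottom lies in \<open>P + R v\<close> and whose top is the whole ring, because right
      multiplication by \<open>v^j\<close> is injective modulo \<open>P\<close>.\<close>
    then have "small k P (lquo (D (Suc j)) (v [^] j)) (lquo (D j) (v [^] j))"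
      using small_quo[OF i(2) vc[of j]] by simp
    moreover have "lquo (D j) (v [^] j) = carrier R"
      using ladd_upper2[OF tP(2) lid_lprin[OF vc[of j]]] by (auto simp: lquo_def D_def intro: lmulI)
    moreover have reg': "b \<in> P" if "b \<in> carrier R" "b \<otimes> v [^] j \<in> P" for b and j :: nat
      using that
    proof (induction j)
      case (Suc j)
      have "b \<otimes> v [^] j \<otimes> v \<in> I" using Suc.prems v \<open>I = P\<close> by (simp add: m_assoc)
      then show ?case using Suc reg v by simp
    qed simp
    have "lquo (D (Suc j)) (v [^] j) \<subseteq> ladd P (lprin v)"
    proof
      fix b assume "b \<in> lquo (D (Suc j)) (v [^] j)"
      then obtain p a where *: "b \<in> carrier R" "p \<in> P" "a \<in> carrier R" "b \<otimes> v [^] j = p \<oplus> a \<otimes> (v \<otimes> v [^] j)"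
        using nat_pow_Suc2[OF v, of j] by (auto simp: lquo_def D_def ladd_def lmul_def)
      have c: "p \<in> carrier R" using * tP lid_closed by blast
      then have "(b \<ominus> a \<otimes> v) \<otimes> v [^] j = p"
        using * v by (simp add: minus_eq l_distr l_minus a_assoc r_neg m_assoc)
      then have "(b \<ominus> a \<otimes> v) \<otimes> v [^] j \<in> P" using *(2) by (simp only:)
      moreover have "b \<ominus> a \<otimes> v \<in> carrier R" using *(1,3) v by simp
      ultimately have "b \<ominus> a \<otimes> v \<in> P" by (rule reg'[rotated])
      then have "b \<ominus> a \<otimes> v \<oplus> a \<otimes> v \<in> ladd P (lprin v)"
        using * by (intro laddI lmulI)
      then show "b \<in> ladd P (lprin v)"
        using * v by (simp add: minus_eq a_assoc l_neg)
    qed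
    ultimately have "small k P (lquo (D (Suc j)) (v [^] j)) (carrier R)" by simp
    then show ?thesis
      by (rule small_sub)
         (use \<open>lquo _ _ \<subseteq> _\<close> \<open>I = P\<close> tP v w in \<open>simp_all add: lid_ladd lid_lprin ladd_upper1 lid_carrier\<close>)
  qed
qed

text \<open>The element \<open>a\<close> maximizes the length of the trace of \<open>I + A (v + a w)\<close> on \<open>I + A w\<close>. If that trace
  is not everything, then \<open>B = (I : u)\<close> is not contained in \<open>P\<close> and there is \<open>n \<in> J w\<close> such that \<open>B n\<close> is
  large modulo \<open>I + A u\<close>, but \<open>B n\<close> and \<open>A n\<close> have the same length. As \<open>B (u + n)\<close> agrees with \<open>B n\<close> modulo
  \<open>I\<close>, replacing \<open>u\<close> by \<open>u + n\<close> gains \<open>B n\<close>, and it loses only a part of \<open>A n\<close>, which is small modulo \<open>B n\<close>.\<close>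

lemma reduce_prime:
  assumes P: "prm P" and J: "tid J" "\<not> J \<subseteq> P" and I: "lid I" "P \<subseteq> I"
    and v: "v \<in> carrier R" and w: "w \<in> carrier R"
    and sm: "small (Suc k) P I (ladd I (lprin w))"
  shows "\<exists>a\<in>J. small k P (ladd I (lprin (v \<oplus> a \<otimes> w))) (ladd (ladd I (lprin (v \<oplus> a \<otimes> w))) (lprin w))"
proof -
  define W where "W = ladd I (lprin w)"
  have W: "lid W" "I \<subseteq> W" "lprin w \<subseteq> W"
    using I w by (simp_all add: W_def lid_ladd lid_lprin ladd_upper1 ladd_upper2)
  obtain b where b: "bounded_steps k P I W b"
    using small_bounded_steps[OF sm] by (auto simp: W_def)
  have Jc: "a \<in> carrier R" if "a \<in> J" for a using that J tid_lid lid_closed by blast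
  define Y where "Y a = ladd I (lprin (v \<oplus> a \<otimes> w))" for a
  have lY: "lid (Y a)" "I \<subseteq> Y a" if "a \<in> carrier R" for a
    using that I v w by (simp_all add: Y_def lid_ladd lid_lprin ladd_upper1)
  have bound: "slength k P I (Y a \<inter> W) \<le> b" if "a \<in> J" for a
    by (rule slength_props(3)[OF bounded_steps_mono[OF b]]) (use lY[OF Jc[OF that]] W I in auto)
  obtain a where a: "a \<in> J" and a_max: "\<And>a'. a' \<in> J \<Longrightarrow> slength k P I (Y a' \<inter> W) \<le> slength k P I (Y a \<inter> W)"
  proof -
    have "\<exists>x. x \<in> J \<and> (\<forall>y. y \<in> J \<longrightarrow> slength k P I (Y y \<inter> W) \<le> slength k P I (Y x \<inter> W))"
      by (rule ex_has_greatest_nat[of _ \<zero> _ "Suc b"]) (use bound J lid_zero tid_lid in \<open>auto simp: less_Suc_eq_le\<close>)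
    then show ?thesis using that by blast
  qed
  have ac: "a \<in> carrier R" using Jc a by blast
  define u where "u = v \<oplus> a \<otimes> w"
  have u: "u \<in> carrier R" using v w ac by (simp add: u_def)
  have Ya: "Y a = ladd I (lprin u)" by (simp add: Y_def u_def)
  note lYa = lY[OF ac]
  have "small k P (Y a) (ladd (Y a) (lprin w))"
  proof (rule ccontr)
    assume large: "\<not> small k P (Y a) (ladd (Y a) (lprin w))"
    define B where "B = lquo I u"
    have lB: "lid B" using I u by (simp add: B_def lid_lquo)
    have B: "\<not> B \<subseteq> P"
    proof
      assume "B \<subseteq> P"
      then have "\<And>b. b \<in> carrier R \<Longrightarrow> b \<otimes> u \<in> I \<Longrightarrow> b \<in> P" by (auto simp: B_def lquo_def)
      then show False using small_regular[OF P I u w sm] large by (simp add: Ya)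
    qed
    \<comment> \<open>The candidates are recorded as pairs because \<open>n\<close> must have the
      form \<open>b0 w'\<close> with \<open>b0\<close> in \<open>J\<close> and \<open>w'\<close> a
      multiple of \<open>w\<close>: only then is \<open>u + n\<close> again of the form
      \<open>v + a' w\<close> with \<open>a'\<close> in \<open>J\<close>. Minimality of the length
      over all candidates will make \<open>B n\<close> as long as \<open>N\<close>.\<close>
    define good where "good B' w' \<longleftrightarrow> lid B' \<and> B' \<subseteq> J \<and> w' \<in> lprin w \<and> \<not> small k P (Y a) (ladd (Y a) (lmul B' w'))" for B' w'
    have lw: "lid (lprin w)" using w lid_lprin by blast
    have wc: "w' \<in> carrier R" if "w' \<in> lprin w" for w' using that lw lid_closed by blast
    obtain n0 where "good J n0"
      using exists_large_summand[OF lYa(1) lw tid_lid[OF J(1)] J(2) large] tid_lid[OF J(1)] by (auto simp: good_def)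
    then obtain B' w' where good: "good B' w'"
      and minimal: "\<And>B'' w''. good B'' w'' \<Longrightarrow> slength k P I (ladd I (lmul B' w')) \<le> slength k P I (ladd I (lmul B'' w''))"
      using ex_has_least_nat[of "\<lambda>(B, w). good B w" "(J, n0)" "\<lambda>(B, w). slength k P I (ladd I (lmul B w))"] by auto
    define N where "N = lmul B' w'"
    have B': "lid B'" "B' \<subseteq> J" and w': "w' \<in> lprin w" "w' \<in> carrier R"
      and largeN: "\<not> small k P (Y a) (ladd (Y a) N)"
      using good wc by (auto simp: good_def N_def)
    have lN: "lid N" using B' w' by (simp add: N_def lid_lmul)
    have NW: "N \<subseteq> W"
      using W w' B' lid_mult[OF lw] lid_closed by (auto simp: N_def lmul_def[of B'])
    obtain n where n: "n \<in> N" "\<not> small k P (Y a) (ladd (Y a) (lmul B n))"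
      using exists_large_summand[OF lYa(1) lN lB B largeN] by blast
    then obtain b0 where b0: "b0 \<in> B'" "n = b0 \<otimes> w'" by (auto simp: N_def lmul_def)
    have b0c: "b0 \<in> carrier R" and nc: "n \<in> carrier R" using b0 B' n lN lid_closed by blast+
    have Bn: "lmul B n = lmul (lmul B b0) w'"
      using lmul_lmul[OF lid_carrier[OF lB] b0c w'(2)] b0 by simp
    have "lmul B b0 \<subseteq> B'"
      using B' b0 lB lid_closed lid_mult by (auto simp: lmul_def)
    \<comment> \<open>\<open>B n\<close> equals \<open>(B b0) w'\<close> and is large by the choice
      of \<open>n\<close>, so it competes in the minimization while being contained in
      \<open>N\<close>.\<close>
    then have "good (lmul B b0) w'"
      using n(2) w' lB b0c B' by (auto simp: good_def Bn lid_lmul)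
    from minimal[OF this] have le: "slength k P I (ladd I N) \<le> slength k P I (ladd I (lmul B n))"
      by (simp add: Bn N_def)
    have lBn: "lid (lmul B n)" and lAn: "lid (lprin n)" using lB nc by (simp_all add: lid_lmul lid_lprin)
    have An: "lprin n \<subseteq> N" using lN n by (simp add: lprin_least)
    have BA: "lmul B n \<subseteq> lprin n" using lB lid_carrier lmul_mono by blast
    have "small k P (ladd I (lmul B n)) (ladd I N)"
    proof (rule ccontr)
      assume "\<not> ?thesis"
      then have "slength k P I (ladd I (lmul B n)) < slength k P I (ladd I N)"
        by (intro slength_strict[OF b])
           (use I lN lBn BA An NW W in \<open>simp_all add: lid_ladd ladd_upper1 ladd_mono ladd_least subset_trans[OF BA An]\<close>)
      then show False using le by simp
    qed
    then have sn: "small k P (ladd I (lmul B n)) (ladd I (lprin n))"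
      by (rule small_sub) (use I lBn lAn An BA in \<open>simp_all add: lid_ladd ladd_mono\<close>)
    obtain r where r: "r \<in> carrier R" "w' = r \<otimes> w" using w' by (auto simp: lmul_def)
    \<comment> \<open>With \<open>w' = r w\<close> one has \<open>n = (b0 r) w\<close>, and
      \<open>b0 r\<close> stays in the two-sided ideal \<open>J\<close>.\<close>
    define a' where "a' = a \<oplus> b0 \<otimes> r"
    have a': "a' \<in> J"
      using a b0 r B' J tid_mult[OF J(1)] lid_add[OF tid_lid[OF J(1)]] by (auto simp: a'_def)
    have a'c: "a' \<in> carrier R" using a' Jc by blast
    define u' where "u' = v \<oplus> a' \<otimes> w"
    have u'c: "u' \<in> carrier R" using v w a'c by (simp add: u'_def)
    have u': "u' = u \<oplus> n"
      using v w ac b0c r by (simp add: u'_def u_def a'_def b0(2) l_distr m_assoc a_assoc)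
    note lZ = lY[OF a'c]
    define Z where "Z = Y a' \<inter> W"
    have Z: "lid Z" "I \<subseteq> Z" "Z \<subseteq> W" using lZ W by (simp_all add: Z_def lid_Int)
    have Yu': "b \<otimes> u' \<in> Y a'" if "b \<in> carrier R" for b
      using ladd_upper2[OF I(1) lid_lprin[OF u'c]] lmulI[OF that, of u'] by (auto simp: Y_def u'_def)
    have BnZ: "lmul B n \<subseteq> Z"
    proof
      fix z assume z: "z \<in> lmul B n"
      then obtain b where *: "b \<in> B" "z = b \<otimes> n" by (auto simp: lmul_def)
      have bc: "b \<in> carrier R" "b \<otimes> u \<in> I" using * by (auto simp: B_def lquo_def)
      have "b \<otimes> n \<oplus> b \<otimes> u \<in> Y a'"
        using Yu'[OF bc(1)] u nc bc by (simp add: u' r_distr a_comm)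
      then have "b \<otimes> n \<in> Y a'"
        using bc nc lZ by (intro lid_diff_cancel[of "Y a'" "b \<otimes> n" "b \<otimes> u"]) auto
      then show "z \<in> Z" using z * BA An NW by (auto simp: Z_def)
    qed
    have ZA: "lid (ladd Z (lprin n))" "ladd Z (lprin n) \<subseteq> W"
      using Z lAn W subset_trans[OF An NW] by (simp_all add: lid_ladd ladd_least)
    have "small k P (ladd (ladd I (lmul B n)) Z) (ladd (ladd I (lprin n)) Z)"
      by (rule small_add[OF sn Z(1)])
    moreover have "ladd (ladd I (lmul B n)) Z = Z"
      using I lBn Z BnZ by (simp add: ladd_absorb1 lid_ladd ladd_least)
    moreover have "ladd (ladd I (lprin n)) Z = ladd Z (lprin n)"
      using ladd_commute[of "ladd I (lprin n)" Z] ladd_assoc[of Z I "lprin n"] I lAn Z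
      by (simp add: lid_ladd ladd_absorb2)
    \<comment> \<open>Adding all of \<open>R n\<close> to the new trace \<open>Z\<close> gains no
      length: \<open>Z\<close> contains \<open>B n\<close>, modulo which \<open>R n\<close> is
      small.\<close>
    ultimately have "slength k P I (ladd Z (lprin n)) \<le> slength k P I Z"
      using slength_small[OF b I(1) Z(2) ZA(2)] by simp
    moreover have "slength k P I (Y a \<inter> W) < slength k P I (ladd (Y a \<inter> W) (lmul B n))"
    proof (rule slength_strict[OF b I(1)])
      show "I \<subseteq> Y a \<inter> W" "lid (Y a \<inter> W)" "lid (ladd (Y a \<inter> W) (lmul B n))"
        "Y a \<inter> W \<subseteq> ladd (Y a \<inter> W) (lmul B n)" "ladd (Y a \<inter> W) (lmul B n) \<subseteq> W"
        using lYa W lBn subset_trans[OF BnZ Z(3)] by (simp_all add: lid_Int lid_ladd ladd_least ladd_upper1)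
      show "\<not> small k P (Y a \<inter> W) (ladd (Y a \<inter> W) (lmul B n))"
      proof
        assume "small k P (Y a \<inter> W) (ladd (Y a \<inter> W) (lmul B n))"
        from small_add[OF this lYa(1)]
        have "small k P (Y a) (ladd (ladd (Y a \<inter> W) (lmul B n)) (Y a))"
          using lYa W by (simp add: ladd_absorb1 lid_Int)
        moreover have "ladd (ladd (Y a \<inter> W) (lmul B n)) (Y a) = ladd (Y a) (lmul B n)"
          using ladd_commute[of "ladd (Y a \<inter> W) (lmul B n)" "Y a"] ladd_assoc[of "Y a" "Y a \<inter> W" "lmul B n"]
            lYa W lBn by (simp add: lid_ladd ladd_absorb2 lid_Int)
        ultimately show False using n(2) by simp
      qed
    qed
    moreover have "ladd (Y a \<inter> W) (lmul B n) \<subseteq> ladd Z (lprin n)"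
    proof (rule ladd_least[OF ZA(1)])
      show "lmul B n \<subseteq> ladd Z (lprin n)"
        using BnZ ladd_upper1[OF Z(1) lAn] by blast
      \<comment> \<open>An element \<open>i + x u\<close> of the old trace differs from
        \<open>i + x u'\<close>, which lies in the new trace, by the multiple \<open>x n\<close> of
        \<open>n\<close>.\<close>
      show "Y a \<inter> W \<subseteq> ladd Z (lprin n)"
      proof
        fix y assume y: "y \<in> Y a \<inter> W"
        then obtain i x where *: "i \<in> I" "x \<in> carrier R" "y = i \<oplus> x \<otimes> u"
          by (auto simp: Ya ladd_def lmul_def)
        have ic: "i \<in> carrier R" using * I lid_closed by blast
        have "i \<oplus> x \<otimes> u' \<in> Y a'"
          using * Yu' lZ by (auto intro!: lid_add)
        moreover have e: "i \<oplus> x \<otimes> u' = y \<oplus> x \<otimes> n"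
          using * ic u nc by (simp add: u' r_distr a_assoc)
        moreover have "y \<oplus> x \<otimes> n \<in> W"
          using y * W An NW lmulI[OF *(2), of n] by (auto intro!: lid_add)
        ultimately have "y \<oplus> x \<otimes> n \<in> Z" by (simp add: Z_def)
        then have "(y \<oplus> x \<otimes> n) \<oplus> (\<ominus> x) \<otimes> n \<in> ladd Z (lprin n)"
          using * by (intro laddI lmulI) auto
        moreover have "(y \<oplus> x \<otimes> n) \<oplus> (\<ominus> x) \<otimes> n = y"
          using * ic u nc by (simp add: l_minus a_assoc r_neg)
        ultimately show "y \<in> ladd Z (lprin n)" by simp
      qed
    qed
    then have "slength k P I (ladd (Y a \<inter> W) (lmul B n)) \<le> slength k P I (ladd Z (lprin n))"
      using slength_mono[OF b I(1) _ _ ZA(2)] lYa W lBn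
        ladd_upper1[of "Y a \<inter> W" "lmul B n"] lid_Int by (meson Int_greatest subset_trans)
    \<comment> \<open>The old trace is strictly shorter than its sum with \<open>B n\<close>, which
      is no longer than \<open>Z + R n\<close>, which is no longer than the new trace. This
      contradicts the choice of \<open>a\<close>.\<close>
    ultimately show False
      using a_max[OF a'] by (simp add: Z_def)
  qed
  then show ?thesis using a by (auto simp: Y_def)
qed

end

section \<open>Stable range of left noetherian rings\<close>

context left_noetherian_ring
begin

text \<open>The interval from \<open>L\<close> to \<open>Y\<close> becomes small after passing to a quotient annihilated by \<open>P\<close>.\<close>

definition small_mod :: "nat \<Rightarrow> 'a set \<Rightarrow> 'a set \<Rightarrow> 'a set \<Rightarrow> bool"
  where "small_mod k P L Y \<longleftrightarrow>
    (\<forall>T. lid T \<and> L \<subseteq> T \<and> (\<forall>p\<in>P. \<forall>y\<in>Y. p \<otimes> y \<in> T) \<longrightarrow> small k P T (ladd T Y))"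

lemma small_modD:
  "small_mod k P L Y \<Longrightarrow> lid T \<Longrightarrow> L \<subseteq> T \<Longrightarrow> (\<And>p y. p \<in> P \<Longrightarrow> y \<in> Y \<Longrightarrow> p \<otimes> y \<in> T) \<Longrightarrow>
    small k P T (ladd T Y)"
  by (simp add: small_mod_def)

lemma small_imp_small_mod:
  assumes "small k P L Y"
  shows "small_mod k P L Y"
  unfolding small_mod_def
proof (intro allI impI)
  fix T assume T: "lid T \<and> L \<subseteq> T \<and> (\<forall>p\<in>P. \<forall>y\<in>Y. p \<otimes> y \<in> T)"
  have "small k P (ladd L T) (ladd Y T)"
    using small_add[OF assms] T by blast
  then show "small k P T (ladd T Y)"
    using T small_lid[OF assms] ladd_absorb1[of L T] ladd_commute[of Y T] by auto
qed

lemma small_mod_trans: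
  assumes "lid L" "lid Y" "lid Z" "Y \<subseteq> Z" "small_mod k P L Y" "small_mod k P Y Z"
  shows "small_mod k P L Z"
  unfolding small_mod_def
proof (intro allI impI)
  fix T assume T: "lid T \<and> L \<subseteq> T \<and> (\<forall>p\<in>P. \<forall>y\<in>Z. p \<otimes> y \<in> T)"
  have "small k P T (ladd T Y)"
    by (rule small_modD[OF assms(5)]) (use T assms(4) in auto)
  moreover have "small k P (ladd T Y) (ladd (ladd T Y) Z)"
    by (rule small_modD[OF assms(6)])
       (use T assms(2) ladd_upper1[of T Y] ladd_upper2[of T Y] in \<open>auto simp: lid_ladd\<close>)
  moreover have "ladd (ladd T Y) Z = ladd T Z"
    using T assms ladd_assoc[of T Y Z] by (simp add: ladd_absorb1)
  ultimately show "small k P T (ladd T Z)"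
    using small_trans by auto
qed

text \<open>For a critical interval the only possible exception is the annihilator \<open>K\<close>
  of \<open>B / A\<close>. Indeed, if \<open>T\<close> meets \<open>B\<close> only in
  \<open>A\<close>, then \<open>P\<close> is inside \<open>K\<close>; when they differ,
  \<open>K\<close> is not inside \<open>P\<close> and makes \<open>B / A\<close> small. If
  \<open>T\<close> meets \<open>B\<close> in more, what remains is a proper quotient of a critical
  interval. Extensions only unite the finite sets of exceptions.\<close>

lemma finite_large_primes_dev:
  assumes "dev_less (Suc k) (between L Y)" "lid L" "lid Y" "L \<subseteq> Y"
  shows "finite {P. prm P \<and> \<not> small_mod k P L Y}"
proof (rule dev_Suc_induct[OF assms])
  fix A B C assume *: "lid A" "lid B" "lid C" "B \<subseteq> C"
    "finite {P. prm P \<and> \<not> small_mod k P A B}" "finite {P. prm P \<and> \<not> small_mod k P B C}"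
  have "{P. prm P \<and> \<not> small_mod k P A C} \<subseteq>
    {P. prm P \<and> \<not> small_mod k P A B} \<union> {P. prm P \<and> \<not> small_mod k P B C}"
    using small_mod_trans[OF *(1-4)] by blast
  then show "finite {P. prm P \<and> \<not> small_mod k P A C}"
    by (rule finite_subset) (use * in simp)
next
  fix A B assume "lid A" "lid B" "A \<subseteq> B" "dev_less k (between A B)"
  then have e: "{P. prm P \<and> \<not> small_mod k P A B} = {}"
    using small_imp_small_mod[OF small_dev] by blast
  show "finite {P. prm P \<and> \<not> small_mod k P A B}" unfolding e by simp
next
  fix A B assume AB: "lid A" "lid B" "A \<subseteq> B"
    and cr: "\<And>C. lid C \<Longrightarrow> A \<subset> C \<Longrightarrow> C \<subseteq> B \<Longrightarrow> dev_less k (between C B)"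
  define K where "K = {a \<in> carrier R. \<forall>y\<in>B. a \<otimes> y \<in> A}"
  have Bc: "y \<in> carrier R" if "y \<in> B" for y using that AB lid_closed by blast
  have "lid K"
    using AB Bc by (intro lidI) (auto simp: K_def l_distr m_assoc lid_zero intro: lid_add lid_mult)
  then have K: "tid K"
    using Bc lid_mult[OF AB(2)] by (auto simp: tid_def K_def m_assoc)
  have "small_mod k P A B" if P: "prm P" "P \<noteq> K" for P
    unfolding small_mod_def
  proof (intro allI impI)
    fix T assume T: "lid T \<and> A \<subseteq> T \<and> (\<forall>p\<in>P. \<forall>y\<in>B. p \<otimes> y \<in> T)"
    have TB: "lid (T \<inter> B)" "A \<subseteq> T \<inter> B" using T AB by (simp_all add: lid_Int)
    show "small k P T (ladd T B)"
    proof (cases "T \<inter> B = A")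
      case True
      have "p \<in> K" if p: "p \<in> P" for p
      proof -
        have "p \<in> carrier R" using p prm_lid[OF P(1)] lid_closed by blast
        moreover have "p \<otimes> y \<in> T \<inter> B" if "y \<in> B" for y
          using T p that lid_mult[OF AB(2) \<open>p \<in> carrier R\<close>] by blast
        ultimately show ?thesis using True by (simp add: K_def)
      qed
      then have "\<not> K \<subseteq> P" using P(2) by blast
      then have "small k P A B"
        by (intro small_ann[OF AB K]) (simp_all add: K_def)
      then show ?thesis using small_modD[OF small_imp_small_mod] T by blast
    next
      case False
      then have "dev_less k (between (T \<inter> B) B)" using cr[OF TB(1)] TB by blast
      then have "small k P (T \<inter> B) B" using TB AB by (intro small_dev) auto
      then have "small k P (ladd (T \<inter> B) T) (ladd B T)" using small_add T by blast
      moreover have "ladd (T \<inter> B) T = T" using T TB by (simp add: ladd_absorb1)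
      ultimately show ?thesis using ladd_commute[of B T] T AB by simp
    qed
  qed
  then have "{P. prm P \<and> \<not> small_mod k P A B} \<subseteq> {K}" by blast
  then show "finite {P. prm P \<and> \<not> small_mod k P A B}" by (rule finite_subset) simp
qed

definition prime_small :: "nat \<Rightarrow> 'a set \<Rightarrow> 'a \<Rightarrow> 'a set \<Rightarrow> bool"
  where "prime_small k I w P \<longleftrightarrow> small k P (ladd I P) (ladd (ladd I P) (lprin w))"

lemma tid_Inter: "\<F> \<noteq> {} \<Longrightarrow> (\<And>K. K \<in> \<F> \<Longrightarrow> tid K) \<Longrightarrow> tid (\<Inter>\<F>)"
  unfolding tid_def
proof (intro conjI lidI ballI)
  assume ne: "\<F> \<noteq> {}" and t: "\<And>K. K \<in> \<F> \<Longrightarrow> lid K \<and> (\<forall>a\<in>K. \<forall>x\<in>carrier R. a \<otimes> x \<in> K)"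
  show "\<Inter>\<F> \<subseteq> carrier R" using ne t lid_carrier by blast
  show "\<zero> \<in> \<Inter>\<F>" using t lid_zero by blast
  show "x \<oplus> y \<in> \<Inter>\<F>" if "x \<in> \<Inter>\<F>" "y \<in> \<Inter>\<F>" for x y
    using that t by (blast intro: lid_add)
  show "a \<otimes> x \<in> \<Inter>\<F>" if "a \<in> carrier R" "x \<in> \<Inter>\<F>" for a x
    using that t by (blast intro: lid_mult)
  show "a \<otimes> x \<in> \<Inter>\<F>" if "a \<in> \<Inter>\<F>" "x \<in> carrier R" for a x
    using that t by blast
qed

text \<open>Noetherian induction on a two-sided ideal \<open>J\<close> with infinitely many
  exceptional primes above it. If \<open>J\<close> is prime, smallness at \<open>J\<close> already
  forces smallness at the primes above it, except finitely many and those above strictly larger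
  ideals. Otherwise every prime above \<open>J\<close> lies above one of two strictly larger
  ideals.\<close>

lemma finite_large_primes_above:
  assumes I: "lid I" and w: "w \<in> carrier R"
    and sm: "\<And>P. prm P \<Longrightarrow> prime_small (Suc k) I w P"
  shows "finite {P. prm P \<and> \<not> prime_small k I w P}"
proof (rule ccontr)
  let ?F = "\<lambda>J. {P. prm P \<and> J \<subseteq> P \<and> \<not> prime_small k I w P}"
  assume "\<not> ?thesis"
  moreover have "?F {\<zero>} = {P. prm P \<and> \<not> prime_small k I w P}"
    using prm_lid lid_zero by blast
  ultimately have "tid {\<zero>} \<and> infinite (?F {\<zero>})"
    by (auto simp: tid_def lid_trivial)
  then obtain J where J: "tid J \<and> infinite (?F J)"
    and J_max: "\<And>K. tid K \<and> infinite (?F K) \<Longrightarrow> J \<subseteq> K \<Longrightarrow> K = J"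
    by (rule lid_maximal[where Q = "\<lambda>J. tid J \<and> infinite (?F J)"]) (use tid_lid in blast)+
  have fin: "finite (?F K)" if "tid K" "J \<subset> K" for K
    using J_max[of K] that by blast
  have lJ: "lid J" using J tid_lid by blast
  show False
  proof (cases "prm J")
    case True
    \<comment> \<open>A series witnessing smallness at \<open>J\<close> is followed factor by
      factor. A factor killed by \<open>K\<close> not inside \<open>J\<close> is small at each prime
      not containing \<open>K\<close>; the other primes contain \<open>J + K\<close>, and maximality
      of \<open>J\<close> leaves only finitely many exceptions there.\<close>
    have main: "finite {P. prm P \<and> J \<subset> P \<and> \<not> prime_small k I w P \<and> \<not> small_mod k P L Y}"
      if "small (Suc k) J L Y" for L Y
      using that
    proof (induction rule: small.induct)
      case (small_dev L Y)
      show ?case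
        by (rule finite_subset[OF _ finite_large_primes_dev[OF small_dev(4,1-3)]]) blast
    next
      case (small_ann L Y K)
      let ?K = "ladd J K"
      have lK: "lid K" using small_ann tid_lid by blast
      have "tid ?K"
      proof -
        have "z \<otimes> x \<in> ?K" if z: "z \<in> ?K" "x \<in> carrier R" for z x
        proof -
          obtain a b where *: "a \<in> J" "b \<in> K" "z = a \<oplus> b" using z(1) by (rule laddE)
          have "a \<in> carrier R" "b \<in> carrier R" using * lJ lK lid_closed by blast+
          then have "z \<otimes> x = a \<otimes> x \<oplus> b \<otimes> x" using * z(2) by (simp add: l_distr)
          then show ?thesis using * z J small_ann(4) by (simp add: laddI tid_mult)
        qed
        then show ?thesis using lJ lK by (simp add: tid_def lid_ladd)
      qed
      moreover have "J \<subset> ?K"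
        using small_ann(5) ladd_upper1[OF lJ lK] ladd_upper2[OF lJ lK] by blast
      ultimately have "finite (?F ?K)" by (rule fin)
      moreover have "?K \<subseteq> P" if "prm P" "J \<subset> P" "\<not> small_mod k P L Y" for P
      proof -
        have "K \<subseteq> P"
        proof (rule ccontr)
          assume "\<not> K \<subseteq> P"
          then have "small k P L Y"
            using small_ann by (intro small.small_ann[of L Y K]) auto
          then show False using that small_imp_small_mod by blast
        qed
        then show ?thesis using that prm_lid by (intro ladd_least) auto
      qed
      ultimately show ?case by (elim rev_finite_subset) blast
    next
      case (small_trans L Y Z)
      have l: "lid L" "lid Y" "lid Z" "Y \<subseteq> Z"
        using small_lid[OF small_trans.hyps(1)] small_lid[OF small_trans.hyps(2)] by auto
      show ?case
        by (rule finite_subset[OF _ finite_UnI[OF small_trans.IH]]) (use small_mod_trans[OF l] in blast)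
    qed
    let ?V = "\<lambda>P. ladd I P" and ?W = "\<lambda>P. ladd (ladd I P) (lprin w)"
    have lw: "lid (lprin w)" using w lid_lprin by blast
    \<comment> \<open>This is why \<open>small_mod\<close> quantifies over \<open>T\<close>: one
      passes from \<open>J\<close> to the larger prime \<open>P\<close> by taking
      \<open>T = I + P\<close>, which contains \<open>P y\<close> for every
      \<open>y\<close>.\<close>
    have "prime_small k I w P" if P: "prm P" "J \<subseteq> P" and good: "small_mod k P (?V J) (?W J)" for P
    proof -
      have lP: "lid P" and tP: "tid P" using P prm_lid prm_tid by blast+
      have lVP: "lid (?V P)" and lVJ: "lid (?V J)" and lWJ: "lid (?W J)"
        using I lP lJ lw by (simp_all add: lid_ladd)
      have sub: "?V J \<subseteq> ?V P" using P by (simp add: ladd_mono)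
      have "small k P (?V P) (ladd (?V P) (?W J))"
      proof (rule small_modD[OF good lVP sub])
        fix p y assume "p \<in> P" "y \<in> ?W J"
        then have "p \<otimes> y \<in> P" using tP lWJ tid_mult lid_closed by blast
        then show "p \<otimes> y \<in> ?V P" using ladd_upper2[OF I lP] by blast
      qed
      moreover have "ladd (?V P) (?W J) = ?W P"
        using ladd_assoc[OF lVP lVJ lw] ladd_absorb2[OF lVP lVJ sub] by simp
      ultimately show ?thesis by (simp add: prime_small_def)
    qed
    then have "?F J \<subseteq> insert J {P. prm P \<and> J \<subset> P \<and> \<not> prime_small k I w P \<and> \<not> small_mod k P (?V J) (?W J)}"
      by blast
    moreover have "finite \<dots>"
      using main sm[OF True] by (simp add: prime_small_def)
    ultimately show False using J finite_subset by blast
  next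
    case False
    have ne: "J \<noteq> carrier R"
    proof
      assume "J = carrier R"
      then have "\<not> J \<subseteq> P" if "prm P" for P
        using that lid_carrier[OF prm_lid[OF that]] by (auto simp: prm_def)
      then have e: "?F J = {}" by blast
      show False using J unfolding e by simp
    qed
    then obtain a b where ab: "a \<in> carrier R" "b \<in> carrier R" "\<forall>x\<in>carrier R. a \<otimes> x \<otimes> b \<in> J" "a \<notin> J" "b \<notin> J"
      using False J unfolding prm_def by blast
    \<comment> \<open>The two-sided ideal generated by \<open>J\<close> and \<open>c\<close>. A
      prime above \<open>J\<close> contains \<open>a\<close> or \<open>b\<close>, hence one of the
      two generated ideals.\<close>
    define gen where "gen c = \<Inter>{K. tid K \<and> J \<subseteq> K \<and> c \<in> K}" for c
    have gen: "tid (gen c)" "J \<subset> gen c" if "c \<in> carrier R" "c \<notin> J" for c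
    proof -
      have "carrier R \<in> {K. tid K \<and> J \<subseteq> K \<and> c \<in> K}"
        using that lJ lid_carrier tid_carrier by simp
      then show "tid (gen c)" unfolding gen_def by (intro tid_Inter) auto
      have "J \<subseteq> gen c" "c \<in> gen c" by (auto simp: gen_def)
      then show "J \<subset> gen c" using that by blast
    qed
    have "gen a \<subseteq> P \<or> gen b \<subseteq> P" if P: "prm P" "J \<subseteq> P" for P
    proof -
      have "a \<in> P \<or> b \<in> P"
        using prmD[OF P(1) ab(1,2)] ab(3) P(2) by blast
      moreover have "gen c \<subseteq> P" if "c \<in> P" for c
        using that P prm_tid unfolding gen_def by blast
      ultimately show ?thesis by blast
    qed
    then have "?F J \<subseteq> ?F (gen a) \<union> ?F (gen b)" by blast
    moreover have "finite (?F (gen a) \<union> ?F (gen b))"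
      using fin[OF gen[OF ab(1,4)]] fin[OF gen[OF ab(2,5)]] by simp
    ultimately show False using J finite_subset by blast
  qed
qed

text \<open>By primality a product of ideals not inside \<open>P\<close> is not inside
  \<open>P\<close>, so neither is an intersection of finitely many of them. The result confines
  corrections at \<open>P\<close> to elements that vanish modulo the other primes.\<close>

lemma exists_ideal_below:
  assumes "prm P" "finite \<F>" "\<And>Q. Q \<in> \<F> \<Longrightarrow> tid Q \<and> \<not> Q \<subseteq> P"
  shows "\<exists>J. tid J \<and> \<not> J \<subseteq> P \<and> (\<forall>Q\<in>\<F>. J \<subseteq> Q)"
  using assms(2,3)
proof (induction \<F>)
  case empty
  have "\<not> carrier R \<subseteq> P" using assms(1) lid_carrier[OF prm_lid] by (auto simp: prm_def)
  then show ?case using tid_carrier by blast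
next
  case (insert Q \<F>)
  then obtain J where J: "tid J" "\<not> J \<subseteq> P" "\<forall>Q\<in>\<F>. J \<subseteq> Q" by blast
  obtain a b where ab: "a \<in> J" "a \<notin> P" "b \<in> Q" "b \<notin> P" using J insert.prems by blast
  have Q: "tid Q" using insert.prems by simp
  have c: "a \<in> carrier R" "b \<in> carrier R"
    using ab J Q tid_lid lid_closed by blast+
  then obtain x where x: "x \<in> carrier R" "a \<otimes> x \<otimes> b \<notin> P"
    using prmD[OF assms(1)] ab by blast
  have "a \<otimes> x \<otimes> b \<in> J" "a \<otimes> x \<otimes> b \<in> Q"
    using ab x c J Q by (simp_all add: tid_mult lid_mult tid_lid)
  then show ?case
    using J Q x by (intro exI[of _ "J \<inter> Q"]) (auto simp: tid_Int)
qed

text \<open>A minimal member \<open>P\<close> is treated last. By minimality none of the other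
  primes lies inside \<open>P\<close>, so there is an ideal \<open>J\<close> inside all of them but
  not inside \<open>P\<close>. The final correction \<open>a' w\<close> with \<open>a'\<close> in
  \<open>J\<close> then leaves \<open>I + R u + Q\<close> unchanged for every other prime
  \<open>Q\<close>.\<close>

lemma reduce_finite_primes:
  assumes I: "lid I" and v: "v \<in> carrier R" and w: "w \<in> carrier R"
    and "finite \<F>" "\<And>P. P \<in> \<F> \<Longrightarrow> prm P \<and> prime_small (Suc k) I w P"
  shows "\<exists>a\<in>carrier R. \<forall>P\<in>\<F>. prime_small k (ladd I (lprin (v \<oplus> a \<otimes> w))) w P"
  using assms(4,5)
proof (induction \<F> rule: finite_psubset_induct)
  case (psubset \<F>)
  show ?case
  proof (cases "\<F> = {}")
    case True
    then show ?thesis by blast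
  next
    case False
    then obtain P where P: "P \<in> \<F>" and P_min: "\<And>Q. Q \<in> \<F> \<Longrightarrow> Q \<subseteq> P \<Longrightarrow> P = Q"
      using finite_has_minimal[OF psubset.hyps(1)] by blast
    define \<G> where "\<G> = \<F> - {P}"
    have "\<G> \<subset> \<F>" using P by (auto simp: \<G>_def)
    then obtain a where a: "a \<in> carrier R" "\<forall>Q\<in>\<G>. prime_small k (ladd I (lprin (v \<oplus> a \<otimes> w))) w Q"
      using psubset.IH[of \<G>] psubset.prems by blast
    have pP: "prm P" "prime_small (Suc k) I w P" using psubset.prems[OF P] by auto
    have lP: "lid P" using pP prm_lid by blast
    have "tid Q \<and> \<not> Q \<subseteq> P" if "Q \<in> \<G>" for Q
      using that P_min[of Q] psubset.prems[of Q] prm_tid unfolding \<G>_def by blast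
    then obtain J where J: "tid J" "\<not> J \<subseteq> P" "\<forall>Q\<in>\<G>. J \<subseteq> Q"
      using exists_ideal_below[OF pP(1), of \<G>] psubset.hyps(1) by (auto simp: \<G>_def)
    define u where "u = v \<oplus> a \<otimes> w"
    have u: "u \<in> carrier R" using v w a by (simp add: u_def)
    have lIP: "lid (ladd I P)" "P \<subseteq> ladd I P" using I lP by (simp_all add: lid_ladd ladd_upper2)
    obtain a' where a': "a' \<in> J"
      and sm: "small k P (ladd (ladd I P) (lprin (u \<oplus> a' \<otimes> w))) (ladd (ladd (ladd I P) (lprin (u \<oplus> a' \<otimes> w))) (lprin w))"
      using reduce_prime[OF pP(1) J(1,2) lIP u w] pP(2) unfolding prime_small_def by blast
    have a'c: "a' \<in> carrier R" using a' J tid_lid lid_closed by blast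
    define u' where "u' = v \<oplus> (a \<oplus> a') \<otimes> w"
    have u': "u' \<in> carrier R" "u' = u \<oplus> a' \<otimes> w"
      using v w a a'c by (simp_all add: u'_def u_def l_distr a_assoc)
    have lu: "lid (lprin u)" "lid (lprin u')" using u u' by (simp_all add: lid_lprin)
    have "ladd (ladd I P) (lprin u') = ladd (ladd I (lprin u')) P"
      using ladd_assoc[OF I lP lu(2)] ladd_assoc[OF I lu(2) lP] ladd_commute[OF lP lu(2)] by simp
    then have "prime_small k (ladd I (lprin u')) w P"
      using sm by (simp add: prime_small_def u'(2))
    moreover have "prime_small k (ladd I (lprin u')) w Q" if Q: "Q \<in> \<G>" for Q
    proof -
      have tQ: "tid Q" "lid Q" using Q psubset.prems[of Q] prm_tid tid_lid by (auto simp: \<G>_def)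
      have q: "a' \<otimes> w \<in> Q" using a' J Q tQ w tid_mult by blast
      have *: "ladd (ladd I (lprin x)) Q \<subseteq> ladd (ladd I (lprin y)) Q"
        if "x \<in> carrier R" "y \<in> carrier R" "q \<in> Q" "x = y \<oplus> q" for x y q
      proof -
        note l = lid_lprin[OF that(1)] lid_lprin[OF that(2)]
        have l': "lid (ladd I (lprin y))" "lid (ladd (ladd I (lprin y)) Q)"
          using I l tQ by (simp_all add: lid_ladd)
        have up: "ladd I (lprin y) \<subseteq> ladd (ladd I (lprin y)) Q" "Q \<subseteq> ladd (ladd I (lprin y)) Q"
          using l' tQ by (simp_all add: ladd_upper1 ladd_upper2)
        have "y \<in> ladd (ladd I (lprin y)) Q"
          using up ladd_upper2[OF I l(2)] lprin_self[OF that(2)] by blast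
        then have "x \<in> ladd (ladd I (lprin y)) Q"
          using that up lid_add[OF l'(2)] by blast
        then have "lprin x \<subseteq> ladd (ladd I (lprin y)) Q" by (rule lprin_least[OF l'(2)])
        then show ?thesis
          using up ladd_upper1[OF I l(2)] l'(2) by (intro ladd_least) (auto intro: subset_trans)
      qed
      have "u = u' \<oplus> \<ominus> (a' \<otimes> w)"
        using u a'c w by (simp add: u'(2) a_assoc r_neg)
      moreover have "\<ominus> (a' \<otimes> w) \<in> Q"
        using lid_minus[OF tQ(2) lid_zero[OF tQ(2)] q] a'c w by (simp add: minus_eq)
      ultimately have "ladd (ladd I (lprin u')) Q = ladd (ladd I (lprin u)) Q"
        using *[OF u'(1) u q u'(2)] *[OF u u'(1)] by blast
      then show ?thesis using a(2) Q by (simp add: prime_small_def u_def)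
    qed
    ultimately have "\<forall>Q\<in>\<F>. prime_small k (ladd I (lprin (v \<oplus> (a \<oplus> a') \<otimes> w))) w Q"
      by (auto simp: \<G>_def u'_def)
    then show ?thesis using a(1) a'c by (intro bexI[of _ "a \<oplus> a'"]) simp_all
  qed
qed

text \<open>Only the finitely many primes that are not yet small at level \<open>k\<close> have to
  be treated. At the others smallness survives the enlargement of \<open>I\<close>, by
  \<open>small_add\<close>.\<close>

lemma reduce_primes:
  assumes I: "lid I" and v: "v \<in> carrier R" and w: "w \<in> carrier R"
    and sm: "\<And>P. prm P \<Longrightarrow> prime_small (Suc k) I w P"
  shows "\<exists>a\<in>carrier R. \<forall>P. prm P \<longrightarrow> prime_small k (ladd I (lprin (v \<oplus> a \<otimes> w))) w P"
proof -
  obtain a where a: "a \<in> carrier R"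
    "\<And>P. prm P \<Longrightarrow> \<not> prime_small k I w P \<Longrightarrow> prime_small k (ladd I (lprin (v \<oplus> a \<otimes> w))) w P"
    using reduce_finite_primes[OF I v w finite_large_primes_above[OF I w sm]] sm by blast
  have "prime_small k (ladd I (lprin (v \<oplus> a \<otimes> w))) w P" if P: "prm P" "prime_small k I w P" for P
  proof -
    let ?U = "lprin (v \<oplus> a \<otimes> w)"
    have l: "lid ?U" "lid P" "lid (lprin w)" "lid (ladd I P)"
      using a v w I P prm_lid by (simp_all add: lid_lprin lid_ladd)
    have "ladd (ladd I P) ?U = ladd (ladd I ?U) P"
      using ladd_assoc[OF I l(2,1)] ladd_assoc[OF I l(1,2)] ladd_commute[OF l(1,2)] by simp
    moreover have "ladd (ladd (ladd I P) (lprin w)) ?U = ladd (ladd (ladd I P) ?U) (lprin w)"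
      using ladd_assoc[OF l(4,3,1)] ladd_assoc[OF l(4,1,3)] ladd_commute[OF l(1,3)] by simp
    ultimately show ?thesis
      using small_add[OF P(2)[unfolded prime_small_def] l(1)] by (simp add: prime_small_def)
  qed
  with a(2) have "\<forall>P. prm P \<longrightarrow> prime_small k (ladd I (lprin (v \<oplus> a \<otimes> w))) w P" by meson
  with a(1) show ?thesis by (rule bexI[rotated])
qed

text \<open>The annihilator \<open>P\<close> of the simple module \<open>R / M\<close> is prime and
  lies in \<open>M\<close>. If \<open>w\<close> were outside \<open>M\<close>, smallness at
  \<open>P\<close> would pass to \<open>R / M\<close>. A proper interval does not have deviation
  less than 0, so by simplicity an ideal not inside \<open>P\<close> would annihilate
  \<open>R / M\<close>, contrary to the definition of \<open>P\<close>.\<close>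

lemma maximal_lid_contains:
  assumes I: "lid I" and w: "w \<in> carrier R" and sm: "\<And>P. prm P \<Longrightarrow> prime_small 0 I w P"
    and M: "lid M" "M \<noteq> carrier R" "\<And>N. lid N \<Longrightarrow> M \<subset> N \<Longrightarrow> N = carrier R" "I \<subseteq> M"
  shows "w \<in> M"
proof (rule ccontr)
  assume wM: "w \<notin> M"
  define P where "P = {a \<in> carrier R. \<forall>x\<in>carrier R. a \<otimes> x \<in> M}"
  have "lid P"
    using M(1) by (intro lidI) (auto simp: P_def l_distr m_assoc lid_zero intro: lid_add lid_mult)
  then have tP: "tid P" by (auto simp: tid_def P_def m_assoc)
  have PM: "P \<subseteq> M"
  proof
    fix a assume "a \<in> P"
    then have "a \<in> carrier R" "a \<otimes> \<one> \<in> M" unfolding P_def by blast+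
    then show "a \<in> M" by simp
  qed
  have one: "\<one> \<notin> M" using M lid_eq_carrier by blast
  have "prm P"
    unfolding prm_def
  proof (intro conjI ballI impI tP)
    show "P \<noteq> carrier R" using one PM by blast
  next
    fix a b assume ab: "a \<in> carrier R" "b \<in> carrier R" "\<forall>x\<in>carrier R. a \<otimes> x \<otimes> b \<in> P"
    have "a \<in> P" if nb: "b \<notin> P"
    proof -
      obtain y where y: "y \<in> carrier R" "b \<otimes> y \<notin> M" using nb ab(2) unfolding P_def by blast
      have lby: "lid (lprin (b \<otimes> y))" using ab y by (simp add: lid_lprin)
      have "M \<subset> ladd M (lprin (b \<otimes> y))"
        using ladd_upper1[OF M(1) lby] ladd_upper2[OF M(1) lby] lprin_self[of "b \<otimes> y"] ab y by auto
      then have top: "ladd M (lprin (b \<otimes> y)) = carrier R"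
        using M(3) lid_ladd[OF M(1) lby] by blast
      have "a \<otimes> x \<in> M" if x: "x \<in> carrier R" for x
      proof -
        have "x \<in> ladd M (lprin (b \<otimes> y))" using x top by simp
        then obtain m c where *: "m \<in> M" "c \<in> carrier R" "x = m \<oplus> c \<otimes> (b \<otimes> y)"
          by (auto simp: ladd_def lmul_def)
        have mc: "m \<in> carrier R" using * M(1) lid_closed by blast
        have "a \<otimes> x = a \<otimes> m \<oplus> (a \<otimes> c \<otimes> b) \<otimes> y"
          using * mc ab y by (simp add: r_distr m_assoc)
        moreover have "(a \<otimes> c \<otimes> b) \<otimes> y \<in> M" using ab(3) *(2) y(1) by (auto simp: P_def)
        ultimately show ?thesis using M(1) * ab by (simp add: lid_add lid_mult)
      qed
      then show "a \<in> P" using ab by (simp add: P_def)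
    qed
    then show "a \<in> P \<or> b \<in> P" by blast
  qed
  then have "small 0 P (ladd I P) (ladd (ladd I P) (lprin w))"
    using sm by (simp add: prime_small_def)
  then have "small 0 P (ladd (ladd I P) M) (ladd (ladd (ladd I P) (lprin w)) M)"
    by (rule small_add[OF _ M(1)])
  moreover have lw: "lid (lprin w)" using w by (rule lid_lprin)
  then have "ladd (ladd I P) M = M"
    using M I \<open>lid P\<close> PM by (simp add: ladd_absorb1 lid_ladd ladd_least)
  moreover have "ladd (ladd (ladd I P) (lprin w)) M = carrier R"
  proof (rule M(3))
    show l: "lid (ladd (ladd (ladd I P) (lprin w)) M)"
      using I \<open>lid P\<close> lw M by (simp add: lid_ladd)
    have "w \<in> ladd (ladd I P) (lprin w)"
      using ladd_upper2[OF lid_ladd[OF I \<open>lid P\<close>] lw] lprin_self[OF w] by blast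
    then show "M \<subset> ladd (ladd (ladd I P) (lprin w)) M"
      using wM ladd_upper1[OF lid_ladd[OF lid_ladd[OF I \<open>lid P\<close>] lw] M(1)]
        ladd_upper2[OF lid_ladd[OF lid_ladd[OF I \<open>lid P\<close>] lw] M(1)] by blast
  qed
  ultimately have "small 0 P M (carrier R)" by simp
  from small_proper[OF this M(2)] obtain N where N: "lid N" "M \<subset> N"
    and alt: "dev_less 0 (between M N) \<or> (\<exists>J. tid J \<and> \<not> J \<subseteq> P \<and> (\<forall>a\<in>J. \<forall>y\<in>N. a \<otimes> y \<in> M))"
    by blast
  have "\<not> dev_less 0 (between M N)"
    using N M(1) by (auto simp: between_def)
  then obtain J where J: "tid J" "\<not> J \<subseteq> P" "\<forall>a\<in>J. \<forall>y\<in>N. a \<otimes> y \<in> M" using alt by blast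
  have "N = carrier R" using M(3) N by blast
  then have "J \<subseteq> P" using J(3) lid_closed[OF tid_lid[OF J(1)]] by (auto simp: P_def)
  then show False using J(2) by simp
qed

lemma lid_finsum: "finite F \<Longrightarrow> lid I \<Longrightarrow> f \<in> F \<rightarrow> I \<Longrightarrow> (\<Oplus>i\<in>F. f i) \<in> I"
proof (induction F rule: finite_induct)
  case (insert i F)
  have "f \<in> F \<rightarrow> carrier R" "f i \<in> carrier R" using insert lid_closed by blast+
  then show ?case using insert by (simp add: lid_add)
qed (simp add: lid_zero)

lemma unimodular_stable:
  assumes dev: "dev_less d (Collect lid)" and uni: "unimodular_column R (d + 1) v"
  shows "stable_column R (d + 1) v"
proof -
  define w where "w = v (d + 1)"
  have vc: "v i \<in> carrier R" if "i \<in> {1..d + 1}" for i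
    using uni that unfolding unimodular_column_def by blast
  have w: "w \<in> carrier R" using vc by (simp add: w_def)
  \<comment> \<open>After \<open>j\<close> steps \<open>I\<close> is the left ideal generated by the
    first \<open>j\<close> modified entries, and the level has dropped from \<open>d\<close> to
    \<open>d - j\<close>. The explicit combinations are kept because for \<open>j = d\<close> they
    yield the left inverse of the shortened column.\<close>
  have "\<exists>a I. a \<in> {1..j} \<rightarrow> carrier R \<and> lid I \<and> (\<forall>P. prm P \<longrightarrow> prime_small (d - j) I w P) \<and>
    (\<forall>i\<in>{1..j}. v i \<oplus> a i \<otimes> w \<in> I) \<and>
    (\<forall>x\<in>I. \<exists>b\<in>{1..j} \<rightarrow> carrier R. x = (\<Oplus>i\<in>{1..j}. b i \<otimes> (v i \<oplus> a i \<otimes> w)))" if "j \<le> d" for j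
    using that
  proof (induction j)
    case 0
    have "prime_small d {\<zero>} w P" if P: "prm P" for P
      unfolding prime_small_def
    proof (rule small_dev)
      show "dev_less d (between (ladd {\<zero>} P) (ladd (ladd {\<zero>} P) (lprin w)))"
        by (rule dev_less_subset[OF dev]) (auto simp: between_def)
    qed (use P w in \<open>simp_all add: lid_ladd lid_trivial prm_lid lid_lprin ladd_upper1\<close>)
    then show ?case by (intro exI[of _ "\<lambda>_. \<zero>"] exI[of _ "{\<zero>}"]) (auto simp: lid_trivial)
  next
    case (Suc j)
    then obtain a I where a: "a \<in> {1..j} \<rightarrow> carrier R" and I: "lid I"
      and sm: "\<And>P. prm P \<Longrightarrow> prime_small (d - j) I w P"
      and mem: "\<And>i. i \<in> {1..j} \<Longrightarrow> v i \<oplus> a i \<otimes> w \<in> I"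
      and rep: "\<And>x. x \<in> I \<Longrightarrow> \<exists>b\<in>{1..j} \<rightarrow> carrier R. x = (\<Oplus>i\<in>{1..j}. b i \<otimes> (v i \<oplus> a i \<otimes> w))"
      by auto
    have vj: "v (Suc j) \<in> carrier R" using vc Suc.prems by simp
    have "d - j = Suc (d - Suc j)" using Suc.prems by simp
    then obtain \<alpha> where \<alpha>: "\<alpha> \<in> carrier R"
      and sm': "\<And>P. prm P \<Longrightarrow> prime_small (d - Suc j) (ladd I (lprin (v (Suc j) \<oplus> \<alpha> \<otimes> w))) w P"
      using reduce_primes[OF I vj w, of "d - Suc j"] sm by auto
    define u where "u = v (Suc j) \<oplus> \<alpha> \<otimes> w"
    have u: "u \<in> carrier R" using vj \<alpha> w by (simp add: u_def)
    have lu: "lid (lprin u)" using u by (rule lid_lprin)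
    define a' where "a' = a(Suc j := \<alpha>)"
    define I' where "I' = ladd I (lprin u)"
    have I': "lid I'" "I \<subseteq> I'" "u \<in> I'"
      using I lu ladd_upper1[OF I lu] ladd_upper2[OF I lu] lprin_self[OF u] by (auto simp: I'_def lid_ladd)
    have a'c: "a' \<in> {1..Suc j} \<rightarrow> carrier R" using a \<alpha> by (auto simp: a'_def Pi_iff)
    have a'_eq: "a' i = (if i = Suc j then \<alpha> else a i)" for i by (simp add: a'_def)
    have "v i \<oplus> a' i \<otimes> w \<in> I'" if "i \<in> {1..Suc j}" for i
      using that mem[of i] I' by (auto simp: a'_eq u_def[symmetric])
    moreover have "\<exists>b\<in>{1..Suc j} \<rightarrow> carrier R. x = (\<Oplus>i\<in>{1..Suc j}. b i \<otimes> (v i \<oplus> a' i \<otimes> w))" if x: "x \<in> I'" for x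
    proof -
      obtain y c where *: "y \<in> I" "c \<in> carrier R" "x = y \<oplus> c \<otimes> u"
        using x by (auto simp: I'_def ladd_def lmul_def)
      obtain b where b: "b \<in> {1..j} \<rightarrow> carrier R" "y = (\<Oplus>i\<in>{1..j}. b i \<otimes> (v i \<oplus> a i \<otimes> w))"
        using rep[OF *(1)] by blast
      define b' where "b' = b(Suc j := c)"
      have in_carrier: "(\<lambda>i. b i \<otimes> (v i \<oplus> a i \<otimes> w)) \<in> {1..j} \<rightarrow> carrier R"
        using b(1) a vc w Suc.prems by (auto simp: Pi_iff)
      have "(\<Oplus>i\<in>{1..Suc j}. b' i \<otimes> (v i \<oplus> a' i \<otimes> w)) =
        (\<Oplus>i\<in>insert (Suc j) {1..j}. b' i \<otimes> (v i \<oplus> a' i \<otimes> w))"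
        by (simp add: atLeastAtMostSuc_conv)
      also have "\<dots> = b' (Suc j) \<otimes> (v (Suc j) \<oplus> a' (Suc j) \<otimes> w) \<oplus> (\<Oplus>i\<in>{1..j}. b' i \<otimes> (v i \<oplus> a' i \<otimes> w))"
        using in_carrier * u by (intro finsum_insert) (auto simp: b'_def a'_eq u_def[symmetric] Pi_iff)
      also have "(\<Oplus>i\<in>{1..j}. b' i \<otimes> (v i \<oplus> a' i \<otimes> w)) = y"
        unfolding b(2) by (rule finsum_cong') (use in_carrier in \<open>auto simp: b'_def a'_eq\<close>)
      also have "b' (Suc j) \<otimes> (v (Suc j) \<oplus> a' (Suc j) \<otimes> w) \<oplus> y = x"
        using * u lid_closed[OF I] by (simp add: b'_def a'_eq u_def[symmetric] a_comm)
      finally have "x = (\<Oplus>i\<in>{1..Suc j}. b' i \<otimes> (v i \<oplus> a' i \<otimes> w))" by simp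
      moreover have "b' \<in> {1..Suc j} \<rightarrow> carrier R" using b(1) * by (auto simp: b'_def Pi_iff)
      ultimately show ?thesis by blast
    qed
    ultimately show ?case
      using a'c I'(1) sm' unfolding I'_def u_def by blast
  qed
  from this[of d] obtain a I where a: "a \<in> {1..d} \<rightarrow> carrier R" and I: "lid I"
    and sm: "\<And>P. prm P \<Longrightarrow> prime_small 0 I w P"
    and mem: "\<And>i. i \<in> {1..d} \<Longrightarrow> v i \<oplus> a i \<otimes> w \<in> I"
    and rep: "\<And>x. x \<in> I \<Longrightarrow> \<exists>b\<in>{1..d} \<rightarrow> carrier R. x = (\<Oplus>i\<in>{1..d}. b i \<otimes> (v i \<oplus> a i \<otimes> w))"
    by auto
  \<comment> \<open>Otherwise a maximal left ideal above \<open>I\<close> contains \<open>w\<close>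
    by \<open>maximal_lid_contains\<close>, hence every original entry \<open>v i\<close>, against
    unimodularity.\<close>
  have "\<one> \<in> I"
  proof (rule ccontr)
    assume "\<one> \<notin> I"
    then have "lid I \<and> I \<subseteq> I \<and> \<one> \<notin> I" using I by blast
    then obtain M where M: "lid M \<and> I \<subseteq> M \<and> \<one> \<notin> M"
      and M_max: "\<And>N. lid N \<and> I \<subseteq> N \<and> \<one> \<notin> N \<Longrightarrow> M \<subseteq> N \<Longrightarrow> N = M"
      by (rule lid_maximal[where Q = "\<lambda>M. lid M \<and> I \<subseteq> M \<and> \<one> \<notin> M"]) blast+
    have "w \<in> M"
    proof (rule maximal_lid_contains[OF I w sm])
      show "M \<noteq> carrier R" using M by auto
      show "N = carrier R" if "lid N" "M \<subset> N" for N
        using M_max[of N] M that lid_eq_carrier by blast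
    qed (use M in auto)
    have "v i \<in> M" if i: "i \<in> {1..d + 1}" for i
    proof (cases "i = d + 1")
      case False
      then have i': "i \<in> {1..d}" using i by auto
      have "a i \<otimes> w \<in> M" using M \<open>w \<in> M\<close> a i' lid_mult by blast
      then show ?thesis
        using M mem[OF i'] vc[OF i] by (intro lid_diff_cancel[of M "v i" "a i \<otimes> w"]) auto
    qed (use \<open>w \<in> M\<close> in \<open>simp add: w_def\<close>)
    moreover obtain b where b: "b \<in> {1..d + 1} \<rightarrow> carrier R" "(\<Oplus>i\<in>{1..d + 1}. b i \<otimes> v i) = \<one>"
      using uni unfolding unimodular_column_def by blast
    ultimately have "(\<Oplus>i\<in>{1..d + 1}. b i \<otimes> v i) \<in> M"
      using M by (intro lid_finsum) (auto intro: lid_mult)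
    then show False using b M by simp
  qed
  from rep[OF this] obtain b where b: "b \<in> {1..d} \<rightarrow> carrier R"
    "\<one> = (\<Oplus>i\<in>{1..d}. b i \<otimes> (v i \<oplus> a i \<otimes> w))" by blast
  have "unimodular_column R d (\<lambda>i. v i \<oplus> a i \<otimes> w)"
    unfolding unimodular_column_def
  proof
    show "(\<lambda>i. v i \<oplus> a i \<otimes> w) \<in> {1..d} \<rightarrow> carrier R"
      using a vc w by (simp add: Pi_iff)
    show "\<exists>b\<in>{1..d} \<rightarrow> carrier R. (\<Oplus>i\<in>{1..d}. b i \<otimes> (v i \<oplus> a i \<otimes> w)) = \<one>"
      using b(1) b(2)[symmetric] by blast
  qed
  then show ?thesis
    unfolding stable_column_def using a by (auto simp: w_def)
qed

end

section \<open>Cancellation of free summands\<close>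

lemma left_module_homD:
  assumes "f \<in> left_module_hom S M N"
  shows "u \<in> carrier M \<Longrightarrow> f u \<in> carrier N"
    and "u \<in> carrier M \<Longrightarrow> v \<in> carrier M \<Longrightarrow> f (u \<oplus>\<^bsub>M\<^esub> v) = f u \<oplus>\<^bsub>N\<^esub> f v"
    and "a \<in> carrier S \<Longrightarrow> u \<in> carrier M \<Longrightarrow> f (a \<odot>\<^bsub>M\<^esub> u) = a \<odot>\<^bsub>N\<^esub> f u"
  using assms by (auto simp: left_module_hom_def)

lemma left_module_homI:
  assumes "\<And>u. u \<in> carrier M \<Longrightarrow> f u \<in> carrier N"
    and "\<And>u v. u \<in> carrier M \<Longrightarrow> v \<in> carrier M \<Longrightarrow> f (u \<oplus>\<^bsub>M\<^esub> v) = f u \<oplus>\<^bsub>N\<^esub> f v"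
    and "\<And>a u. a \<in> carrier S \<Longrightarrow> u \<in> carrier M \<Longrightarrow> f (a \<odot>\<^bsub>M\<^esub> u) = a \<odot>\<^bsub>N\<^esub> f u"
  shows "f \<in> left_module_hom S M N"
  using assms by (auto simp: left_module_hom_def)

lemma left_module_hom_comp:
  "f \<in> left_module_hom S M N \<Longrightarrow> g \<in> left_module_hom S N N' \<Longrightarrow> (\<lambda>u. g (f u)) \<in> left_module_hom S M N'"
  by (rule left_module_homI) (simp_all add: left_module_homD)

lemma free_power_simps:
  "carrier (free_power S r) = {1..r} \<rightarrow>\<^sub>E carrier S"
  "\<zero>\<^bsub>free_power S r\<^esub> = (\<lambda>i\<in>{1..r}. \<zero>\<^bsub>S\<^esub>)"
  "u \<oplus>\<^bsub>free_power S r\<^esub> v = (\<lambda>i\<in>{1..r}. u i \<oplus>\<^bsub>S\<^esub> v i)"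
  "a \<odot>\<^bsub>free_power S r\<^esub> u = (\<lambda>i\<in>{1..r}. a \<otimes>\<^bsub>S\<^esub> u i)"
  by (simp_all add: free_power_def)

lemma self_module_simps:
  "carrier (self_module S) = carrier S" "\<zero>\<^bsub>self_module S\<^esub> = \<zero>\<^bsub>S\<^esub>"
  "u \<oplus>\<^bsub>self_module S\<^esub> v = u \<oplus>\<^bsub>S\<^esub> v" "a \<odot>\<^bsub>self_module S\<^esub> u = a \<otimes>\<^bsub>S\<^esub> u"
  by (simp_all add: self_module_def)

lemma direct_sum_simps:
  "carrier (direct_sum M N) = carrier M \<times> carrier N"
  "p \<oplus>\<^bsub>direct_sum M N\<^esub> q = (fst p \<oplus>\<^bsub>M\<^esub> fst q, snd p \<oplus>\<^bsub>N\<^esub> snd q)"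
  "a \<odot>\<^bsub>direct_sum M N\<^esub> p = (a \<odot>\<^bsub>M\<^esub> fst p, a \<odot>\<^bsub>N\<^esub> snd p)"
  by (simp_all add: direct_sum_def split_beta)

lemma finsum_self_module: "finsum (self_module S) f A = finsum S f A"
  by (simp add: finsum_def finprod_def self_module_def)

context left_module
begin

lemma smult_l_null:
  assumes "u \<in> carrier M"
  shows "\<zero> \<odot>\<^bsub>M\<^esub> u = \<zero>\<^bsub>M\<^esub>"
proof -
  have "\<zero> \<odot>\<^bsub>M\<^esub> u \<oplus>\<^bsub>M\<^esub> \<zero> \<odot>\<^bsub>M\<^esub> u = \<zero> \<odot>\<^bsub>M\<^esub> u"
    using smult_l_distr[of \<zero> \<zero> u] assms by simp
  then show ?thesis
    using M.add.l_cancel_one[of "\<zero> \<odot>\<^bsub>M\<^esub> u" "\<zero> \<odot>\<^bsub>M\<^esub> u"] smult_closed[of \<zero> u] assms by simp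
qed

lemma smult_neg_cancel:
  assumes "a \<in> carrier S" "u \<in> carrier M" "y \<in> carrier M"
  shows "(y \<oplus>\<^bsub>M\<^esub> a \<odot>\<^bsub>M\<^esub> u) \<oplus>\<^bsub>M\<^esub> (\<ominus> a) \<odot>\<^bsub>M\<^esub> u = y"
    "(y \<oplus>\<^bsub>M\<^esub> (\<ominus> a) \<odot>\<^bsub>M\<^esub> u) \<oplus>\<^bsub>M\<^esub> a \<odot>\<^bsub>M\<^esub> u = y"
proof -
  have "a \<odot>\<^bsub>M\<^esub> u \<oplus>\<^bsub>M\<^esub> (\<ominus> a) \<odot>\<^bsub>M\<^esub> u = \<zero>\<^bsub>M\<^esub>" "(\<ominus> a) \<odot>\<^bsub>M\<^esub> u \<oplus>\<^bsub>M\<^esub> a \<odot>\<^bsub>M\<^esub> u = \<zero>\<^bsub>M\<^esub>"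
    using smult_l_distr[of a "\<ominus> a" u] smult_l_distr[of "\<ominus> a" a u] smult_l_null assms
    by (simp_all add: S.r_neg S.l_neg)
  then show "(y \<oplus>\<^bsub>M\<^esub> a \<odot>\<^bsub>M\<^esub> u) \<oplus>\<^bsub>M\<^esub> (\<ominus> a) \<odot>\<^bsub>M\<^esub> u = y"
    "(y \<oplus>\<^bsub>M\<^esub> (\<ominus> a) \<odot>\<^bsub>M\<^esub> u) \<oplus>\<^bsub>M\<^esub> a \<odot>\<^bsub>M\<^esub> u = y"
    using assms by (simp_all add: M.a_assoc smult_closed)
qed

end

context ring
begin

lemma left_module_free_power: "left_module R (free_power R r)"
proof -
  have "abelian_group (free_power R r)"
  proof (rule abelian_groupI, unfold free_power_simps)
    fix u assume u: "u \<in> {1..r} \<rightarrow>\<^sub>E carrier R"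
    show "\<exists>y\<in>{1..r} \<rightarrow>\<^sub>E carrier R. (\<lambda>i\<in>{1..r}. y i \<oplus> u i) = (\<lambda>i\<in>{1..r}. \<zero>)"
      using u by (intro bexI[of _ "\<lambda>i\<in>{1..r}. \<ominus> u i"]) (auto simp: l_neg PiE_iff)
    show "(\<lambda>i\<in>{1..r}. (\<lambda>i\<in>{1..r}. \<zero>) i \<oplus> u i) = u"
      using u by (auto simp: PiE_iff extensional_def)
  qed (auto simp: PiE_iff a_ac intro!: restrict_ext)
  then show ?thesis
    by (intro left_module.intro left_module_axioms.intro ring_axioms, unfold free_power_simps)
       (auto simp: PiE_iff l_distr r_distr m_assoc extensional_def intro!: restrict_ext)
qed

lemma left_module_self: "left_module R (self_module R)"
proof -
  have "abelian_group (self_module R)"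
    by (rule abelian_groupI, unfold self_module_simps) (auto simp: a_ac intro: l_neg)
  then show ?thesis
    by (intro left_module.intro left_module_axioms.intro ring_axioms, unfold self_module_simps)
       (auto simp: l_distr r_distr m_assoc)
qed

definition unit_vec :: "nat \<Rightarrow> nat \<Rightarrow> nat \<Rightarrow> 'a"
  where "unit_vec r i = (\<lambda>j\<in>{1..r}. if i = j then \<one> else \<zero>)"

lemma unit_vec_closed: "unit_vec r i \<in> carrier (free_power R r)"
  by (auto simp: unit_vec_def free_power_simps)

lemma hom_free_power_expand:
  assumes N: "left_module R N" and f: "f \<in> left_module_hom R (free_power R r) N"
    and u: "u \<in> carrier (free_power R r)"
  shows "f u = (\<Oplus>\<^bsub>N\<^esub>i\<in>{1..r}. u i \<odot>\<^bsub>N\<^esub> f (unit_vec r i))"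
proof -
  interpret N: left_module R N by (rule N)
  interpret F: left_module R "free_power R r" by (rule left_module_free_power)
  have uc: "u i \<in> carrier R" if "i \<in> {1..r}" for i using u that by (auto simp: free_power_simps)
  define t where "t k = (\<lambda>j\<in>{1..r}. if j \<le> k then u j else \<zero>)" for k
  have tc: "t k \<in> carrier (free_power R r)" for k
    using uc by (auto simp: t_def free_power_simps)
  have summand: "u i \<odot>\<^bsub>N\<^esub> f (unit_vec r i) \<in> carrier N" if "i \<in> {1..r}" for i
    using uc[OF that] left_module_homD(1)[OF f unit_vec_closed] by (simp add: N.smult_closed)
  have "f (t k) = (\<Oplus>\<^bsub>N\<^esub>i\<in>{1..k}. u i \<odot>\<^bsub>N\<^esub> f (unit_vec r i))" if "k \<le> r" for k
    using that
  proof (induction k)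
    case 0
    have "t 0 = \<zero> \<odot>\<^bsub>free_power R r\<^esub> t 0"
      using tc[of 0] by (auto simp: free_power_simps t_def)
    then have "f (t 0) = \<zero> \<odot>\<^bsub>N\<^esub> f (t 0)"
      using left_module_homD(3)[OF f zero_closed tc] by metis
    also have "\<dots> = \<zero>\<^bsub>N\<^esub>"
      using left_module_homD(1)[OF f tc] by (rule N.smult_l_null)
    finally show ?case by simp
  next
    case (Suc k)
    have k: "Suc k \<in> {1..r}" using Suc.prems by simp
    have "t (Suc k) = u (Suc k) \<odot>\<^bsub>free_power R r\<^esub> unit_vec r (Suc k) \<oplus>\<^bsub>free_power R r\<^esub> t k"
      using uc uc[OF k] by (auto simp: t_def unit_vec_def free_power_simps le_Suc_eq intro!: restrict_ext)
    then have "f (t (Suc k)) = u (Suc k) \<odot>\<^bsub>N\<^esub> f (unit_vec r (Suc k)) \<oplus>\<^bsub>N\<^esub> f (t k)"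
      using left_module_homD(2,3)[OF f] uc[OF k] tc unit_vec_closed
      by (simp add: F.smult_closed)
    also have "\<dots> = (\<Oplus>\<^bsub>N\<^esub>i\<in>insert (Suc k) {1..k}. u i \<odot>\<^bsub>N\<^esub> f (unit_vec r i))"
      using Suc summand by (subst N.finsum_insert) auto
    also have "insert (Suc k) {1..k} = {1..Suc k}" by auto
    finally show ?case .
  qed
  moreover have "t r = u"
    using u by (auto simp: t_def free_power_simps PiE_iff extensional_def)
  ultimately show ?thesis by auto
qed

lemma functional_expand:
  assumes "f \<in> left_module_hom R (free_power R r) (self_module R)" "u \<in> carrier (free_power R r)"
  shows "f u = (\<Oplus>i\<in>{1..r}. u i \<otimes> f (unit_vec r i))"
  using hom_free_power_expand[OF left_module_self assms]
  by (simp add: finsum_self_module self_module_simps)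

lemma functional_add:
  assumes "f \<in> left_module_hom R F (self_module R)" "g \<in> left_module_hom R F (self_module R)"
  shows "(\<lambda>y. f y \<oplus> g y) \<in> left_module_hom R F (self_module R)"
  using left_module_homD[OF assms(1)] left_module_homD[OF assms(2)]
  by (intro left_module_homI) (simp_all add: self_module_simps a_ac r_distr)

lemma functional_rmult:
  assumes "f \<in> left_module_hom R F (self_module R)" "c \<in> carrier R"
  shows "(\<lambda>y. f y \<otimes> c) \<in> left_module_hom R F (self_module R)"
  using left_module_homD[OF assms(1)] assms(2)
  by (intro left_module_homI) (simp_all add: self_module_simps l_distr m_assoc)

lemma functional_values:
  assumes "a \<in> {1..m} \<rightarrow> carrier R"
  shows "\<exists>\<gamma>\<in>left_module_hom R (free_power R m) (self_module R). \<forall>i\<in>{1..m}. \<gamma> (unit_vec m i) = a i"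
proof -
  define \<gamma> where "\<gamma> y = (\<Oplus>i\<in>{1..m}. y i \<otimes> a i)" for y
  have "\<gamma> \<in> left_module_hom R (free_power R m) (self_module R)"
  proof (rule left_module_homI, unfold free_power_simps self_module_simps)
    fix y y' c assume y: "y \<in> {1..m} \<rightarrow>\<^sub>E carrier R"
    then have ya: "(\<lambda>i. y i \<otimes> a i) \<in> {1..m} \<rightarrow> carrier R" using assms by (auto simp: PiE_iff Pi_iff)
    then show "\<gamma> y \<in> carrier R" by (simp add: \<gamma>_def finsum_closed)
    show "\<gamma> (\<lambda>i\<in>{1..m}. y i \<oplus> y' i) = \<gamma> y \<oplus> \<gamma> y'" if y': "y' \<in> {1..m} \<rightarrow>\<^sub>E carrier R"
    proof -
      have ya': "(\<lambda>i. y' i \<otimes> a i) \<in> {1..m} \<rightarrow> carrier R" using y' assms by (auto simp: PiE_iff Pi_iff)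
      have "\<gamma> (\<lambda>i\<in>{1..m}. y i \<oplus> y' i) = (\<Oplus>i\<in>{1..m}. y i \<otimes> a i \<oplus> y' i \<otimes> a i)"
        unfolding \<gamma>_def
        by (rule finsum_cong') (use y y' assms ya ya' in \<open>auto simp: PiE_iff Pi_iff l_distr\<close>)
      then show ?thesis using ya ya' by (simp add: \<gamma>_def finsum_addf)
    qed
    show "\<gamma> (\<lambda>i\<in>{1..m}. c \<otimes> y i) = c \<otimes> \<gamma> y" if c: "c \<in> carrier R"
    proof -
      have "\<gamma> (\<lambda>i\<in>{1..m}. c \<otimes> y i) = (\<Oplus>i\<in>{1..m}. c \<otimes> (y i \<otimes> a i))"
        unfolding \<gamma>_def
        by (rule finsum_cong') (use y c assms ya in \<open>auto simp: PiE_iff Pi_iff m_assoc\<close>)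
      then show ?thesis using ya c by (simp add: \<gamma>_def finsum_rdistr)
    qed
  qed
  moreover have "\<gamma> (unit_vec m i) = a i" if i: "i \<in> {1..m}" for i
  proof -
    have "\<gamma> (unit_vec m i) = (\<Oplus>j\<in>{1..m}. if i = j then a j else \<zero>)"
      unfolding \<gamma>_def by (rule finsum_cong') (use assms in \<open>auto simp: unit_vec_def Pi_iff\<close>)
    then show ?thesis using finsum_singleton[OF i _ assms] by simp
  qed
  ultimately show ?thesis by blast
qed

text \<open>For functionals \<open>\<alpha>, \<gamma>\<close> such that \<open>\<alpha> + \<gamma> \<beta>\<close> takes the value 1, elementary automorphisms of
  \<open>F \<oplus> R\<close> transform the functional \<open>(y, z) \<mapsto> \<alpha> y + z \<beta>\<close> into the second projection. The maps \<open>g\<close> and \<open>h\<close>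
  are the components of their restriction to the graph of \<open>-(\<alpha> + \<gamma> \<beta>)\<close>.\<close>

lemma kernel_parametrization:
  assumes F: "left_module R F"
    and \<alpha>: "\<alpha> \<in> left_module_hom R F (self_module R)" and \<gamma>: "\<gamma> \<in> left_module_hom R F (self_module R)"
    and \<beta>: "\<beta> \<in> carrier R" and b: "b \<in> carrier F" and one: "\<alpha> b \<oplus> \<gamma> b \<otimes> \<beta> = \<one>"
  shows "\<exists>g\<in>left_module_hom R F F. \<exists>h\<in>left_module_hom R F (self_module R).
    bij_betw (\<lambda>y. (g y, h y)) (carrier F) {(y, z). y \<in> carrier F \<and> z \<in> carrier R \<and> \<alpha> y \<oplus> z \<otimes> \<beta> = \<zero>}"
proof -
  interpret F: left_module R F by (rule F)
  define \<alpha>' where "\<alpha>' y = \<alpha> y \<oplus> \<gamma> y \<otimes> \<beta>" for y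
  have \<alpha>': "\<alpha>' \<in> left_module_hom R F (self_module R)"
    unfolding \<alpha>'_def by (intro functional_add functional_rmult \<alpha> \<gamma> \<beta>)
  \<comment> \<open>As \<open>\<alpha>' b = 1\<close>, adding \<open>\<kappa> y\<close> times
    \<open>b\<close> to \<open>y\<close> turns the value \<open>\<alpha>' y\<close> into
    \<open>\<alpha>' y \<beta>\<close>. This is what makes \<open>(g y, h y)\<close> a zero of the
    functional.\<close>
  define \<kappa> where "\<kappa> y = \<alpha>' y \<otimes> (\<beta> \<ominus> \<one>)" for y
  have \<kappa>: "\<kappa> \<in> left_module_hom R F (self_module R)"
    unfolding \<kappa>_def by (intro functional_rmult \<alpha>') (use \<beta> in simp)
  define g where "g y = y \<oplus>\<^bsub>F\<^esub> \<kappa> y \<odot>\<^bsub>F\<^esub> b" for y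
  define h where "h y = \<gamma> (g y) \<oplus> \<alpha>' y \<otimes> (\<ominus> \<one>)" for y
  note homs = left_module_homD[OF \<alpha>, unfolded self_module_simps]
    left_module_homD[OF \<gamma>, unfolded self_module_simps]
    left_module_homD[OF \<alpha>', unfolded self_module_simps]
    left_module_homD[OF \<kappa>, unfolded self_module_simps]
  have g: "g \<in> left_module_hom R F F"
    using homs b unfolding g_def
    by (intro left_module_homI)
       (simp_all add: F.smult_closed F.smult_l_distr F.smult_r_distr F.smult_assoc F.M.a_ac)
  have h: "h \<in> left_module_hom R F (self_module R)"
    unfolding h_def by (intro functional_add functional_rmult left_module_hom_comp[OF g \<gamma>] \<alpha>') simp
  have gc: "g y \<in> carrier F" if "y \<in> carrier F" for y
    by (rule left_module_homD(1)[OF g that])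
  have \<alpha>'b: "\<alpha>' b = \<one>" using one by (simp add: \<alpha>'_def)
  let ?K = "{(y, z). y \<in> carrier F \<and> z \<in> carrier R \<and> \<alpha> y \<oplus> z \<otimes> \<beta> = \<zero>}"
  \<comment> \<open>For a pair \<open>(g y, h y)\<close> the difference
    \<open>\<gamma> (g y) - h y\<close> is \<open>\<alpha>' y\<close>, so the multiple of
    \<open>b\<close> that was added can be read off and removed.\<close>
  define preim where "preim = (\<lambda>(y, z). y \<oplus>\<^bsub>F\<^esub> (\<ominus> ((\<gamma> y \<ominus> z) \<otimes> (\<beta> \<ominus> \<one>))) \<odot>\<^bsub>F\<^esub> b)"
  have "bij_betw (\<lambda>y. (g y, h y)) (carrier F) ?K"
  proof (rule bij_betw_byWitness[where f' = preim])
    show "\<forall>y\<in>carrier F. preim (g y, h y) = y"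
    proof
      fix y assume y: "y \<in> carrier F"
      have "\<gamma> (g y) \<ominus> h y = \<alpha>' y"
        using y gc[OF y] homs by (simp add: h_def minus_eq r_minus minus_add minus_minus a_assoc[symmetric] r_neg)
      then show "preim (g y, h y) = y"
        using y b homs by (simp add: preim_def g_def \<kappa>_def[symmetric] F.smult_neg_cancel)
    qed
    show "(\<lambda>y. (g y, h y)) ` carrier F \<subseteq> ?K"
    proof clarify
      fix y assume y: "y \<in> carrier F"
      have hc: "h y \<in> carrier R" using left_module_homD(1)[OF h y] by (simp add: self_module_simps)
      have "\<alpha>' (g y) = \<alpha>' y \<oplus> \<kappa> y"
        using y b homs by (simp add: g_def F.smult_closed \<alpha>'b)
      also have "\<dots> = \<alpha>' y \<otimes> \<beta>"
        using y homs \<beta> by (simp add: \<kappa>_def minus_eq r_distr r_minus a_comm[of "\<alpha>' y \<otimes> \<beta>"] a_assoc[symmetric] r_neg)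
      finally have *: "\<alpha> (g y) \<oplus> \<gamma> (g y) \<otimes> \<beta> = \<alpha>' y \<otimes> \<beta>" by (simp add: \<alpha>'_def)
      have "\<alpha> (g y) \<oplus> h y \<otimes> \<beta> = (\<alpha> (g y) \<oplus> \<gamma> (g y) \<otimes> \<beta>) \<oplus> \<ominus> (\<alpha>' y \<otimes> \<beta>)"
        using y gc[OF y] homs \<beta> by (simp add: h_def l_distr r_minus l_minus a_assoc)
      also have "\<dots> = \<zero>"
        unfolding * using y homs \<beta> by (simp add: r_neg)
      finally show "g y \<in> carrier F \<and> h y \<in> carrier R \<and> \<alpha> (g y) \<oplus> h y \<otimes> \<beta> = \<zero>"
        using gc[OF y] hc by simp
    qed
    have key: "preim (y, z) \<in> carrier F \<and> g (preim (y, z)) = y \<and> h (preim (y, z)) = z"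
      if yz: "y \<in> carrier F" "z \<in> carrier R" "\<alpha> y \<oplus> z \<otimes> \<beta> = \<zero>" for y z
    proof -
      define z' where "z' = \<gamma> y \<ominus> z"
      have z': "z' \<in> carrier R" using yz homs by (simp add: z'_def)
      have i: "preim (y, z) = y \<oplus>\<^bsub>F\<^esub> (\<ominus> (z' \<otimes> (\<beta> \<ominus> \<one>))) \<odot>\<^bsub>F\<^esub> b"
        by (simp add: preim_def z'_def)
      have ic: "preim (y, z) \<in> carrier F"
        using yz z' b \<beta> by (simp add: i F.smult_closed)
      have "\<alpha> y = \<ominus> (z \<otimes> \<beta>)"
        using minus_equality[OF yz(3)] yz homs \<beta> by simp
      then have "\<alpha>' y = z' \<otimes> \<beta>"
        using yz homs \<beta> by (simp add: \<alpha>'_def z'_def minus_eq l_distr l_minus a_comm)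
      then have "\<alpha>' (preim (y, z)) = z' \<otimes> \<beta> \<oplus> \<ominus> (z' \<otimes> (\<beta> \<ominus> \<one>))"
        using yz z' b \<beta> homs by (simp add: i F.smult_closed \<alpha>'b)
      also have "\<dots> = z'"
        using z' \<beta> by (simp add: minus_eq r_distr r_minus minus_add minus_minus a_assoc[symmetric] r_neg)
      finally have \<alpha>'i: "\<alpha>' (preim (y, z)) = z'" .
      then have gi: "g (preim (y, z)) = y"
        using yz z' b \<beta> by (simp add: g_def \<kappa>_def i F.smult_neg_cancel)
      have "h (preim (y, z)) = \<gamma> y \<oplus> \<ominus> z'"
        using z' by (simp add: h_def gi \<alpha>'i r_minus)
      also have "\<dots> = z"
        using yz homs by (simp add: z'_def minus_eq minus_add minus_minus a_assoc[symmetric] r_neg)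
      finally show ?thesis using ic gi by simp
    qed
    show "\<forall>p\<in>?K. (g (preim p), h (preim p)) = p" "preim ` ?K \<subseteq> carrier F"
      using key by auto
  qed
  then show ?thesis using g h by blast
qed

lemma free_power_extend:
  assumes "y \<in> carrier (free_power R m)" "z \<in> carrier R"
  shows "y(Suc m := z) \<in> carrier (free_power R (Suc m))"
    "y(Suc m := z) = y(Suc m := \<zero>) \<oplus>\<^bsub>free_power R (Suc m)\<^esub> z \<odot>\<^bsub>free_power R (Suc m)\<^esub> unit_vec (Suc m) (Suc m)"
proof -
  show "y(Suc m := z) \<in> carrier (free_power R (Suc m))"
    using assms by (auto simp: free_power_simps PiE_iff extensional_def le_Suc_eq)
  have yc: "y i \<in> carrier R" if "i \<in> {1..m}" for i
    using assms(1) that by (auto simp: free_power_simps)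
  have yu: "y i = undefined" if "i \<notin> {1..m}" for i
    using assms(1) that by (auto simp: free_power_simps PiE_iff extensional_def)
  show "y(Suc m := z) = y(Suc m := \<zero>) \<oplus>\<^bsub>free_power R (Suc m)\<^esub> z \<odot>\<^bsub>free_power R (Suc m)\<^esub> unit_vec (Suc m) (Suc m)"
  proof
    fix i
    consider "i = Suc m" | "i \<in> {1..m}" | "i \<notin> {1..Suc m}" by fastforce
    then show "(y(Suc m := z)) i =
      (y(Suc m := \<zero>) \<oplus>\<^bsub>free_power R (Suc m)\<^esub> z \<odot>\<^bsub>free_power R (Suc m)\<^esub> unit_vec (Suc m) (Suc m)) i"
      by cases (use assms(2) yc yu in \<open>auto simp: free_power_simps unit_vec_def\<close>)
  qed
qed

text \<open>Let \<open>\<pi>\<close> be the composite of \<open>\<phi>\<close> with the coordinate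
  projection to be removed. Its kernel is carried by \<open>\<phi>\<close> to the remaining summand.
  As \<open>\<pi>\<close> takes the value 1, its values on the unit vectors form a unimodular
  column; stability of that column and \<open>kernel_parametrization\<close> identify the kernel
  with a free module of rank \<open>m\<close>.\<close>

lemma cancel_free_summand:
  fixes M :: "('a, 'm, 'x) module_scheme"
  assumes stable: "\<And>v. unimodular_column R (Suc m) v \<Longrightarrow> stable_column R (Suc m) v"
    and M: "left_module R M"
    and \<phi>: "\<phi> \<in> left_module_hom R (free_power R (Suc m)) (direct_sum (free_power R (Suc s)) M)"
    and bij: "bij_betw \<phi> (carrier (free_power R (Suc m))) (carrier (direct_sum (free_power R (Suc s)) M))"
  shows "\<exists>\<phi>'\<in>left_module_hom R (free_power R m) (direct_sum (free_power R s) M).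
    bij_betw \<phi>' (carrier (free_power R m)) (carrier (direct_sum (free_power R s) M))"
proof -
  interpret M: left_module R M by (rule M)
  interpret F: left_module R "free_power R m" by (rule left_module_free_power)
  let ?F = "free_power R m" and ?F' = "free_power R (Suc m)"
  let ?s = "Suc s"
  note \<phi>D = left_module_homD[OF \<phi>, unfolded direct_sum_simps]
  define \<pi> where "\<pi> x = fst (\<phi> x) ?s" for x
  have fst_closed: "fst (\<phi> x) \<in> {1..?s} \<rightarrow>\<^sub>E carrier R" "snd (\<phi> x) \<in> carrier M" if "x \<in> carrier ?F'" for x
    using \<phi>D(1)[OF that] by (auto simp: free_power_simps)
  have \<pi>: "\<pi> \<in> left_module_hom R ?F' (self_module R)"
  proof (rule left_module_homI, unfold self_module_simps)
    fix u v c assume u: "u \<in> carrier ?F'"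
    show "\<pi> u \<in> carrier R" using fst_closed(1)[OF u] by (auto simp: \<pi>_def PiE_iff)
    show "\<pi> (u \<oplus>\<^bsub>?F'\<^esub> v) = \<pi> u \<oplus> \<pi> v" if "v \<in> carrier ?F'"
      using \<phi>D(2)[OF u that] by (simp add: \<pi>_def free_power_simps)
    show "\<pi> (c \<odot>\<^bsub>?F'\<^esub> u) = c \<otimes> \<pi> u" if "c \<in> carrier R"
      using \<phi>D(3)[OF that u] by (simp add: \<pi>_def free_power_simps)
  qed
  note \<pi>D = left_module_homD[OF \<pi>, unfolded self_module_simps]
  define v where "v i = \<pi> (unit_vec (Suc m) i)" for i
  have vc: "v i \<in> carrier R" for i using \<pi>D(1)[OF unit_vec_closed] by (simp add: v_def)
  have "(unit_vec ?s ?s, \<zero>\<^bsub>M\<^esub>) \<in> carrier (direct_sum (free_power R ?s) M)"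
    using unit_vec_closed by (simp add: direct_sum_simps)
  then obtain x where x: "x \<in> carrier ?F'" "\<phi> x = (unit_vec ?s ?s, \<zero>\<^bsub>M\<^esub>)"
    using bij by (metis bij_betw_imp_surj_on imageE)
  then have "\<pi> x = \<one>" by (simp add: \<pi>_def unit_vec_def)
  then have "(\<Oplus>i\<in>{1..Suc m}. x i \<otimes> v i) = \<one>"
    using functional_expand[OF \<pi> x(1)] by (simp add: v_def)
  moreover have "x \<in> {1..Suc m} \<rightarrow> carrier R" using x by (auto simp: free_power_simps)
  ultimately have "unimodular_column R (Suc m) v"
    using vc unfolding unimodular_column_def by blast
  from stable[OF this] obtain a where a: "a \<in> {1..m} \<rightarrow> carrier R"
    and "unimodular_column R m (\<lambda>i. v i \<oplus> a i \<otimes> v (Suc m))"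
    unfolding stable_column_def by auto
  then obtain b' where b': "b' \<in> {1..m} \<rightarrow> carrier R"
    "(\<Oplus>i\<in>{1..m}. b' i \<otimes> (v i \<oplus> a i \<otimes> v (Suc m))) = \<one>"
    unfolding unimodular_column_def by blast
  \<comment> \<open>With these values, \<open>\<alpha> + \<gamma> \<beta>\<close> sends the unit
    vectors to the entries of the shortened column, so the left inverse \<open>b'\<close> of that
    column becomes a vector on which the functional is 1.\<close>
  obtain \<gamma> where \<gamma>: "\<gamma> \<in> left_module_hom R ?F (self_module R)" "\<And>i. i \<in> {1..m} \<Longrightarrow> \<gamma> (unit_vec m i) = a i"
    using functional_values[OF a] by blast
  define \<beta> where "\<beta> = v (Suc m)"
  have \<beta>: "\<beta> \<in> carrier R" using vc by (simp add: \<beta>_def)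
  define \<alpha> where "\<alpha> y = \<pi> (y(Suc m := \<zero>))" for y
  have \<alpha>: "\<alpha> \<in> left_module_hom R ?F (self_module R)"
  proof (rule left_module_homI, unfold self_module_simps)
    fix u w c assume u: "u \<in> carrier ?F"
    note u' = free_power_extend(1)[OF u zero_closed]
    show "\<alpha> u \<in> carrier R" using \<pi>D(1)[OF u'] by (simp add: \<alpha>_def)
    show "\<alpha> (u \<oplus>\<^bsub>?F\<^esub> w) = \<alpha> u \<oplus> \<alpha> w" if w: "w \<in> carrier ?F"
    proof -
      have "(u \<oplus>\<^bsub>?F\<^esub> w)(Suc m := \<zero>) = u(Suc m := \<zero>) \<oplus>\<^bsub>?F'\<^esub> w(Suc m := \<zero>)"
        by (auto simp: free_power_simps restrict_def fun_eq_iff)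
      then show ?thesis using \<pi>D(2)[OF u' free_power_extend(1)[OF w zero_closed]] by (simp add: \<alpha>_def)
    qed
    show "\<alpha> (c \<odot>\<^bsub>?F\<^esub> u) = c \<otimes> \<alpha> u" if c: "c \<in> carrier R"
    proof -
      have "(c \<odot>\<^bsub>?F\<^esub> u)(Suc m := \<zero>) = c \<odot>\<^bsub>?F'\<^esub> u(Suc m := \<zero>)"
        using c by (auto simp: free_power_simps restrict_def fun_eq_iff)
      then show ?thesis using \<pi>D(3)[OF c u'] by (simp add: \<alpha>_def)
    qed
  qed
  have \<alpha>_unit: "\<alpha> (unit_vec m i) = v i" if "i \<in> {1..m}" for i
  proof -
    have "(unit_vec m i)(Suc m := \<zero>) = unit_vec (Suc m) i"
      using that by (auto simp: unit_vec_def restrict_def fun_eq_iff)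
    then show ?thesis by (simp add: \<alpha>_def v_def)
  qed
  define b where "b = restrict b' {1..m}"
  have b: "b \<in> carrier ?F" using b' by (auto simp: b_def free_power_simps)
  have "\<alpha> b \<oplus> \<gamma> b \<otimes> \<beta> = (\<Oplus>i\<in>{1..m}. b i \<otimes> (\<alpha> (unit_vec m i) \<oplus> \<gamma> (unit_vec m i) \<otimes> \<beta>))"
    by (rule functional_expand[OF functional_add[OF \<alpha> functional_rmult[OF \<gamma>(1) \<beta>]] b])
  also have "\<dots> = (\<Oplus>i\<in>{1..m}. b' i \<otimes> (v i \<oplus> a i \<otimes> v (Suc m)))"
    using b'(1) a vc by (intro finsum_cong') (auto simp: b_def \<alpha>_unit \<gamma>(2) \<beta>_def Pi_iff)
  finally have one: "\<alpha> b \<oplus> \<gamma> b \<otimes> \<beta> = \<one>" using b'(2) by simp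
  let ?K = "{(y, z). y \<in> carrier ?F \<and> z \<in> carrier R \<and> \<alpha> y \<oplus> z \<otimes> \<beta> = \<zero>}"
  obtain g h where g: "g \<in> left_module_hom R ?F ?F" and h: "h \<in> left_module_hom R ?F (self_module R)"
    and bij1: "bij_betw (\<lambda>y. (g y, h y)) (carrier ?F) ?K"
    using kernel_parametrization[where \<alpha> = \<alpha> and \<gamma> = \<gamma> and \<beta> = \<beta> and b = b,
      OF left_module_free_power \<alpha> \<gamma>(1) \<beta> b one] by blast
  note gD = left_module_homD[OF g] and hD = left_module_homD[OF h, unfolded self_module_simps]
  let ?ker = "{x \<in> carrier ?F'. \<pi> x = \<zero>}"
  have \<pi>_ext: "\<pi> (y(Suc m := z)) = \<alpha> y \<oplus> z \<otimes> \<beta>" if "y \<in> carrier ?F" "z \<in> carrier R" for y z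
  proof -
    interpret F': left_module R ?F' by (rule left_module_free_power)
    show ?thesis
      using free_power_extend(1)[OF that(1) zero_closed] that unit_vec_closed[of "Suc m" "Suc m"]
      by (simp add: free_power_extend(2)[OF that] \<pi>D F'.smult_closed \<alpha>_def \<beta>_def v_def)
  qed
  have bij2: "bij_betw (\<lambda>(y, z). y(Suc m := z)) ?K ?ker"
  proof (rule bij_betw_byWitness[where f' = "\<lambda>x. (restrict x {1..m}, x (Suc m))"])
    show "\<forall>p\<in>?K. (restrict ((\<lambda>(y, z). y(Suc m := z)) p) {1..m}, (\<lambda>(y, z). y(Suc m := z)) p (Suc m)) = p"
      by (auto simp: free_power_simps PiE_iff extensional_def)
    show "(\<lambda>(y, z). y(Suc m := z)) ` ?K \<subseteq> ?ker"
      using \<pi>_ext free_power_extend(1) by auto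
    have ext: "(restrict x {1..m})(Suc m := x (Suc m)) = x" "restrict x {1..m} \<in> carrier ?F" "x (Suc m) \<in> carrier R"
      if "x \<in> carrier ?F'" for x
      using that by (auto simp: free_power_simps PiE_iff extensional_def fun_eq_iff)
    then show "\<forall>x\<in>?ker. (\<lambda>(y, z). y(Suc m := z)) (restrict x {1..m}, x (Suc m)) = x" by auto
    show "(\<lambda>x. (restrict x {1..m}, x (Suc m))) ` ?ker \<subseteq> ?K"
    proof (rule image_subsetI)
      fix x assume x: "x \<in> ?ker"
      then have x': "x \<in> carrier ?F'" "\<pi> x = \<zero>" by simp_all
      have "\<alpha> (restrict x {1..m}) \<oplus> x (Suc m) \<otimes> \<beta> = \<zero>"
        using \<pi>_ext[OF ext(2,3)[OF x'(1)]] ext(1)[OF x'(1)] x'(2) by simp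
      then show "(restrict x {1..m}, x (Suc m)) \<in> ?K"
        using ext(2,3)[OF x'(1)] by blast
    qed
  qed
  let ?D = "carrier (direct_sum (free_power R s) M)"
  define \<rho> where "\<rho> p = (restrict (fst p) {1..s}, snd p)" for p :: "(nat \<Rightarrow> 'a) \<times> 'm"
  let ?Z = "{p \<in> carrier (direct_sum (free_power R ?s) M). fst p ?s = \<zero>}"
  have bij3: "bij_betw \<phi> ?ker ?Z"
  proof (rule bij_betw_subset[OF bij])
    have "carrier (direct_sum (free_power R ?s) M) = \<phi> ` carrier ?F'"
      using bij by (simp add: bij_betw_def)
    then show "\<phi> ` ?ker = ?Z" by (simp only: \<pi>_def Compr_image_eq)
  qed blast
  have bij4: "bij_betw \<rho> ?Z ?D"
    by (rule bij_betw_byWitness[where f' = "\<lambda>p. ((fst p)(?s := \<zero>), snd p)"])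
       (auto simp: \<rho>_def direct_sum_simps free_power_simps PiE_iff extensional_def fun_eq_iff le_Suc_eq)
  define \<phi>' where "\<phi>' y = \<rho> (\<phi> ((g y)(Suc m := h y)))" for y
  have "bij_betw \<phi>' (carrier ?F) ?D"
    using bij_betw_trans[OF bij_betw_trans[OF bij_betw_trans[OF bij1 bij2] bij3] bij4]
    by (simp add: \<phi>'_def[abs_def] comp_def)
  moreover have "\<phi>' \<in> left_module_hom R ?F (direct_sum (free_power R s) M)"
  proof (rule left_module_homI, unfold direct_sum_simps)
    fix u w c assume u: "u \<in> carrier ?F"
    have uc: "(g u)(Suc m := h u) \<in> carrier ?F'" by (rule free_power_extend(1)[OF gD(1)[OF u] hD(1)[OF u]])
    show "\<phi>' u \<in> carrier (free_power R s) \<times> carrier M"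
      using \<open>bij_betw \<phi>' (carrier ?F) ?D\<close> u by (auto simp: direct_sum_simps dest: bij_betwE)
    show "\<phi>' (u \<oplus>\<^bsub>?F\<^esub> w) =
      (fst (\<phi>' u) \<oplus>\<^bsub>free_power R s\<^esub> fst (\<phi>' w), snd (\<phi>' u) \<oplus>\<^bsub>M\<^esub> snd (\<phi>' w))" if w: "w \<in> carrier ?F"
    proof -
      have wc: "(g w)(Suc m := h w) \<in> carrier ?F'" by (rule free_power_extend(1)[OF gD(1)[OF w] hD(1)[OF w]])
      have e: "(g (u \<oplus>\<^bsub>?F\<^esub> w))(Suc m := h (u \<oplus>\<^bsub>?F\<^esub> w)) =
        (g u)(Suc m := h u) \<oplus>\<^bsub>?F'\<^esub> (g w)(Suc m := h w)"
        unfolding gD(2)[OF u w] hD(2)[OF u w] by (auto simp: free_power_simps restrict_def fun_eq_iff)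
      show ?thesis
        unfolding \<phi>'_def e \<phi>D(2)[OF uc wc] by (auto simp: \<rho>_def free_power_simps restrict_def fun_eq_iff)
    qed
    show "\<phi>' (c \<odot>\<^bsub>?F\<^esub> u) = (c \<odot>\<^bsub>free_power R s\<^esub> fst (\<phi>' u), c \<odot>\<^bsub>M\<^esub> snd (\<phi>' u))" if c: "c \<in> carrier R"
    proof -
      have e: "(g (c \<odot>\<^bsub>?F\<^esub> u))(Suc m := h (c \<odot>\<^bsub>?F\<^esub> u)) = c \<odot>\<^bsub>?F'\<^esub> (g u)(Suc m := h u)"
        unfolding gD(3)[OF c u] hD(3)[OF c u] by (auto simp: free_power_simps restrict_def fun_eq_iff)
      show ?thesis
        unfolding \<phi>'_def e \<phi>D(3)[OF c uc] by (auto simp: \<rho>_def free_power_simps restrict_def fun_eq_iff)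
    qed
  qed
  ultimately show ?thesis by blast
qed

text \<open>A basis in the definition of freeness is a set of elements indexed by itself. The images
  of the unit vectors are pairwise distinct because 1 differs from 0, so the indices can be
  transferred.\<close>

lemma free_if_iso_free_power:
  assumes ne: "\<one> \<noteq> \<zero>" and M: "left_module R M"
    and g: "g \<in> left_module_hom R (free_power R t) M"
    and bij: "bij_betw g (carrier (free_power R t)) (carrier M)"
  shows "is_free_left_module R M"
proof -
  interpret M: left_module R M by (rule M)
  define e where "e i = g (unit_vec t i)" for i
  have ec: "e i \<in> carrier M" for i using left_module_homD(1)[OF g unit_vec_closed] by (simp add: e_def)
  have inj: "inj_on e {1..t}"
  proof (rule inj_onI)
    fix i j assume ij: "i \<in> {1..t}" "j \<in> {1..t}" "e i = e j"
    then have "unit_vec t i = unit_vec t j"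
      using bij unit_vec_closed unfolding e_def bij_betw_def inj_on_def by blast
    then have "unit_vec t i i = unit_vec t j i" by simp
    then show "i = j" using ij ne by (auto simp: unit_vec_def split: if_splits)
  qed
  let ?B = "e ` {1..t}"
  have comb: "(\<Oplus>\<^bsub>M\<^esub>b\<in>{b \<in> ?B. c b \<noteq> \<zero>}. c b \<odot>\<^bsub>M\<^esub> b) = g (\<lambda>i\<in>{1..t}. c (e i))"
    if c: "c \<in> ?B \<rightarrow> carrier R" for c
  proof -
    have cc: "(\<lambda>b. c b \<odot>\<^bsub>M\<^esub> b) \<in> ?B \<rightarrow> carrier M"
      using c ec by (auto simp: Pi_iff M.smult_closed)
    have "(\<Oplus>\<^bsub>M\<^esub>b\<in>{b \<in> ?B. c b \<noteq> \<zero>}. c b \<odot>\<^bsub>M\<^esub> b) = (\<Oplus>\<^bsub>M\<^esub>b\<in>?B. c b \<odot>\<^bsub>M\<^esub> b)"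
      by (rule M.add.finprod_mono_neutral_cong_left) (use cc ec M.smult_l_null in auto)
    also have "\<dots> = (\<Oplus>\<^bsub>M\<^esub>i\<in>{1..t}. c (e i) \<odot>\<^bsub>M\<^esub> e i)"
      by (rule M.finsum_reindex[OF cc inj])
    also have "\<dots> = (\<Oplus>\<^bsub>M\<^esub>i\<in>{1..t}. (\<lambda>i\<in>{1..t}. c (e i)) i \<odot>\<^bsub>M\<^esub> e i)"
      by (rule M.finsum_cong') (use c ec in \<open>auto simp: Pi_iff M.smult_closed\<close>)
    also have "\<dots> = g (\<lambda>i\<in>{1..t}. c (e i))"
      unfolding e_def by (rule hom_free_power_expand[OF M g, symmetric]) (use c in \<open>auto simp: free_power_simps e_def\<close>)
    finally show ?thesis .
  qed
  have "is_left_basis R M ?B (\<lambda>b. b)"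
    unfolding is_left_basis_def
  proof (intro conjI ballI)
    show "(\<lambda>b. b) \<in> ?B \<rightarrow> carrier M" using ec by auto
    fix u assume u: "u \<in> carrier M"
    then obtain y where y: "y \<in> carrier (free_power R t)" "g y = u"
      using bij by (metis bij_betw_imp_surj_on imageE)
    define c where "c = (\<lambda>b\<in>?B. y (the_inv_into {1..t} e b))"
    have ce: "c (e i) = y i" if "i \<in> {1..t}" for i
      using that inj by (simp add: c_def the_inv_into_f_f)
    have c: "c \<in> ?B \<rightarrow>\<^sub>E carrier R"
      using ce y(1) by (auto simp: free_power_simps PiE_iff) (simp add: c_def)
    show "\<exists>!c. c \<in> ?B \<rightarrow>\<^sub>E carrier R \<and> finite {i \<in> ?B. c i \<noteq> \<zero>} \<and>
      u = (\<Oplus>\<^bsub>M\<^esub>b\<in>{b \<in> ?B. c b \<noteq> \<zero>}. c b \<odot>\<^bsub>M\<^esub> b)"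
    proof (rule ex1I[of _ c])
      have "(\<lambda>i\<in>{1..t}. c (e i)) = y"
        using y(1) ce by (auto simp: free_power_simps PiE_iff extensional_def)
      then show "c \<in> ?B \<rightarrow>\<^sub>E carrier R \<and> finite {i \<in> ?B. c i \<noteq> \<zero>} \<and>
        u = (\<Oplus>\<^bsub>M\<^esub>b\<in>{b \<in> ?B. c b \<noteq> \<zero>}. c b \<odot>\<^bsub>M\<^esub> b)"
        using comb[of c] c y(2) by (auto simp: PiE_def)
    next
      fix c' assume c': "c' \<in> ?B \<rightarrow>\<^sub>E carrier R \<and> finite {i \<in> ?B. c' i \<noteq> \<zero>} \<and>
        u = (\<Oplus>\<^bsub>M\<^esub>b\<in>{b \<in> ?B. c' b \<noteq> \<zero>}. c' b \<odot>\<^bsub>M\<^esub> b)"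
      then have "g (\<lambda>i\<in>{1..t}. c' (e i)) = g y" using comb[of c'] y(2) by (auto simp: PiE_def)
      moreover have "(\<lambda>i\<in>{1..t}. c' (e i)) \<in> carrier (free_power R t)"
        using c' by (auto simp: free_power_simps PiE_iff)
      ultimately have "(\<lambda>i\<in>{1..t}. c' (e i)) = y"
        using bij y(1) unfolding bij_betw_def inj_on_def by blast
      then have eq: "c' (e i) = c (e i)" if "i \<in> {1..t}" for i
        using ce that by (metis restrict_apply')
      show "c' = c"
        by (rule PiE_ext[of _ ?B "\<lambda>_. carrier R"]) (use c c' eq in auto)
    qed
  qed
  then show ?thesis
    unfolding is_free_left_module_def using M ec by blast
qed

text \<open>The free summands are cancelled one at a time. Removing one of \<open>Suc s\<close>
  summands needs a stable column of length \<open>Suc (s + t)\<close>, which is available because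
  \<open>d \<le> t\<close>.\<close>

lemma stably_free_imp_free:
  assumes ne: "\<one> \<noteq> \<zero>"
    and stable: "\<And>m v. d \<le> m \<Longrightarrow> unimodular_column R (Suc m) v \<Longrightarrow> stable_column R (Suc m) v"
    and t: "d \<le> t" and sf: "stably_free_of_rank R M t"
  shows "is_free_left_module R M"
proof -
  have M: "left_module R M" using sf by (simp add: stably_free_of_rank_def)
  interpret M: left_module R M by (rule M)
  have "\<exists>\<phi>\<in>left_module_hom R (free_power R t) (direct_sum (free_power R 0) M).
      bij_betw \<phi> (carrier (free_power R t)) (carrier (direct_sum (free_power R 0) M))"
    if "left_module_iso R (free_power R (s + t)) (direct_sum (free_power R s) M)" for s
    using that
  proof (induction s)
    case 0
    then show ?case by (simp add: left_module_iso_def)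
  next
    case (Suc s)
    then obtain \<phi> where \<phi>: "\<phi> \<in> left_module_hom R (free_power R (Suc (s + t))) (direct_sum (free_power R (Suc s)) M)"
      "bij_betw \<phi> (carrier (free_power R (Suc (s + t)))) (carrier (direct_sum (free_power R (Suc s)) M))"
      unfolding left_module_iso_def by auto
    have "left_module_iso R (free_power R (s + t)) (direct_sum (free_power R s) M)"
      unfolding left_module_iso_def
      by (rule cancel_free_summand[OF stable M \<phi>]) (use t in simp)
    then show ?case by (rule Suc.IH)
  qed
  then obtain \<phi> where \<phi>: "\<phi> \<in> left_module_hom R (free_power R t) (direct_sum (free_power R 0) M)"
    "bij_betw \<phi> (carrier (free_power R t)) (carrier (direct_sum (free_power R 0) M))"
    using sf unfolding stably_free_of_rank_def by blast
  have "snd \<in> left_module_hom R (direct_sum (free_power R 0) M) M"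
    by (rule left_module_homI) (auto simp: direct_sum_simps)
  then have "(\<lambda>u. snd (\<phi> u)) \<in> left_module_hom R (free_power R t) M"
    by (rule left_module_hom_comp[OF \<phi>(1)])
  moreover have "bij_betw snd (carrier (direct_sum (free_power R 0) M)) (carrier M)"
    by (rule bij_betw_byWitness[where f' = "\<lambda>u. (\<lambda>_. undefined, u)"])
       (auto simp: direct_sum_simps free_power_simps)
  then have "bij_betw (\<lambda>u. snd (\<phi> u)) (carrier (free_power R t)) (carrier M)"
    using bij_betw_trans[OF \<phi>(2)] by (simp add: comp_def)
  ultimately show ?thesis by (rule free_if_iso_free_power[OF ne M])
qed

end

section \<open>Monomials in skew PBW extensions\<close>

lemma lex_less_than_linear:
  assumes "length xs = length ys"
  shows "xs = ys \<or> (xs, ys) \<in> lex less_than \<or> (ys, xs) \<in> lex less_than"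
  using assms by (induction xs ys rule: list_induct2) auto

lemma lex_map_add:
  fixes f g e :: "'i \<Rightarrow> nat"
  shows "(map f is, map g is) \<in> lex less_than \<Longrightarrow>
    (map (\<lambda>j. f j + e j) is, map (\<lambda>j. g j + e j) is) \<in> lex less_than"
  by (induction "is") auto

context bijective_skew_PBW_extension
begin

abbreviation mon :: "(nat \<Rightarrow> nat) \<Rightarrow> 'a"
  where "mon \<equiv> pbw_monomial A n x"

definition incr :: "nat \<Rightarrow> (nat \<Rightarrow> nat) \<Rightarrow> nat \<Rightarrow> nat"
  where "incr i \<alpha> = \<alpha>(i := Suc (\<alpha> i))"

definition deg :: "(nat \<Rightarrow> nat) \<Rightarrow> nat"
  where "deg \<alpha> = (\<Sum>i\<in>{1..n}. \<alpha> i)"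

definition exps_below :: "nat \<Rightarrow> (nat \<Rightarrow> nat) set"
  where "exps_below q = {\<beta> \<in> exps n. deg \<beta> < q}"

lemma coeff_closed: "r \<in> R \<Longrightarrow> r \<in> carrier A"
  using subset by blast

lemma var: "i \<in> {1..n} \<Longrightarrow> x i \<in> carrier A"
  using var_closed by blast

lemma incr_exps: "\<alpha> \<in> exps n \<Longrightarrow> i \<in> {1..n} \<Longrightarrow> incr i \<alpha> \<in> exps n"
  by (auto simp: exps_def incr_def PiE_iff extensional_def)

lemma deg_incr: "i \<in> {1..n} \<Longrightarrow> deg (incr i \<alpha>) = Suc (deg \<alpha>)"
proof -
  assume i: "i \<in> {1..n}"
  have "(\<Sum>j\<in>{1..n} - {i}. incr i \<alpha> j) = (\<Sum>j\<in>{1..n} - {i}. \<alpha> j)"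
    by (rule sum.cong) (auto simp: incr_def)
  then show ?thesis
    using i sum.remove[of "{1..n}" i "incr i \<alpha>"] sum.remove[of "{1..n}" i \<alpha>]
    by (simp add: deg_def incr_def)
qed

lemma foldr_monomial_closed:
  fixes \<alpha> :: "nat \<Rightarrow> nat"
  shows
  "set is \<subseteq> {1..n} \<Longrightarrow> p \<in> carrier A \<Longrightarrow> foldr (\<lambda>i p. x i [^] \<alpha> i \<otimes> p) is p \<in> carrier A"
  by (induction "is") (simp_all add: var)

lemma mon_closed: "mon \<alpha> \<in> carrier A"
  unfolding pbw_monomial_def by (rule foldr_monomial_closed) auto

lemma foldr_monomial_zero:
  assumes "\<And>i. i \<in> set is \<Longrightarrow> \<alpha> i = (0::nat)" "p \<in> carrier A"
  shows "foldr (\<lambda>i p. x i [^] \<alpha> i \<otimes> p) is p = p"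
  using assms(1) by (induction "is") (simp_all add: assms(2))

text \<open>No variable stands to the left of \<open>x i\<close> in the monomial, so nothing has to
  be commuted and no lower terms appear.\<close>

lemma var_mon:
  assumes i: "i \<in> {1..n}" and z: "\<And>j. 1 \<le> j \<Longrightarrow> j < i \<Longrightarrow> \<alpha> j = 0"
  shows "x i \<otimes> mon \<alpha> = mon (incr i \<alpha>)"
proof -
  have split: "[1..<Suc n] = [1..<i] @ i # [Suc i..<Suc n]"
    using i upt_add_eq_append[of 1 i "Suc n - i"] upt_conv_Cons[of i "Suc n"] by simp
  define p where "p = foldr (\<lambda>i p. x i [^] \<alpha> i \<otimes> p) [Suc i..<Suc n] \<one>"
  have pc: "p \<in> carrier A" unfolding p_def by (rule foldr_monomial_closed) auto
  have p': "foldr (\<lambda>j p. x j [^] incr i \<alpha> j \<otimes> p) [Suc i..<Suc n] \<one> = p"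
    unfolding p_def by (rule foldr_cong) (auto simp: incr_def)
  have xi: "x i \<in> carrier A" using var[OF i] .
  have "mon \<alpha> = x i [^] \<alpha> i \<otimes> p"
    unfolding pbw_monomial_def split
    using foldr_monomial_zero[of "[1..<i]" \<alpha> "x i [^] \<alpha> i \<otimes> p"] z xi pc by (simp add: p_def)
  moreover have "mon (incr i \<alpha>) = x i [^] Suc (\<alpha> i) \<otimes> p"
    unfolding pbw_monomial_def split
    using foldr_monomial_zero[of "[1..<i]" "incr i \<alpha>" "x i [^] Suc (\<alpha> i) \<otimes> p"] z xi pc p'
    by (simp add: incr_def)
  moreover have "x i [^] Suc (\<alpha> i) \<otimes> p = x i \<otimes> (x i [^] \<alpha> i \<otimes> p)"
    unfolding nat_pow_Suc2[OF xi] using xi pc by (simp add: m_assoc)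
  ultimately show ?thesis by simp
qed

text \<open>With \<open>j\<close> the first index of a nonzero exponent, \<open>var_mon\<close> lets
  the monomial be peeled as \<open>x j\<close> times a monomial of smaller degree. This drives the
  inductions on the degree.\<close>

lemma exps_cases:
  assumes "\<alpha> \<in> exps n" "deg \<alpha> \<noteq> 0"
  obtains j \<beta> where "j \<in> {1..n}" "\<beta> \<in> exps n" "\<alpha> = incr j \<beta>" "\<And>i. 1 \<le> i \<Longrightarrow> i < j \<Longrightarrow> \<alpha> i = 0"
    "\<And>i. 1 \<le> i \<Longrightarrow> i < j \<Longrightarrow> \<beta> i = 0"
proof -
  have "\<exists>j. j \<in> {1..n} \<and> \<alpha> j \<noteq> 0" using assms(2) by (auto simp: deg_def)
  then obtain j where j: "j \<in> {1..n} \<and> \<alpha> j \<noteq> 0" and least: "\<And>i. i < j \<Longrightarrow> \<not> (i \<in> {1..n} \<and> \<alpha> i \<noteq> 0)"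
    using exists_least_iff[of "\<lambda>j. j \<in> {1..n} \<and> \<alpha> j \<noteq> 0"] by blast
  show thesis
  proof (rule that[of j "\<alpha>(j := \<alpha> j - 1)"])
    show "\<alpha>(j := \<alpha> j - 1) \<in> exps n"
      using assms(1) j by (auto simp: exps_def PiE_iff extensional_def)
  qed (use j least in \<open>auto simp: incr_def\<close>)
qed

lemma mon_degree_zero: "deg \<alpha> = 0 \<Longrightarrow> mon \<alpha> = \<one>"
  unfolding pbw_monomial_def by (rule foldr_monomial_zero) (auto simp: deg_def)

section \<open>Left spans of monomials and commutation rules\<close>

inductive_set span :: "(nat \<Rightarrow> nat) set \<Rightarrow> 'a set"
  for E :: "(nat \<Rightarrow> nat) set"
  where
    span_zero: "\<zero> \<in> span E"
  | span_step: "\<lbrakk>r \<in> R; \<beta> \<in> E; h \<in> span E\<rbrakk> \<Longrightarrow> r \<otimes> mon \<beta> \<oplus> h \<in> span E"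

lemma span_closed: "h \<in> span E \<Longrightarrow> h \<in> carrier A"
  by (induction rule: span.induct) (auto simp: coeff_closed mon_closed)

lemma span_mono: "h \<in> span E \<Longrightarrow> E \<subseteq> E' \<Longrightarrow> h \<in> span E'"
  by (induction rule: span.induct) (auto intro: span.intros)

lemma span_add:
  assumes "g \<in> span E" "h \<in> span E"
  shows "g \<oplus> h \<in> span E"
  using assms(1)
proof (induction rule: span.induct)
  case (span_step r \<beta> g)
  then have "r \<otimes> mon \<beta> \<oplus> (g \<oplus> h) \<in> span E" by (intro span.span_step)
  then show ?case
    using span_step assms(2) by (simp add: a_assoc coeff_closed mon_closed span_closed)
qed (use assms(2) span_closed in simp)

lemma span_monomial:
  assumes "r \<in> R" "\<beta> \<in> E"
  shows "r \<otimes> mon \<beta> \<in> span E"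
  using span_step[OF assms span_zero] assms by (simp add: coeff_closed mon_closed)

lemma span_map:
  assumes h: "h \<in> span E" and zero: "f \<zero> = \<zero>"
    and add: "\<And>u v. u \<in> carrier A \<Longrightarrow> v \<in> carrier A \<Longrightarrow> f (u \<oplus> v) = f u \<oplus> f v"
    and step: "\<And>r \<beta>. r \<in> R \<Longrightarrow> \<beta> \<in> E \<Longrightarrow> f (r \<otimes> mon \<beta>) \<in> span E'"
  shows "f h \<in> span E'"
  using h
proof (induction rule: span.induct)
  case span_zero
  then show ?case by (simp add: zero span.span_zero)
next
  case (span_step r \<beta> h)
  then show ?case
    using add[of "r \<otimes> mon \<beta>" h] step[of r \<beta>] by (simp add: coeff_closed mon_closed span_closed span_add)
qed

lemma span_lmult:
  assumes "s \<in> R" "h \<in> span E"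
  shows "s \<otimes> h \<in> span E"
proof (rule span_map[OF assms(2)])
  fix r \<beta> assume "r \<in> R" "\<beta> \<in> E"
  then show "s \<otimes> (r \<otimes> mon \<beta>) \<in> span E"
    using span_monomial[of "s \<otimes> r" \<beta> E] assms(1) by (simp add: coeff_closed mon_closed m_assoc)
qed (use assms(1) in \<open>simp_all add: coeff_closed r_distr\<close>)

lemma span_uminus: "h \<in> span E \<Longrightarrow> \<ominus> h \<in> span E"
  using span_lmult[of "\<ominus> \<one>" h E] span_closed[of h E] subringE(5)[OF subring_axioms one_closed]
  by (simp add: l_minus)

lemma span_finsum: "finite F \<Longrightarrow> f \<in> F \<rightarrow> span E \<Longrightarrow> (\<Oplus>i\<in>F. f i) \<in> span E"
proof (induction F rule: finite_induct)
  case (insert i F)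
  have "f \<in> F \<rightarrow> carrier A" "f i \<in> carrier A" using insert span_closed by blast+
  then show ?case using insert by (simp add: span_add)
qed (simp add: span_zero)

text \<open>These are the maps by which a coefficient changes when a monomial is moved past it up to
  lower terms: composites of the endomorphisms attached to the variables.\<close>

definition twist :: "('a \<Rightarrow> 'a) \<Rightarrow> bool"
  where "twist \<tau> \<longleftrightarrow> bij_betw \<tau> R R \<and> \<tau> \<one> = \<one> \<and> (\<forall>r\<in>R. \<forall>s\<in>R. \<tau> (r \<otimes> s) = \<tau> r \<otimes> \<tau> s)"

lemma twist_closed: "twist \<tau> \<Longrightarrow> r \<in> R \<Longrightarrow> \<tau> r \<in> R"
  by (auto simp: twist_def dest: bij_betwE)

lemma twist_comp: "twist \<phi> \<Longrightarrow> twist \<tau> \<Longrightarrow> twist (\<lambda>r. \<phi> (\<tau> r))"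
  using bij_betw_trans[of \<tau> R R \<phi> R] twist_closed[of \<tau>] by (auto simp: twist_def comp_def)

lemma twist_surj: "twist \<tau> \<Longrightarrow> s \<in> R \<Longrightarrow> \<exists>r\<in>R. \<tau> r = s"
proof -
  assume "twist \<tau>" "s \<in> R"
  then have "s \<in> \<tau> ` R" by (simp add: twist_def bij_betw_def)
  then show ?thesis by blast
qed

lemma var_twist:
  assumes "i \<in> {1..n}"
  shows "\<exists>\<phi>. twist \<phi> \<and> (\<forall>r\<in>R. \<exists>d\<in>R. x i \<otimes> r = \<phi> r \<otimes> x i \<oplus> d)"
proof -
  obtain \<phi> \<delta> where *: "\<phi> \<in> ring_hom (A\<lparr>carrier := R\<rparr>) (A\<lparr>carrier := R\<rparr>)" "bij_betw \<phi> R R"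
    "skew_derivation (A\<lparr>carrier := R\<rparr>) \<phi> \<delta>" "\<forall>r\<in>R. x i \<otimes> r = \<phi> r \<otimes> x i \<oplus> \<delta> r"
    using bij_endo[OF assms] by blast
  have "twist \<phi>"
    using *(1,2) ring_hom_mult[OF *(1)] ring_hom_one[OF *(1)] by (simp add: twist_def)
  moreover have "\<delta> r \<in> R" if "r \<in> R" for r
    using *(3) that by (auto simp: skew_derivation_def)
  ultimately show ?thesis using *(4) by blast
qed

definition unit_coeff :: "'a \<Rightarrow> bool"
  where "unit_coeff c \<longleftrightarrow> c \<in> R \<and> (\<exists>d\<in>R. d \<otimes> c = \<one> \<and> c \<otimes> d = \<one>)"

lemma unit_coeff_twist:
  assumes "twist \<tau>" "unit_coeff c"
  shows "unit_coeff (\<tau> c)"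
proof -
  obtain d where d: "c \<in> R" "d \<in> R" "d \<otimes> c = \<one>" "c \<otimes> d = \<one>" using assms(2) by (auto simp: unit_coeff_def)
  then have "\<tau> d \<otimes> \<tau> c = \<one>" "\<tau> c \<otimes> \<tau> d = \<one>" using assms(1) unfolding twist_def by metis+
  then show ?thesis using d twist_closed[OF assms(1)] by (auto simp: unit_coeff_def)
qed

lemma unit_coeff_mult:
  assumes "unit_coeff c" "unit_coeff c'"
  shows "unit_coeff (c \<otimes> c')"
proof -
  obtain d d' where d: "c \<in> R" "d \<in> R" "d \<otimes> c = \<one>" "c \<otimes> d = \<one>" "c' \<in> R" "d' \<in> R" "d' \<otimes> c' = \<one>" "c' \<otimes> d' = \<one>"
    using assms by (auto simp: unit_coeff_def)
  note cl = d(1,2,5,6)[THEN coeff_closed]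
  have "(d' \<otimes> d) \<otimes> (c \<otimes> c') = d' \<otimes> (d \<otimes> c) \<otimes> c'" "(c \<otimes> c') \<otimes> (d' \<otimes> d) = c \<otimes> (c' \<otimes> d') \<otimes> d"
    using cl by (simp_all add: m_assoc)
  then show ?thesis
    using d cl unfolding unit_coeff_def by (intro conjI bexI[of _ "d' \<otimes> d"]) auto
qed

lemma var_commute:
  assumes "i \<in> {1..n}" "j \<in> {1..n}" "j < i"
  shows "\<exists>c. unit_coeff c \<and> x i \<otimes> x j \<ominus> c \<otimes> (x j \<otimes> x i) \<in> pbw_linear_part A R n x"
  using invertible_coeff[OF assms(2,1,3)] unfolding Units_def unit_coeff_def by auto

lemma linear_part_mult:
  assumes l: "l \<in> pbw_linear_part A R n x" and f: "f \<in> span E"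
    and var: "\<And>k. k \<in> {1..n} \<Longrightarrow> x k \<otimes> f \<in> span E"
  shows "l \<otimes> f \<in> span E"
proof -
  obtain r0 r where *: "r0 \<in> R" "r \<in> {1..n} \<rightarrow> R" "l = r0 \<oplus> (\<Oplus>i\<in>{1..n}. r i \<otimes> x i)"
    using l unfolding pbw_linear_part_def by blast
  have rx: "(\<lambda>i. r i \<otimes> x i) \<in> {1..n} \<rightarrow> carrier A"
    using *(2) var_closed coeff_closed by (auto simp: Pi_iff)
  have fc: "f \<in> carrier A" using f span_closed by blast
  have "l \<otimes> f = r0 \<otimes> f \<oplus> (\<Oplus>i\<in>{1..n}. r i \<otimes> x i \<otimes> f)"
    using * rx fc by (simp add: l_distr coeff_closed finsum_ldistr finsum_closed)
  moreover have "r i \<otimes> x i \<otimes> f \<in> span E" if "i \<in> {1..n}" for i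
    using span_lmult[OF _ var[OF that], of "r i"] *(2) that fc var_closed coeff_closed by (auto simp: m_assoc Pi_iff)
  then have "(\<Oplus>i\<in>{1..n}. r i \<otimes> x i \<otimes> f) \<in> span E" by (intro span_finsum) auto
  ultimately show ?thesis using span_add span_lmult[OF *(1) f] by simp
qed

text \<open>Moving \<open>x i\<close> past a coefficient leaves a derivation term in which the
  monomial is not multiplied, which is why both \<open>mon \<beta>\<close> and
  \<open>x i \<otimes> mon \<beta>\<close> must lie in the target span.\<close>

lemma var_mult_span:
  assumes i: "i \<in> {1..n}" and h: "h \<in> span E"
    and step: "\<And>\<beta>. \<beta> \<in> E \<Longrightarrow> mon \<beta> \<in> span E' \<and> x i \<otimes> mon \<beta> \<in> span E'"
  shows "x i \<otimes> h \<in> span E'"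
proof (rule span_map[OF h])
  obtain \<phi> where \<phi>: "twist \<phi>" "\<And>r. r \<in> R \<Longrightarrow> \<exists>d\<in>R. x i \<otimes> r = \<phi> r \<otimes> x i \<oplus> d"
    using var_twist[OF i] by blast
  fix r \<beta> assume r: "r \<in> R" "\<beta> \<in> E"
  then obtain d where d: "d \<in> R" "x i \<otimes> r = \<phi> r \<otimes> x i \<oplus> d" using \<phi>(2) by blast
  note cl = r(1)[THEN coeff_closed] d(1)[THEN coeff_closed] twist_closed[OF \<phi>(1) r(1), THEN coeff_closed] var[OF i] mon_closed[of \<beta>]
  have "x i \<otimes> (r \<otimes> mon \<beta>) = (x i \<otimes> r) \<otimes> mon \<beta>"
    using cl by (simp add: m_assoc)
  also have "\<dots> = \<phi> r \<otimes> (x i \<otimes> mon \<beta>) \<oplus> d \<otimes> mon \<beta>"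
    unfolding d(2) using cl by (simp add: m_assoc l_distr)
  also have "\<dots> \<in> span E'"
    using step[OF r(2)] twist_closed[OF \<phi>(1) r(1)] d(1) by (simp add: span_add span_lmult)
  finally show "x i \<otimes> (r \<otimes> mon \<beta>) \<in> span E'" .
qed (use var[OF i] in \<open>simp_all add: r_distr\<close>)

text \<open>If some variable before \<open>x i\<close> occurs, let \<open>x j\<close> be the first
  one and \<open>\<beta>\<close> the rest of the exponent. Exchanging \<open>x i\<close> and
  \<open>x j\<close> costs a unit and a linear part, and the induction hypothesis moves
  \<open>x i\<close> into \<open>mon \<beta>\<close>. All error terms are variables or coefficients
  times monomials of degree less than that of \<open>\<alpha>\<close>, so they stay below the degree
  of the leading term.\<close>

lemma var_mon_general:
  assumes "\<alpha> \<in> exps n" "i \<in> {1..n}"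
  shows "\<exists>c h. unit_coeff c \<and> h \<in> span (exps_below (Suc (deg \<alpha>))) \<and> x i \<otimes> mon \<alpha> = c \<otimes> mon (incr i \<alpha>) \<oplus> h"
  using assms
proof (induction "deg \<alpha>" arbitrary: \<alpha> i rule: less_induct)
  case less
  note \<alpha> = less.prems(1) and i = less.prems(2)
  have mon_in: "mon \<beta> \<in> span E" if "\<beta> \<in> E" for \<beta> E
    using span_monomial[OF one_closed that] mon_closed by simp
  show ?case
  proof (cases "\<forall>j. 1 \<le> j \<and> j < i \<longrightarrow> \<alpha> j = 0")
    case True
    then have "x i \<otimes> mon \<alpha> = \<one> \<otimes> mon (incr i \<alpha>) \<oplus> \<zero>"
      using var_mon[OF i, of \<alpha>] mon_closed by simp
    moreover have "unit_coeff \<one>" by (auto simp: unit_coeff_def)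
    ultimately show ?thesis using span_zero by blast
  next
    case False
    then obtain l where l: "1 \<le> l" "l < i" "\<alpha> l \<noteq> 0" by blast
    then have "deg \<alpha> \<noteq> 0" using i by (auto simp: deg_def)
    then obtain j \<beta> where j: "j \<in> {1..n}" "\<beta> \<in> exps n" "\<alpha> = incr j \<beta>"
      and \<alpha>z: "\<And>i. 1 \<le> i \<Longrightarrow> i < j \<Longrightarrow> \<alpha> i = 0" and \<beta>z: "\<And>i. 1 \<le> i \<Longrightarrow> i < j \<Longrightarrow> \<beta> i = 0"
      by (rule exps_cases[OF \<alpha>]) blast+
    have ji: "j < i" using \<alpha>z[of l] l by (meson linorder_not_less order_le_less_trans)
    have deg: "deg \<alpha> = Suc (deg \<beta>)" using deg_incr j by simp
    let ?S = "span (exps_below (Suc (deg \<alpha>)))"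
    have S_mono: "h \<in> ?S" if "h \<in> span (exps_below (Suc (deg \<beta>)))" for h
      using that by (rule span_mono) (auto simp: exps_below_def deg)
    have var_small: "x k \<otimes> mon \<gamma> \<in> ?S" if k: "k \<in> {1..n}" and \<gamma>: "\<gamma> \<in> exps n" "deg \<gamma> < deg \<alpha>" for k \<gamma>
    proof -
      obtain c h where c: "unit_coeff c" "h \<in> span (exps_below (Suc (deg \<gamma>)))" "x k \<otimes> mon \<gamma> = c \<otimes> mon (incr k \<gamma>) \<oplus> h"
        using less.hyps[OF \<gamma>(2,1) k] by blast
      have "incr k \<gamma> \<in> exps_below (Suc (deg \<alpha>))"
        using incr_exps[OF \<gamma>(1) k] deg_incr[OF k] \<gamma>(2) by (simp add: exps_below_def)
      moreover have "h \<in> ?S" using c(2) by (rule span_mono) (use \<gamma>(2) in \<open>auto simp: exps_below_def\<close>)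
      ultimately show ?thesis using c span_monomial by (auto simp: unit_coeff_def intro: span_add)
    qed
    have mon\<beta>: "mon \<beta> \<in> ?S" using j deg by (intro mon_in) (simp add: exps_below_def)
    obtain c where c: "unit_coeff c" "x i \<otimes> x j \<ominus> c \<otimes> (x j \<otimes> x i) \<in> pbw_linear_part A R n x"
      using var_commute[OF i j(1) ji] by blast
    define l where "l = x i \<otimes> x j \<ominus> c \<otimes> (x j \<otimes> x i)"
    have lS: "l \<otimes> mon \<beta> \<in> ?S"
      by (rule linear_part_mult[OF c(2)[folded l_def] mon\<beta> var_small]) (use j deg in auto)
    obtain c' h where c': "unit_coeff c'" "h \<in> span (exps_below (Suc (deg \<beta>)))" "x i \<otimes> mon \<beta> = c' \<otimes> mon (incr i \<beta>) \<oplus> h"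
      using less.hyps[of \<beta> i] j i deg by auto
    obtain \<phi> where \<phi>: "twist \<phi>" "\<And>r. r \<in> R \<Longrightarrow> \<exists>d\<in>R. x j \<otimes> r = \<phi> r \<otimes> x j \<oplus> d"
      using var_twist[OF j(1)] by blast
    have R: "c \<in> R" "c' \<in> R" using c c' by (auto simp: unit_coeff_def)
    then obtain d where d: "d \<in> R" "x j \<otimes> c' = \<phi> c' \<otimes> x j \<oplus> d" using \<phi>(2) by blast
    have cl: "c \<in> carrier A" "c' \<in> carrier A" "d \<in> carrier A" "\<phi> c' \<in> carrier A" "x i \<in> carrier A" "x j \<in> carrier A"
      "h \<in> carrier A" "mon \<beta> \<in> carrier A" "mon (incr i \<beta>) \<in> carrier A" "mon (incr i \<alpha>) \<in> carrier A"
      using R d twist_closed[OF \<phi>(1)] coeff_closed var i j mon_closed span_closed[OF c'(2)] by blast+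
    have lc: "l \<in> carrier A" using cl by (simp add: l_def)
    have xx: "x i \<otimes> x j = c \<otimes> (x j \<otimes> x i) \<oplus> l"
      using cl by (simp add: l_def minus_eq a_comm[of "c \<otimes> (x j \<otimes> x i)"] a_assoc l_neg)
    have "incr j (incr i \<beta>) = incr i \<alpha>" using j(3) ji by (auto simp: incr_def fun_eq_iff)
    \<comment> \<open>As \<open>j < i\<close>, the index \<open>j\<close> still precedes all nonzero
      exponents of \<open>incr i \<beta>\<close>, so this product is exact.\<close>
    then have m2: "x j \<otimes> mon (incr i \<beta>) = mon (incr i \<alpha>)"
      using var_mon[OF j(1), of "incr i \<beta>"] \<beta>z ji by (simp add: incr_def)
    have m1: "mon \<alpha> = x j \<otimes> mon \<beta>" using var_mon[OF j(1), of \<beta>] \<beta>z j(3) by simp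
    have "x i \<otimes> mon \<alpha> = (x i \<otimes> x j) \<otimes> mon \<beta>"
      using cl by (simp add: m1 m_assoc)
    also have "\<dots> = c \<otimes> (x j \<otimes> (x i \<otimes> mon \<beta>)) \<oplus> l \<otimes> mon \<beta>"
      unfolding xx using cl lc by (simp add: l_distr m_assoc)
    also have "x j \<otimes> (x i \<otimes> mon \<beta>) = (x j \<otimes> c') \<otimes> mon (incr i \<beta>) \<oplus> x j \<otimes> h"
      unfolding c'(3) using cl by (simp add: r_distr m_assoc)
    also have "(x j \<otimes> c') \<otimes> mon (incr i \<beta>) = \<phi> c' \<otimes> mon (incr i \<alpha>) \<oplus> d \<otimes> mon (incr i \<beta>)"
      unfolding d(2) using cl by (simp add: l_distr m_assoc m2)
    finally have eq: "x i \<otimes> mon \<alpha> = c \<otimes> \<phi> c' \<otimes> mon (incr i \<alpha>) \<oplus>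
      (c \<otimes> (d \<otimes> mon (incr i \<beta>) \<oplus> x j \<otimes> h) \<oplus> l \<otimes> mon \<beta>)"
      using cl lc by (simp add: r_distr m_assoc a_assoc)
    have "x j \<otimes> h \<in> ?S"
      by (rule var_mult_span[OF j(1) c'(2)])
         (use var_small j deg in \<open>auto simp: exps_below_def intro!: mon_in\<close>)
    moreover have "d \<otimes> mon (incr i \<beta>) \<in> ?S"
      using d(1) incr_exps[OF j(2) i] deg_incr[OF i] deg by (intro span_monomial) (simp_all add: exps_below_def)
    ultimately have "c \<otimes> (d \<otimes> mon (incr i \<beta>) \<oplus> x j \<otimes> h) \<oplus> l \<otimes> mon \<beta> \<in> ?S"
      using span_add[OF span_lmult[OF R(1) span_add] lS] by blast
    then show ?thesis
      using eq unit_coeff_mult[OF c(1) unit_coeff_twist[OF \<phi>(1) c'(1)]] by blast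
  qed
qed

lemma mon_in_span: "\<beta> \<in> E \<Longrightarrow> mon \<beta> \<in> span E"
  using span_monomial[OF one_closed, of \<beta> E] mon_closed by simp

lemma var_mon_in_span:
  assumes "\<beta> \<in> exps n" "i \<in> {1..n}" "incr i \<beta> \<in> E" "exps_below (Suc (deg \<beta>)) \<subseteq> E"
  shows "x i \<otimes> mon \<beta> \<in> span E"
proof -
  obtain c h where c: "unit_coeff c" "h \<in> span (exps_below (Suc (deg \<beta>)))" "x i \<otimes> mon \<beta> = c \<otimes> mon (incr i \<beta>) \<oplus> h"
    using var_mon_general[OF assms(1,2)] by blast
  then show ?thesis
    using span_mono[OF c(2) assms(4)] span_monomial assms(3) by (auto simp: unit_coeff_def intro: span_add)
qed

text \<open>Peel off the first variable: the twist of the rest is followed by that of the variable,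
  while derivation terms and products of \<open>x j\<close> with lower terms have smaller
  degree.\<close>

lemma mon_twist:
  assumes "\<alpha> \<in> exps n"
  shows "\<exists>\<tau>. twist \<tau> \<and> (\<forall>r\<in>R. \<exists>h\<in>span (exps_below (deg \<alpha>)). mon \<alpha> \<otimes> r = \<tau> r \<otimes> mon \<alpha> \<oplus> h)"
  using assms
proof (induction "deg \<alpha>" arbitrary: \<alpha>)
  case 0
  then have "mon \<alpha> = \<one>" by (simp add: mon_degree_zero)
  then have "\<forall>r\<in>R. \<exists>h\<in>span (exps_below (deg \<alpha>)). mon \<alpha> \<otimes> r = r \<otimes> mon \<alpha> \<oplus> h"
    by (intro ballI bexI[of _ \<zero>]) (simp_all add: coeff_closed span_zero)
  moreover have "twist (\<lambda>r. r)" by (simp add: twist_def bij_betw_def)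
  ultimately show ?case by (intro exI[of _ "\<lambda>r. r"]) simp
next
  case (Suc q)
  obtain j \<beta> where j: "j \<in> {1..n}" "\<beta> \<in> exps n" "\<alpha> = incr j \<beta>" and \<beta>z: "\<And>i. 1 \<le> i \<Longrightarrow> i < j \<Longrightarrow> \<beta> i = 0"
    by (rule exps_cases[OF Suc.prems]) (use Suc.hyps(2) in auto)
  have deg: "deg \<alpha> = Suc (deg \<beta>)" using deg_incr j by simp
  then obtain \<tau> where \<tau>: "twist \<tau>" "\<And>r. r \<in> R \<Longrightarrow> \<exists>h\<in>span (exps_below (deg \<beta>)). mon \<beta> \<otimes> r = \<tau> r \<otimes> mon \<beta> \<oplus> h"
    using Suc.hyps(1)[of \<beta>] Suc.hyps(2) j by auto
  obtain \<phi> where \<phi>: "twist \<phi>" "\<And>r. r \<in> R \<Longrightarrow> \<exists>d\<in>R. x j \<otimes> r = \<phi> r \<otimes> x j \<oplus> d"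
    using var_twist[OF j(1)] by blast
  have m1: "mon \<alpha> = x j \<otimes> mon \<beta>" using var_mon[OF j(1), of \<beta>] \<beta>z j(3) by simp
  have "\<exists>h\<in>span (exps_below (deg \<alpha>)). mon \<alpha> \<otimes> r = \<phi> (\<tau> r) \<otimes> mon \<alpha> \<oplus> h" if r: "r \<in> R" for r
  proof -
    obtain h where h: "h \<in> span (exps_below (deg \<beta>))" "mon \<beta> \<otimes> r = \<tau> r \<otimes> mon \<beta> \<oplus> h" using \<tau>(2)[OF r] by blast
    have \<tau>r: "\<tau> r \<in> R" "\<phi> (\<tau> r) \<in> R" using twist_closed \<tau>(1) \<phi>(1) r by blast+
    obtain d where d: "d \<in> R" "x j \<otimes> \<tau> r = \<phi> (\<tau> r) \<otimes> x j \<oplus> d" using \<phi>(2)[OF \<tau>r(1)] by blast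
    have cl: "r \<in> carrier A" "\<tau> r \<in> carrier A" "\<phi> (\<tau> r) \<in> carrier A" "d \<in> carrier A" "x j \<in> carrier A"
      "mon \<beta> \<in> carrier A" "h \<in> carrier A"
      using r \<tau>r d coeff_closed var[OF j(1)] mon_closed span_closed[OF h(1)] by blast+
    have "mon \<alpha> \<otimes> r = x j \<otimes> (mon \<beta> \<otimes> r)" using cl by (simp add: m1 m_assoc)
    also have "\<dots> = (x j \<otimes> \<tau> r) \<otimes> mon \<beta> \<oplus> x j \<otimes> h"
      unfolding h(2) using cl by (simp add: r_distr m_assoc)
    also have "(x j \<otimes> \<tau> r) \<otimes> mon \<beta> = \<phi> (\<tau> r) \<otimes> mon \<alpha> \<oplus> d \<otimes> mon \<beta>"
      unfolding d(2) m1 using cl by (simp add: l_distr m_assoc)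
    finally have "mon \<alpha> \<otimes> r = \<phi> (\<tau> r) \<otimes> mon \<alpha> \<oplus> (d \<otimes> mon \<beta> \<oplus> x j \<otimes> h)"
      using cl mon_closed by (simp add: a_assoc)
    moreover have "x j \<otimes> h \<in> span (exps_below (deg \<alpha>))"
    proof (rule var_mult_span[OF j(1) h(1)])
      fix \<gamma> assume "\<gamma> \<in> exps_below (deg \<beta>)"
      then have \<gamma>: "\<gamma> \<in> exps n" "deg \<gamma> < deg \<beta>" by (auto simp: exps_below_def)
      then show "mon \<gamma> \<in> span (exps_below (deg \<alpha>)) \<and> x j \<otimes> mon \<gamma> \<in> span (exps_below (deg \<alpha>))"
        using incr_exps[OF \<gamma>(1) j(1)] deg_incr[OF j(1), of \<gamma>] deg
        by (intro conjI mon_in_span var_mon_in_span[OF \<gamma>(1) j(1)]) (auto simp: exps_below_def)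
    qed
    moreover have "d \<otimes> mon \<beta> \<in> span (exps_below (deg \<alpha>))"
      using d j deg by (intro span_monomial) (auto simp: exps_below_def)
    ultimately show ?thesis using span_add by blast
  qed
  then show ?case using twist_comp[OF \<phi>(1) \<tau>(1)] by blast
qed

end

section \<open>Leading coefficients\<close>

context bijective_skew_PBW_extension
begin

text \<open>The degree is prepended to the list of exponents, so that \<open>before\<close> is the degree lexicographic order.\<close>

definition key_entry :: "(nat \<Rightarrow> nat) \<Rightarrow> nat \<Rightarrow> nat"
  where "key_entry \<alpha> j = (if j = 0 then deg \<alpha> else \<alpha> j)"

definition key :: "(nat \<Rightarrow> nat) \<Rightarrow> nat list"
  where "key \<alpha> = map (key_entry \<alpha>) [0..<Suc n]"

definition before :: "(nat \<Rightarrow> nat) \<Rightarrow> (nat \<Rightarrow> nat) \<Rightarrow> bool"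
  where "before \<alpha> \<beta> \<longleftrightarrow> (key \<alpha>, key \<beta>) \<in> lex less_than"

definition lower :: "(nat \<Rightarrow> nat) \<Rightarrow> (nat \<Rightarrow> nat) set"
  where "lower \<alpha> = {\<beta> \<in> exps n. before \<beta> \<alpha>}"

lemma key_Cons: "key \<alpha> = deg \<alpha> # map (key_entry \<alpha>) [1..<Suc n]"
  by (simp add: key_def key_entry_def upt_conv_Cons del: upt_Suc)

lemma before_linear:
  assumes "\<alpha> \<in> exps n" "\<beta> \<in> exps n"
  shows "\<alpha> = \<beta> \<or> before \<alpha> \<beta> \<or> before \<beta> \<alpha>"
proof -
  have "\<alpha> = \<beta>" if k: "key \<alpha> = key \<beta>"
  proof -
    have "key_entry \<alpha> i = key_entry \<beta> i" if "i \<in> {1..n}" for i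
    proof -
      have "key \<alpha> ! i = key_entry \<alpha> i" "key \<beta> ! i = key_entry \<beta> i"
        using that unfolding key_def by (simp_all del: upt_Suc)
      then show ?thesis using k by simp
    qed
    then have "\<alpha> i = \<beta> i" if "i \<in> {1..n}" for i
      using that[THEN \<open>\<And>i. i \<in> {1..n} \<Longrightarrow> key_entry \<alpha> i = key_entry \<beta> i\<close>] that by (auto simp: key_entry_def)
    then show ?thesis using assms unfolding exps_def by (intro PiE_ext) auto
  qed
  moreover have "length (key \<alpha>) = length (key \<beta>)" by (simp add: key_def)
  ultimately show ?thesis
    using lex_less_than_linear[of "key \<alpha>" "key \<beta>"] by (auto simp: before_def)
qed

lemma before_trans: "before \<alpha> \<beta> \<Longrightarrow> before \<beta> \<gamma> \<Longrightarrow> before \<alpha> \<gamma>"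
  unfolding before_def using lex_transI[OF trans_less_than] by (rule transD)

lemma wf_before: "wf {(\<beta>, \<alpha>). before \<beta> \<alpha>}"
proof -
  have "{(\<beta>, \<alpha>). before \<beta> \<alpha>} = inv_image (lex less_than) key"
    by (auto simp: before_def inv_image_def)
  then show ?thesis by (simp add: wf_lex wf_inv_image)
qed

lemma before_degree: "deg \<alpha> < deg \<beta> \<Longrightarrow> before \<alpha> \<beta>"
  by (simp add: before_def key_Cons)

lemma degree_before: "before \<alpha> \<beta> \<Longrightarrow> deg \<alpha> \<le> deg \<beta>"
  by (auto simp: before_def key_Cons)

lemma before_incr:
  assumes "before \<alpha> \<beta>" "i \<in> {1..n}"
  shows "before (incr i \<alpha>) (incr i \<beta>)"
proof -
  \<comment> \<open>Raising one exponent adds the same vector to both keys: one in the degree entry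
    0 and one in entry \<open>i\<close>.\<close>
  define e where "e j = (if j = 0 \<or> j = i then 1 else 0::nat)" for j
  have "key_entry (incr i \<gamma>) = (\<lambda>j. key_entry \<gamma> j + e j)" for \<gamma>
    using assms(2) deg_incr[OF assms(2), of \<gamma>] by (auto simp: key_entry_def e_def incr_def)
  then show ?thesis
    using lex_map_add[of "key_entry \<alpha>" "[0..<Suc n]" "key_entry \<beta>" e] assms(1)
    by (simp add: before_def key_def del: upt_Suc)
qed

lemma exps_below_lower: "q \<le> deg \<alpha> \<Longrightarrow> exps_below q \<subseteq> lower \<alpha>"
  by (auto simp: exps_below_def lower_def intro: before_degree)

lemma var_mult_lower:
  assumes "h \<in> span (lower \<alpha>)" "i \<in> {1..n}"
  shows "x i \<otimes> h \<in> span (lower (incr i \<alpha>))"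
proof (rule var_mult_span[OF assms(2,1)])
  fix \<beta> assume "\<beta> \<in> lower \<alpha>"
  then have \<beta>: "\<beta> \<in> exps n" "before \<beta> \<alpha>" "deg \<beta> \<le> deg \<alpha>"
    using degree_before by (auto simp: lower_def)
  have d: "deg (incr i \<alpha>) = Suc (deg \<alpha>)" using assms(2) by (rule deg_incr)
  have "\<beta> \<in> lower (incr i \<alpha>)" "incr i \<beta> \<in> lower (incr i \<alpha>)"
    using \<beta> d before_degree[of \<beta> "incr i \<alpha>"] before_incr[OF \<beta>(2) assms(2)] incr_exps[OF \<beta>(1) assms(2)]
    by (auto simp: lower_def)
  moreover have "exps_below (Suc (deg \<beta>)) \<subseteq> lower (incr i \<alpha>)"
    using \<beta> d by (intro exps_below_lower) simp
  ultimately show "mon \<beta> \<in> span (lower (incr i \<alpha>)) \<and> x i \<otimes> mon \<beta> \<in> span (lower (incr i \<alpha>))"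
    using mon_in_span var_mon_in_span[OF \<beta>(1) assms(2)] by blast
qed

lemma rmult_lower:
  assumes h: "h \<in> span (lower \<alpha>)" and s: "s \<in> R"
  shows "h \<otimes> s \<in> span (lower \<alpha>)"
proof (rule span_map[OF h])
  fix r \<beta> assume r: "r \<in> R" and "\<beta> \<in> lower \<alpha>"
  then have \<beta>: "\<beta> \<in> exps n" "\<beta> \<in> lower \<alpha>" "deg \<beta> \<le> deg \<alpha>"
    using degree_before by (auto simp: lower_def)
  obtain \<tau> g where \<tau>: "twist \<tau>" "g \<in> span (exps_below (deg \<beta>))" "mon \<beta> \<otimes> s = \<tau> s \<otimes> mon \<beta> \<oplus> g"
    using mon_twist[OF \<beta>(1)] s by blast
  have \<tau>s: "\<tau> s \<in> R" using twist_closed \<tau>(1) s by blast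
  have g: "g \<in> span (lower \<alpha>)" using span_mono[OF \<tau>(2) exps_below_lower[OF \<beta>(3)]] .
  have "(r \<otimes> mon \<beta>) \<otimes> s = r \<otimes> (mon \<beta> \<otimes> s)"
    using r s coeff_closed mon_closed by (simp add: m_assoc)
  also have "\<dots> \<in> span (lower \<alpha>)"
    unfolding \<tau>(3) using r \<tau>s g \<beta>(2) span_lmult[OF r] span_add span_monomial by blast
  finally show "(r \<otimes> mon \<beta>) \<otimes> s \<in> span (lower \<alpha>)" .
qed (use s in \<open>simp_all add: coeff_closed l_distr\<close>)

text \<open>With coefficients on the left, multiplication by \<open>x i\<close> would apply the
  endomorphism of \<open>x i\<close> to them, and the coefficient sets would not be nested. On the
  right a coefficient is only multiplied from the left by a unit, which a left ideal
  absorbs.\<close>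

definition lead_coeffs :: "(nat \<Rightarrow> nat) \<Rightarrow> 'a set \<Rightarrow> 'a set"
  where "lead_coeffs \<alpha> I = {r \<in> R. \<exists>h\<in>span (lower \<alpha>). mon \<alpha> \<otimes> r \<oplus> h \<in> I}"

lemma lead_coeffs_left_ideal:
  assumes I: "lideal A I" and \<alpha>: "\<alpha> \<in> exps n"
  shows "lead_coeffs \<alpha> I \<in> left_ideals (A\<lparr>carrier := R\<rparr>)"
proof -
  interpret S: ring "A\<lparr>carrier := R\<rparr>" by (rule subring_is_ring[OF subring_axioms])
  note mc = mon_closed[of \<alpha>]
  have "lideal (A\<lparr>carrier := R\<rparr>) (lead_coeffs \<alpha> I)"
  proof (rule S.lidI, simp_all)
    show "lead_coeffs \<alpha> I \<subseteq> R" by (auto simp: lead_coeffs_def)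
    show "\<zero> \<in> lead_coeffs \<alpha> I"
      using lid_zero[OF I] mc subringE(2)[OF subring_axioms]
      by (auto simp: lead_coeffs_def intro!: bexI[of _ \<zero>] span_zero)
    fix r s assume s: "s \<in> lead_coeffs \<alpha> I"
    then obtain h where h: "s \<in> R" "h \<in> span (lower \<alpha>)" "mon \<alpha> \<otimes> s \<oplus> h \<in> I"
      by (auto simp: lead_coeffs_def)
    note cl = coeff_closed[OF h(1)] span_closed[OF h(2)] mc
    show "r \<oplus> s \<in> lead_coeffs \<alpha> I" if r: "r \<in> lead_coeffs \<alpha> I"
    proof -
      obtain g where g: "r \<in> R" "g \<in> span (lower \<alpha>)" "mon \<alpha> \<otimes> r \<oplus> g \<in> I"
        using r by (auto simp: lead_coeffs_def)
      have "(mon \<alpha> \<otimes> r \<oplus> g) \<oplus> (mon \<alpha> \<otimes> s \<oplus> h) = mon \<alpha> \<otimes> (r \<oplus> s) \<oplus> (g \<oplus> h)"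
        using cl coeff_closed[OF g(1)] span_closed[OF g(2)] by (simp add: r_distr a_ac)
      then have "mon \<alpha> \<otimes> (r \<oplus> s) \<oplus> (g \<oplus> h) \<in> I"
        using lid_add[OF I g(3) h(3)] by simp
      moreover have "r \<oplus> s \<in> R" using subringE(7)[OF subring_axioms] g h by simp
      ultimately show ?thesis
        using span_add[OF g(2) h(2)] by (auto simp: lead_coeffs_def)
    qed
    show "r \<otimes> s \<in> lead_coeffs \<alpha> I" if r: "r \<in> R"
    proof -
      obtain \<tau> g where \<tau>: "twist \<tau>" "g \<in> span (exps_below (deg \<alpha>))" "mon \<alpha> \<otimes> r = \<tau> r \<otimes> mon \<alpha> \<oplus> g"
        using mon_twist[OF \<alpha>] r by blast
      have \<tau>r: "\<tau> r \<in> R" using twist_closed \<tau>(1) r by blast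
      have g: "g \<in> span (lower \<alpha>)" using span_mono[OF \<tau>(2) exps_below_lower] by simp
      note cl = cl coeff_closed[OF r] coeff_closed[OF \<tau>r] span_closed[OF g]
      \<comment> \<open>Multiplying an element with leading coefficient \<open>s\<close> by
        \<open>\<tau> r\<close> on the left produces the leading coefficient
        \<open>r \<otimes> s\<close>, because \<open>mon \<alpha>\<close> turns \<open>r\<close>
        into \<open>\<tau> r\<close>.\<close>
      have "mon \<alpha> \<otimes> (r \<otimes> s) \<oplus> (\<ominus> (g \<otimes> s) \<oplus> \<tau> r \<otimes> h) =
        (mon \<alpha> \<otimes> r) \<otimes> s \<oplus> (\<ominus> (g \<otimes> s) \<oplus> \<tau> r \<otimes> h)"
        using cl by (simp add: m_assoc)
      also have "\<dots> = \<tau> r \<otimes> (mon \<alpha> \<otimes> s \<oplus> h)"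
        unfolding \<tau>(3) using cl by (simp add: l_distr r_distr m_assoc a_assoc r_neg1 r_neg2)
      finally have "mon \<alpha> \<otimes> (r \<otimes> s) \<oplus> (\<ominus> (g \<otimes> s) \<oplus> \<tau> r \<otimes> h) \<in> I"
        using lid_mult[OF I coeff_closed[OF \<tau>r] h(3)] by simp
      moreover have "\<ominus> (g \<otimes> s) \<oplus> \<tau> r \<otimes> h \<in> span (lower \<alpha>)"
        by (intro span_add span_uminus rmult_lower span_lmult g h \<tau>r)
      moreover have "r \<otimes> s \<in> R" using subringE(6)[OF subring_axioms] r h by simp
      ultimately show ?thesis by (auto simp: lead_coeffs_def)
    qed
  qed
  then show ?thesis by (simp add: lideal_def)
qed

lemma lead_coeffs_incr:
  assumes I: "lideal A I" and \<alpha>: "\<alpha> \<in> exps n" and i: "i \<in> {1..n}"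
  shows "lead_coeffs \<alpha> I \<subseteq> lead_coeffs (incr i \<alpha>) I"
proof
  interpret S: ring "A\<lparr>carrier := R\<rparr>" by (rule subring_is_ring[OF subring_axioms])
  let ?\<alpha> = "incr i \<alpha>"
  fix r assume "r \<in> lead_coeffs \<alpha> I"
  then obtain h where h: "r \<in> R" "h \<in> span (lower \<alpha>)" "mon \<alpha> \<otimes> r \<oplus> h \<in> I"
    by (auto simp: lead_coeffs_def)
  obtain c g where c: "unit_coeff c" "g \<in> span (exps_below (Suc (deg \<alpha>)))" "x i \<otimes> mon \<alpha> = c \<otimes> mon ?\<alpha> \<oplus> g"
    using var_mon_general[OF \<alpha> i] by blast
  have g: "g \<in> span (lower ?\<alpha>)"
    using span_mono[OF c(2) exps_below_lower[of _ ?\<alpha>]] deg_incr[OF i] by simp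
  obtain d where d: "c \<in> R" "d \<in> R" "d \<otimes> c = \<one>" using c(1) by (auto simp: unit_coeff_def)
  obtain \<tau> where \<tau>: "twist \<tau>" "\<And>r. r \<in> R \<Longrightarrow> \<exists>h\<in>span (exps_below (deg ?\<alpha>)). mon ?\<alpha> \<otimes> r = \<tau> r \<otimes> mon ?\<alpha> \<oplus> h"
    using mon_twist[OF incr_exps[OF \<alpha> i]] by blast
  \<comment> \<open>The unit \<open>c\<close> appears to the left of the monomial. Surjectivity of
    the twist moves it to the right as \<open>c'\<close>, whose left inverse \<open>d'\<close> then
    recovers \<open>r\<close> from \<open>c' \<otimes> r\<close>.\<close>
  obtain c' d' where c': "c' \<in> R" "\<tau> c' = c" and d': "d' \<in> R" "\<tau> d' = d"
    using twist_surj[OF \<tau>(1)] d by metis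
  have "d' \<otimes> c' \<in> R" "\<tau> (d' \<otimes> c') = \<tau> \<one>"
    using \<tau>(1) c' d' d subringE(6)[OF subring_axioms] by (auto simp: twist_def)
  then have dc: "d' \<otimes> c' = \<one>"
    using \<tau>(1) subringE(3)[OF subring_axioms] unfolding twist_def bij_betw_def inj_on_def by blast
  obtain f where f: "f \<in> span (exps_below (deg ?\<alpha>))" "mon ?\<alpha> \<otimes> c' = c \<otimes> mon ?\<alpha> \<oplus> f"
    using \<tau>(2)[OF c'(1)] c'(2) by auto
  have f': "f \<in> span (lower ?\<alpha>)" using span_mono[OF f(1) exps_below_lower] by simp
  note cl = coeff_closed[OF h(1)] span_closed[OF h(2)] mon_closed coeff_closed[OF d(1)] coeff_closed[OF c'(1)]
    coeff_closed[OF d'(1)] span_closed[OF f'] span_closed[OF g] var[OF i]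
  let ?h = "\<ominus> (f \<otimes> r) \<oplus> (g \<otimes> r \<oplus> x i \<otimes> h)"
  have "mon ?\<alpha> \<otimes> (c' \<otimes> r) \<oplus> ?h = (mon ?\<alpha> \<otimes> c') \<otimes> r \<oplus> ?h"
    using cl by (simp add: m_assoc)
  also have "\<dots> = (c \<otimes> mon ?\<alpha> \<oplus> g) \<otimes> r \<oplus> x i \<otimes> h"
    unfolding f(2) using cl by (simp add: l_distr a_assoc r_neg1 r_neg2)
  also have "\<dots> = x i \<otimes> (mon \<alpha> \<otimes> r \<oplus> h)"
    unfolding c(3)[symmetric] using cl by (simp add: r_distr m_assoc)
  finally have "mon ?\<alpha> \<otimes> (c' \<otimes> r) \<oplus> ?h \<in> I"
    using lid_mult[OF I var[OF i] h(3)] by simp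
  moreover have "?h \<in> span (lower ?\<alpha>)"
    by (intro span_add span_uminus rmult_lower var_mult_lower f' g h i)
  moreover have "c' \<otimes> r \<in> R" using subringE(6)[OF subring_axioms] c' h by simp
  ultimately have "c' \<otimes> r \<in> lead_coeffs ?\<alpha> I" by (auto simp: lead_coeffs_def)
  moreover have "lideal (A\<lparr>carrier := R\<rparr>) (lead_coeffs ?\<alpha> I)"
    using lead_coeffs_left_ideal[OF I incr_exps[OF \<alpha> i]] by (simp add: lideal_def)
  ultimately have "d' \<otimes> (c' \<otimes> r) \<in> lead_coeffs ?\<alpha> I"
    using S.lid_mult d'(1) by fastforce
  moreover have "d' \<otimes> (c' \<otimes> r) = r"
    using cl dc m_assoc[of d' c' r] by simp
  ultimately show "r \<in> lead_coeffs ?\<alpha> I" by simp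
qed

section \<open>Recovering a left ideal from its leading coefficients\<close>

lemma span_top:
  assumes "f \<in> span (insert \<alpha> E)"
  shows "\<exists>r\<in>R. \<exists>h\<in>span E. f = r \<otimes> mon \<alpha> \<oplus> h"
  using assms
proof (induction rule: span.induct)
  case span_zero
  show ?case
    using subringE(2)[OF subring_axioms] mon_closed by (intro bexI[of _ \<zero>]) (auto intro: span.span_zero)
next
  case (span_step r \<beta> g)
  then obtain s h where *: "s \<in> R" "h \<in> span E" "g = s \<otimes> mon \<alpha> \<oplus> h" by blast
  note cl = coeff_closed[OF *(1)] coeff_closed[OF span_step(1)] span_closed[OF *(2)] mon_closed
  show ?case
  proof (cases "\<beta> = \<alpha>")
    case True
    have "r \<otimes> mon \<beta> \<oplus> g = (r \<oplus> s) \<otimes> mon \<alpha> \<oplus> h"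
      using cl by (simp add: True * l_distr a_assoc)
    moreover have "r \<oplus> s \<in> R" using subringE(7)[OF subring_axioms] span_step * by simp
    ultimately show ?thesis using * by blast
  next
    case False
    have "r \<otimes> mon \<beta> \<oplus> g = s \<otimes> mon \<alpha> \<oplus> (r \<otimes> mon \<beta> \<oplus> h)"
      using cl by (simp add: * a_lcomm)
    moreover have "r \<otimes> mon \<beta> \<oplus> h \<in> span E" using False span_step * by (intro span.span_step) auto
    ultimately show ?thesis using * by blast
  qed
qed

text \<open>Summands are added one by one. As the order is total on exponents, either the new
  exponent or the previous leading one dominates all the others.\<close>

lemma span_leading:
  assumes "h \<in> span E" "E \<subseteq> exps n"
  shows "h = \<zero> \<or> (\<exists>\<beta>\<in>E. h \<in> span (insert \<beta> (lower \<beta>)))"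
  using assms(1)
proof (induction rule: span.induct)
  case (span_step r \<beta> h)
  have \<beta>: "\<beta> \<in> exps n" using span_step assms(2) by blast
  show ?case
  proof (cases "h = \<zero>")
    case True
    then have "r \<otimes> mon \<beta> \<oplus> h \<in> span (insert \<beta> (lower \<beta>))"
      using span_step by (intro span.span_step) (auto intro: span_zero)
    then show ?thesis using span_step by blast
  next
    case False
    then obtain \<gamma> where \<gamma>: "\<gamma> \<in> E" "h \<in> span (insert \<gamma> (lower \<gamma>))" using span_step by blast
    have \<gamma>': "\<gamma> \<in> exps n" using \<gamma> assms(2) by blast
    show ?thesis
    proof (cases "before \<gamma> \<beta>")
      case True
      have "h \<in> span (insert \<beta> (lower \<beta>))"
        using \<gamma>(2) by (rule span_mono) (use True \<gamma>' before_trans in \<open>auto simp: lower_def\<close>)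
      then have "r \<otimes> mon \<beta> \<oplus> h \<in> span (insert \<beta> (lower \<beta>))"
        using span_step by (intro span.span_step) auto
      then show ?thesis using span_step by blast
    next
      case False
      then have "\<beta> \<in> insert \<gamma> (lower \<gamma>)"
        using before_linear[OF \<beta> \<gamma>'] \<beta> by (auto simp: lower_def)
      then have "r \<otimes> mon \<beta> \<oplus> h \<in> span (insert \<gamma> (lower \<gamma>))"
        using span_step \<gamma> by (intro span.span_step) auto
      then show ?thesis using \<gamma> by blast
    qed
  qed
qed simp

lemma carrier_span:
  assumes "f \<in> carrier A"
  shows "f \<in> span (exps n)"
proof -
  have "\<exists>!c. c \<in> exps n \<rightarrow>\<^sub>E R \<and> finite {i \<in> exps n. c i \<noteq> \<zero>} \<and>
    f = (\<Oplus>\<^bsub>self_module A\<^esub>i\<in>{i \<in> exps n. c i \<noteq> \<zero>}. c i \<otimes> mon i)"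
    using monomial_basis assms by (simp add: is_left_basis_def self_module_simps exps_def)
  from ex1_implies_ex[OF this] obtain c where c: "c \<in> exps n \<rightarrow>\<^sub>E R" "finite {i \<in> exps n. c i \<noteq> \<zero>}"
    "f = (\<Oplus>\<^bsub>self_module A\<^esub>i\<in>{i \<in> exps n. c i \<noteq> \<zero>}. c i \<otimes> mon i)" by blast
  show ?thesis
    unfolding c(3) finsum_self_module
    by (rule span_finsum[OF c(2)]) (use c(1) in \<open>auto simp: PiE_iff intro!: span_monomial\<close>)
qed

text \<open>Well-founded induction on the leading exponent: from an element of the larger ideal one
  subtracts an element of the smaller ideal with the same leading coefficient, and the difference
  involves only earlier monomials.\<close>

lemma lead_coeffs_strict:
  assumes I: "lideal A I" "lideal A I'" "I \<subseteq> I'"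
    and eq: "\<And>\<alpha>. \<alpha> \<in> exps n \<Longrightarrow> lead_coeffs \<alpha> I = lead_coeffs \<alpha> I'"
  shows "I = I'"
proof -
  have main: "f \<in> I" if "\<alpha> \<in> exps n" "f \<in> I'" "f \<in> span (insert \<alpha> (lower \<alpha>))" for \<alpha> f
    using that
  proof (induction \<alpha> arbitrary: f rule: wf_induct_rule[OF wf_before])
    case (1 \<alpha>)
    note \<alpha> = 1(2) and f = 1(3,4)
    obtain r h where r: "r \<in> R" "h \<in> span (lower \<alpha>)" "f = r \<otimes> mon \<alpha> \<oplus> h"
      using span_top[OF f(2)] by blast
    obtain \<tau> where \<tau>: "twist \<tau>" "\<And>r. r \<in> R \<Longrightarrow> \<exists>h\<in>span (exps_below (deg \<alpha>)). mon \<alpha> \<otimes> r = \<tau> r \<otimes> mon \<alpha> \<oplus> h"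
      using mon_twist[OF \<alpha>] by blast
    \<comment> \<open>The spanning set writes coefficients on the left, whereas leading coefficients
      stand on the right. Surjectivity of the twist converts one form into the other.\<close>
    obtain s where s: "s \<in> R" "\<tau> s = r" using twist_surj[OF \<tau>(1) r(1)] by blast
    obtain h1 where h1: "h1 \<in> span (exps_below (deg \<alpha>))" "mon \<alpha> \<otimes> s = r \<otimes> mon \<alpha> \<oplus> h1"
      using \<tau>(2)[OF s(1)] s(2) by blast
    have h1': "h1 \<in> span (lower \<alpha>)" using span_mono[OF h1(1) exps_below_lower] by simp
    note cl = coeff_closed[OF r(1)] span_closed[OF r(2)] mon_closed[of \<alpha>] coeff_closed[OF s(1)] span_closed[OF h1']
    have f_eq: "f = mon \<alpha> \<otimes> s \<oplus> (\<ominus> h1 \<oplus> h)"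
      unfolding h1(2) r(3) using cl by (simp add: a_assoc r_neg1 r_neg2)
    have hh: "\<ominus> h1 \<oplus> h \<in> span (lower \<alpha>)" by (intro span_add span_uminus h1' r)
    have "s \<in> lead_coeffs \<alpha> I'"
      using f(1) hh s(1) unfolding lead_coeffs_def f_eq by blast
    then have "s \<in> lead_coeffs \<alpha> I" using eq[OF \<alpha>] by simp
    then obtain h2 where h2: "h2 \<in> span (lower \<alpha>)" "mon \<alpha> \<otimes> s \<oplus> h2 \<in> I"
      by (auto simp: lead_coeffs_def)
    define g where "g = mon \<alpha> \<otimes> s \<oplus> h2"
    have gI: "g \<in> I" "g \<in> I'" using h2 I(3) by (auto simp: g_def)
    have fc: "f \<in> carrier A" and gc: "g \<in> carrier A" using f gI I lid_closed by blast+
    have h2c: "h2 \<in> carrier A" using span_closed[OF h2(1)] .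
    have "f \<ominus> g = (\<ominus> h1 \<oplus> h) \<oplus> \<ominus> h2"
    proof -
      have "(mon \<alpha> \<otimes> s \<oplus> (\<ominus> h1 \<oplus> h)) \<oplus> \<ominus> (mon \<alpha> \<otimes> s \<oplus> h2) =
        (\<ominus> h1 \<oplus> h) \<oplus> (mon \<alpha> \<otimes> s \<oplus> \<ominus> (mon \<alpha> \<otimes> s)) \<oplus> \<ominus> h2"
        using cl h2c by (simp add: minus_add a_ac)
      then show ?thesis using cl h2c by (simp add: f_eq g_def minus_eq r_neg)
    qed
    then have "f \<ominus> g \<in> span (lower \<alpha>)"
      using span_add[OF hh span_uminus[OF h2(1)]] by simp
    moreover have "lower \<alpha> \<subseteq> exps n" by (auto simp: lower_def)
    ultimately have "f \<ominus> g = \<zero> \<or> (\<exists>\<beta>\<in>lower \<alpha>. f \<ominus> g \<in> span (insert \<beta> (lower \<beta>)))"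
      by (rule span_leading)
    moreover have "f \<ominus> g \<in> I'" using lid_minus[OF I(2) f(1) gI(2)] .
    ultimately have "f \<ominus> g \<in> I"
      using 1(1) lid_zero[OF I(1)] by (auto simp: lower_def)
    then have "(f \<ominus> g) \<oplus> g \<in> I" using gI I lid_add by blast
    then show "f \<in> I" using fc gc by (simp add: minus_eq a_assoc l_neg)
  qed
  have "f \<in> I" if f: "f \<in> I'" for f
  proof -
    have "f = \<zero> \<or> (\<exists>\<beta>\<in>exps n. f \<in> span (insert \<beta> (lower \<beta>)))"
      using span_leading[OF carrier_span] f I(2) lid_closed by blast
    then show ?thesis using main f lid_zero[OF I(1)] by blast
  qed
  then show ?thesis using I(3) by blast
qed

text \<open>One strictly increasing map gives both Hilbert's basis theorem for the extension and the
  bound on its Krull dimension.\<close>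

lemma acc_dev_less_extension:
  assumes "acc (left_ideals (A\<lparr>carrier := R\<rparr>))" "dev_less k (left_ideals (A\<lparr>carrier := R\<rparr>))"
  shows "acc (Collect (lideal A))" "dev_less (k + n) (Collect (lideal A))"
proof -
  define f where "f I = {(\<alpha>, r). \<alpha> \<in> exps n \<and> r \<in> lead_coeffs \<alpha> I}" for I
  have sl: "slice (f I) \<alpha> = (if \<alpha> \<in> exps n then lead_coeffs \<alpha> I else {})" for I \<alpha>
    by (auto simp: slice_def f_def)
  have 1: "f I \<in> mono_maps n (left_ideals (A\<lparr>carrier := R\<rparr>))" if "I \<in> Collect (lideal A)" for I
  proof -
    have I: "lideal A I" using that by simp
    show ?thesis
      unfolding mono_maps_def mem_Collect_eq sl
    proof (intro conjI ballI allI impI)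
      fix \<alpha> i assume \<alpha>: "\<alpha> \<in> exps n" "i \<in> {1..n}"
      have "(if incr i \<alpha> \<in> exps n then lead_coeffs (incr i \<alpha>) I else {}) = lead_coeffs (incr i \<alpha>) I"
        using incr_exps[OF \<alpha>] by simp
      then show "(if \<alpha> \<in> exps n then lead_coeffs \<alpha> I else {}) \<subseteq>
        (if \<alpha>(i := Suc (\<alpha> i)) \<in> exps n then lead_coeffs (\<alpha>(i := Suc (\<alpha> i))) I else {})"
        using lead_coeffs_incr[OF I \<alpha>] \<alpha>(1) unfolding incr_def by simp
    qed (simp_all add: lead_coeffs_left_ideal[OF I])
  qed
  have 2: "f I \<subseteq> f I'" if "I \<subseteq> I'" for I I'
    using that by (auto simp: f_def lead_coeffs_def)
  have 3: "I = I'" if "I \<in> Collect (lideal A)" "I' \<in> Collect (lideal A)" "I \<subseteq> I'" "f I = f I'" for I I'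
  proof (rule lead_coeffs_strict)
    fix \<alpha> assume "\<alpha> \<in> exps n"
    then show "lead_coeffs \<alpha> I = lead_coeffs \<alpha> I'"
      using sl[of I \<alpha>] sl[of I' \<alpha>] that(4) by simp
  qed (use that in auto)
  note mm = acc_dev_less_mono_maps[OF assms, of n]
  show "acc (Collect (lideal A))"
    by (rule acc_transfer[where f = f, OF conjunct1[OF mm]]) (rule 1 2 3; assumption)+
  show "dev_less (k + n) (Collect (lideal A))"
    by (rule dev_less_transfer[where f = f, OF conjunct2[OF mm]]) (rule 1 2 3; assumption)+
qed

end

text \<open>Over the zero ring all free powers have a single element, so the first power would map
  onto the second one.\<close>

lemma rank_condition_imp_nonzero:
  assumes "ring S" "rank_condition S"
  shows "\<one>\<^bsub>S\<^esub> \<noteq> \<zero>\<^bsub>S\<^esub>"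
proof
  interpret ring S by fact
  assume "\<one>\<^bsub>S\<^esub> = \<zero>\<^bsub>S\<^esub>"
  then have S: "carrier S = {\<zero>\<^bsub>S\<^esub>}" by (rule one_zeroD)
  have c: "carrier (free_power S r) = {\<lambda>i\<in>{1..r}. \<zero>\<^bsub>S\<^esub>}" for r
  proof (rule subset_antisym; rule subsetI)
    fix u assume "u \<in> carrier (free_power S r)"
    then have u: "u \<in> {1..r} \<rightarrow>\<^sub>E {\<zero>\<^bsub>S\<^esub>}" by (simp add: free_power_simps S)
    have "u = (\<lambda>i\<in>{1..r}. \<zero>\<^bsub>S\<^esub>)"
      by (rule PiE_ext[OF u]) (use u in auto)
    then show "u \<in> {\<lambda>i\<in>{1..r}. \<zero>\<^bsub>S\<^esub>}" by simp
  qed (simp add: free_power_simps)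
  let ?f = "\<lambda>_::nat \<Rightarrow> 'a. (\<lambda>i\<in>{1..2::nat}. \<zero>\<^bsub>S\<^esub>)"
  have "?f \<in> left_module_hom S (free_power S 1) (free_power S 2)"
    by (rule left_module_homI) (simp_all add: free_power_simps cong: restrict_cong)
  moreover have "?f ` carrier (free_power S 1) = carrier (free_power S 2)"
    by (simp add: c)
  ultimately have "(2::nat) \<le> 1"
    using assms(2) unfolding rank_condition_def by (metis one_le_numeral order_refl)
  then show False by simp
qed

theorem theorem3p8:
  fixes A :: "('a, 's) ring_scheme" and R :: "'a set" and n :: nat and x :: "nat \<Rightarrow> 'a"
  assumes "bijective_skew_PBW_extension A R n x"
    and "rank_condition (A\<lparr>carrier := R\<rparr>)"
    and "rank_condition A"
    and "left_noetherian (A\<lparr>carrier := R\<rparr>)"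
    and "has_finite_lKdim (A\<lparr>carrier := R\<rparr>)"
  shows "1 \<le> stable_rank A \<and>
    stable_rank A \<le> enat (nat (lKdim (A\<lparr>carrier := R\<rparr>) + int n + 1)) \<and>
    hermite TYPE('m) A (nat (lKdim (A\<lparr>carrier := R\<rparr>) + int n + 1))"
proof -
  interpret bijective_skew_PBW_extension A R n x by fact
  interpret S: ring "A\<lparr>carrier := R\<rparr>" by (rule subring_is_ring[OF subring_axioms])
  let ?L = "left_ideals (A\<lparr>carrier := R\<rparr>)"
  define k where "k = (LEAST k. dev_less k ?L)"
  have dev: "dev_less k ?L"
    using assms(5) unfolding has_finite_lKdim_def k_def by (rule LeastI_ex)
  have acc: "acc ?L"
    using assms(4) by (simp add: left_noetherian_def acc_def)
  have ne: "\<one>\<^bsub>A\<^esub> \<noteq> \<zero>\<^bsub>A\<^esub>"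
    using rank_condition_imp_nonzero[OF ring_axioms assms(3)] .
  \<comment> \<open>The zero ideal and the whole ring are distinct comparable left ideals. This
    yields \<open>1 \<le> d\<close>, which the definition of the stable rank demands of an
    admissible length.\<close>
  have "k \<noteq> 0"
  proof
    assume "k = 0"
    moreover have "{\<zero>\<^bsub>A\<^esub>} \<in> ?L" "R \<in> ?L"
      using S.lid_trivial S.lid_carrier_self by (simp_all add: lideal_def)
    moreover have "{\<zero>\<^bsub>A\<^esub>} \<subseteq> R" using subringE(2)[OF subring_axioms] by simp
    ultimately have "{\<zero>\<^bsub>A\<^esub>} = R" using dev by simp
    then show False using ne subringE(3)[OF subring_axioms] by blast
  qed
  define d where "d = k + n"
  \<comment> \<open>The definition of \<open>lKdim\<close> subtracts 1 from the least index
    \<open>k\<close>, and the summand 1 of the bound restores it.\<close>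
  have d: "nat (lKdim (A\<lparr>carrier := R\<rparr>) + int n + 1) = d"
    by (simp add: lKdim_def k_def[symmetric] d_def nat_add_distrib)
  interpret left_noetherian_ring A
    by (intro left_noetherian_ring.intro ring_axioms left_noetherian_ring_axioms.intro
        acc_dev_less_extension(1)[OF acc dev])
  \<comment> \<open>Raising the index of \<open>dev_less\<close> from \<open>d\<close> to
    \<open>m\<close> covers every length above \<open>d\<close>: the stable rank uses only
    \<open>m = d\<close>, the cancellation argument all larger \<open>m\<close> as well.\<close>
  have stable: "stable_column A (Suc m) v" if "d \<le> m" "unimodular_column A (Suc m) v" for m v
    using unimodular_stable[OF dev_less_mono[OF acc_dev_less_extension(2)[OF acc dev]], of m v] that
    by (simp add: d_def)
  have "1 \<le> stable_rank A"
    unfolding stable_rank_def by (rule Inf_greatest) (auto simp: one_enat_def)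
  moreover have "stable_rank A \<le> enat d"
    unfolding stable_rank_def
    by (rule Inf_lower) (use stable[of d] \<open>k \<noteq> 0\<close> in \<open>auto simp: d_def\<close>)
  moreover have "hermite TYPE('m) A d"
    unfolding hermite_def using stably_free_imp_free[OF ne stable] by blast
  ultimately show ?thesis by (simp add: d)
qed

end
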